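(* Let $\gamma\in(1/3,1/2]$, $\mathbf{X}=(X,\mathbb{X})\in\mathscr{C}^\gamma(\mathbb{R}_+,\mathbb{R}^d)$, $T>0$, $\xi\in\mathcal{H}$, $F\in C^2_{-2\gamma,0}(\mathcal{H},\mathcal{H}^d)$ and $N\in\mathrm{Poly}^{0,n}_{0,-\delta}(\mathcal{H})$ for some $n\ge1$ and $1-\delta>\gamma$. A pair $(u,F(u))\in\mathscr{D}^{2\gamma,2\gamma,0}_{S,X}([0,T],\mathcal{H}_{-2\gamma})$ with $u_0=\xi$ satisfies, for all $0\le t\le T$, $$u_t=S_t\xi+\int_0^tS_{t-r}N(u_r)dr+\int_0^tS_{t-r}F(u_r)d\mathbf{X}_r$$ (mild solution) if and only if for every $h\in\mathcal{H}_1$ and $0\le t\le T$ $$\langle u_t,h\rangle=\langle u_0,h\rangle+\int_0^t\langle u_s,Lh\rangle ds+\int_0^t\langle N(u_s),h\rangle ds+\int_0^t\langle F(u_s),h\rangle d\mathbf{X}_s$$ (weak solution).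
   Context: Let $\mathcal{H}$ be a separable real Hilbert space, $L$ selfadjoint with $\langle u,Lu\rangle\le c\langle u,u\rangle$ for some $c<0$, $S_t=e^{Lt}$, $\mathcal{H}_\alpha$ the interpolation spaces (norm $\|(-L)^\alpha\cdot\|$, negative indices by completion); $\langle\cdot,\cdot\rangle$ extends to a pairing $\mathcal{H}_{-\alpha}\times\mathcal{H}_\alpha\to\mathbb{R}$; $\mathcal{H}^d_\alpha=\mathcal{L}(\mathbb{R}^d,\mathcal{H}_\alpha)$. $C^k_{\alpha,\beta}(\mathcal{H}^m,\mathcal{H}^n)$: maps $k$ times Fréchet differentiable $\mathcal{H}^m_\theta\to\mathcal{H}^n_{\theta+\beta}$ for all $\theta\ge\alpha$ with derivatives bounded on bounded sets. $\mathrm{Poly}^{k,n}_{\alpha,\beta}(\mathcal{H})$: $N\in C^k_{\alpha,\beta}(\mathcal{H})$ with $\|D^iN(x)-D^iN(y)\|_{\mathcal{L}(\mathcal{H}_\sigma^{\otimes i},\mathcal{H}_{\sigma+\beta})}\le C_{\sigma,i}\|x-y\|_\sigma(1+\|x\|_\sigma+\|y\|_\sigma)^{n-i-1}$. Rough paths $\mathscr{C}^\gamma$: closure of smooth pairs satisfying Chen's relations $X_{t,s}=X_{t,u}+X_{u,s}$, $\mathbb{X}_{t,s}-\mathbb{X}_{t,u}-\mathbb{X}_{u,s}=X_{t,u}\otimes X_{u,s}$ under $\varrho_\gamma(\mathbf{X},\tilde{\mathbf{X}})=|X-\tilde X|_\gamma+|\mathbb{X}-\tilde{\mathbb{X}}|_{2\gamma}$;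 $\mathscr{C}^\gamma(\mathbb{R}_+)$: in $\mathscr{C}^\gamma([0,T])$ for all $T$. $\mathscr{D}^{2\gamma,2\gamma,0}_{S,X}([0,T],\mathcal{H}_{-2\gamma})$: pairs $(Y,Y')$ with $Y\in L^\infty(\mathcal{H})$, $Y'\in L^\infty(\mathcal{H}^d)$, such that in $\mathcal{H}_{-2\gamma}$ the increments $Y_t-S_{t-s}Y_s$, $Y'_t-S_{t-s}Y'_s$ are $O(|t-s|^\gamma)$ and $Y_t-S_{t-s}Y_s-S_{t-s}Y'_sX_{t,s}=O(|t-s|^{2\gamma})$, uniformly. The integrand $F(u)$ has Gubinelli derivative $DF(u)F(u)$; rough convolution $\int_0^tS_{t-r}F(u_r)d\mathbf{X}_r=\lim\sum S_{t-r}(F(u_r)X_{q,r}+DF(u_r)F(u_r)\mathbb{X}_{q,r})$. In the weak formulation, $s\mapsto\langle F(u_s),h\rangle$ is a usual controlled rough path with derivative $\langle DF(u_s)F(u_s),h\rangle$ and $\int\cdot\,d\mathbf{X}$ is the usual rough integral $\lim\sum(Z_uX_{v,u}+Z'_u\mathbb{X}_{v,u})$. *)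

theory Defs
  imports "HOL-Analysis.Analysis"
begin

text \<open>L is given by its values on its domain D.  Negative definite self-adjoint
  (densely defined, symmetric, and equal to its adjoint) with
  inner u (L u) \<le> c * inner u u for some c < 0.\<close>
definition neg_selfadjoint :: "('h::real_inner \<Rightarrow> 'h) \<Rightarrow> 'h set \<Rightarrow> bool" where
  "neg_selfadjoint L D \<longleftrightarrow>
     subspace D \<and> closure D = UNIV \<and>
     (\<forall>x\<in>D. \<forall>y\<in>D. \<forall>a b. L (a *\<^sub>R x + b *\<^sub>R y) = a *\<^sub>R L x + b *\<^sub>R L y) \<and>
     (\<forall>x\<in>D. \<forall>y\<in>D. inner (L x) y = inner x (L y)) \<and>
     (\<forall>y z. (\<forall>x\<in>D. inner (L x) y = inner x z) \<longrightarrow> y \<in> D \<and> L y = z) \<and>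
     (\<exists>c<0. \<forall>x\<in>D. inner x (L x) \<le> c * inner x x)"

definition generates :: "('h::real_normed_vector \<Rightarrow> 'h) \<Rightarrow> 'h set \<Rightarrow> (real \<Rightarrow> 'h \<Rightarrow> 'h) \<Rightarrow> bool" where
  "generates L D S \<longleftrightarrow>
     S 0 = id \<and> (\<forall>t\<ge>0. bounded_linear (S t)) \<and>
     (\<forall>t\<ge>0. \<forall>s\<ge>0. S (t + s) = S t \<circ> S s) \<and>
     (\<forall>x. continuous_on {0..} (\<lambda>t. S t x)) \<and>
     (\<forall>x. x \<in> D \<longleftrightarrow> (\<exists>y. ((\<lambda>t. S t x) has_vector_derivative y) (at 0 within {0..}))) \<and>
     (\<forall>x\<in>D. ((\<lambda>t. S t x) has_vector_derivative L x) (at 0 within {0..}))"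

text \<open>Negative fractional powers (-L)^(-alpha), alpha > 0 (Balakrishnan formula);
  (-L)^0 = id.\<close>
definition fracA :: "(real \<Rightarrow> 'h \<Rightarrow> 'h::real_normed_vector) \<Rightarrow> real \<Rightarrow> 'h \<Rightarrow> 'h" where
  "fracA S \<alpha> x = (if \<alpha> = 0 then x
      else integral {0<..} (\<lambda>t. (t powr (\<alpha> - 1) / Gamma \<alpha>) *\<^sub>R S t x))"

text \<open>For alpha \<ge> 0: the space H_alpha = D((-L)^alpha) = range of (-L)^(-alpha),
  with norm |(-L)^alpha w|.\<close>
definition Hsp :: "(real \<Rightarrow> 'h \<Rightarrow> 'h::real_normed_vector) \<Rightarrow> real \<Rightarrow> 'h set" where
  "Hsp S \<alpha> = range (fracA S \<alpha>)"

definition nrm :: "(real \<Rightarrow> 'h \<Rightarrow> 'h::real_normed_vector) \<Rightarrow> real \<Rightarrow> 'h \<Rightarrow> real" where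
  "nrm S \<alpha> w = norm (THE y. fracA S \<alpha> y = w)"

text \<open>The H_{-alpha} norm (alpha \<ge> 0) of an element v of H: |(-L)^(-alpha) v|.\<close>
definition nneg :: "(real \<Rightarrow> 'h \<Rightarrow> 'h::real_normed_vector) \<Rightarrow> real \<Rightarrow> 'h \<Rightarrow> real" where
  "nneg S \<alpha> v = norm (fracA S \<alpha> v)"

text \<open>Elements of H^d = L(R^d, H) are represented by their d columns.  The norm used
  is the sum of the column norms (equivalent to the operator norm).\<close>
definition Hvsp :: "(real \<Rightarrow> 'h \<Rightarrow> 'h::real_normed_vector) \<Rightarrow> real \<Rightarrow> ('h ^ 'd) set" where
  "Hvsp S \<alpha> = {g. \<forall>i. g $ i \<in> Hsp S \<alpha>}"

definition vnrm :: "(real \<Rightarrow> 'h \<Rightarrow> 'h::real_normed_vector) \<Rightarrow> real \<Rightarrow> 'h ^ 'd \<Rightarrow> real" where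
  "vnrm S \<alpha> g = (\<Sum>i\<in>UNIV. nrm S \<alpha> (g $ i))"

definition vnneg :: "(real \<Rightarrow> 'h \<Rightarrow> 'h::real_normed_vector) \<Rightarrow> real \<Rightarrow> 'h ^ 'd \<Rightarrow> real" where
  "vnneg S \<alpha> g = (\<Sum>i\<in>UNIV. nneg S \<alpha> (g $ i))"

text \<open>Coordinates.  Every H_theta with theta \<ge> -1 is realised inside H via the
  isometry (-L)^(-1): a (possibly distributional) element x of H_theta is represented by
  w = (-L)^(-1) x, which lies in Hsp S (theta + 1) with nrm S (theta+1) w = |x|_theta.
  enc maps v \<in> H to its coordinate, dec maps a coordinate in Hsp S 1 back to H.\<close>
definition enc :: "(real \<Rightarrow> 'h \<Rightarrow> 'h::real_normed_vector) \<Rightarrow> 'h \<Rightarrow> 'h" where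
  "enc S v = fracA S 1 v"

definition dec :: "(real \<Rightarrow> 'h \<Rightarrow> 'h::real_normed_vector) \<Rightarrow> 'h \<Rightarrow> 'h" where
  "dec S w = (THE v. fracA S 1 v = w)"

text \<open>F \<in> C^2_{alpha,beta}(H, H^d), given by its coordinate version Fc (acting on
  coordinates of H_alpha, alpha \<ge> -1) and first derivative DF: for every theta \<ge> alpha,
  Fc maps H_theta to H^d_{theta+beta}, is twice Frechet differentiable there
  (w.r.t. the theta-norms), and Fc, DF, D2F are bounded on bounded sets.\<close>
definition C2_class :: "(real \<Rightarrow> 'h \<Rightarrow> 'h::real_normed_vector) \<Rightarrow> real \<Rightarrow> real \<Rightarrow>
    ('h \<Rightarrow> 'h ^ 'd) \<Rightarrow> ('h \<Rightarrow> 'h \<Rightarrow> 'h ^ 'd) \<Rightarrow> bool" where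
  "C2_class S \<alpha> \<beta> Fc DF \<longleftrightarrow> (\<exists>D2F :: 'h \<Rightarrow> 'h \<Rightarrow> 'h \<Rightarrow> 'h ^ 'd. \<forall>\<theta>\<ge>\<alpha>.
     (\<forall>x\<in>Hsp S (\<theta>+1).
        Fc x \<in> Hvsp S (\<theta>+\<beta>+1) \<and>
        (\<forall>h\<in>Hsp S (\<theta>+1). DF x h \<in> Hvsp S (\<theta>+\<beta>+1)) \<and>
        (\<forall>h\<in>Hsp S (\<theta>+1). \<forall>k\<in>Hsp S (\<theta>+1). D2F x h k \<in> Hvsp S (\<theta>+\<beta>+1)) \<and>
        (\<forall>h\<in>Hsp S (\<theta>+1). \<forall>k\<in>Hsp S (\<theta>+1). \<forall>a b.
            DF x (a *\<^sub>R h + b *\<^sub>R k) = a *\<^sub>R DF x h + b *\<^sub>R DF x k) \<and>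
        (\<forall>h\<in>Hsp S (\<theta>+1). \<forall>k\<in>Hsp S (\<theta>+1). \<forall>l\<in>Hsp S (\<theta>+1). \<forall>a b.
            D2F x (a *\<^sub>R h + b *\<^sub>R k) l = a *\<^sub>R D2F x h l + b *\<^sub>R D2F x k l \<and>
            D2F x l (a *\<^sub>R h + b *\<^sub>R k) = a *\<^sub>R D2F x l h + b *\<^sub>R D2F x l k) \<and>
        (\<forall>\<epsilon>>0. \<exists>\<eta>>0. \<forall>h\<in>Hsp S (\<theta>+1). nrm S (\<theta>+1) h < \<eta> \<longrightarrow>
            vnrm S (\<theta>+\<beta>+1) (Fc (x + h) - Fc x - DF x h) \<le> \<epsilon> * nrm S (\<theta>+1) h) \<and>
        (\<forall>\<epsilon>>0. \<exists>\<eta>>0. \<forall>h\<in>Hsp S (\<theta>+1). nrm S (\<theta>+1) h < \<eta> \<longrightarrow>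
            (\<forall>k\<in>Hsp S (\<theta>+1). vnrm S (\<theta>+\<beta>+1) (DF (x + h) k - DF x k - D2F x h k)
               \<le> \<epsilon> * nrm S (\<theta>+1) h * nrm S (\<theta>+1) k))) \<and>
     (\<forall>R. \<exists>C. \<forall>x\<in>Hsp S (\<theta>+1). nrm S (\<theta>+1) x \<le> R \<longrightarrow>
        vnrm S (\<theta>+\<beta>+1) (Fc x) \<le> C \<and>
        (\<forall>h\<in>Hsp S (\<theta>+1). vnrm S (\<theta>+\<beta>+1) (DF x h) \<le> C * nrm S (\<theta>+1) h) \<and>
        (\<forall>h\<in>Hsp S (\<theta>+1). \<forall>k\<in>Hsp S (\<theta>+1).
            vnrm S (\<theta>+\<beta>+1) (D2F x h k) \<le> C * nrm S (\<theta>+1) h * nrm S (\<theta>+1) k)))"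

text \<open>N \<in> Poly^{0,n}_{alpha,beta}(H), given by its coordinate version Nc.\<close>
definition Poly0_class :: "(real \<Rightarrow> 'h \<Rightarrow> 'h::real_normed_vector) \<Rightarrow> real \<Rightarrow> nat \<Rightarrow> real \<Rightarrow>
    ('h \<Rightarrow> 'h) \<Rightarrow> bool" where
  "Poly0_class S \<alpha> n \<beta> Nc \<longleftrightarrow> (\<forall>\<theta>\<ge>\<alpha>.
     (\<forall>x\<in>Hsp S (\<theta>+1). Nc x \<in> Hsp S (\<theta>+\<beta>+1)) \<and>
     (\<forall>x\<in>Hsp S (\<theta>+1). \<forall>\<epsilon>>0. \<exists>\<eta>>0. \<forall>y\<in>Hsp S (\<theta>+1).
        nrm S (\<theta>+1) (y - x) < \<eta> \<longrightarrow> nrm S (\<theta>+\<beta>+1) (Nc y - Nc x) < \<epsilon>) \<and>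
     (\<forall>R. \<exists>C. \<forall>x\<in>Hsp S (\<theta>+1). nrm S (\<theta>+1) x \<le> R \<longrightarrow> nrm S (\<theta>+\<beta>+1) (Nc x) \<le> C) \<and>
     (\<exists>C. \<forall>x\<in>Hsp S (\<theta>+1). \<forall>y\<in>Hsp S (\<theta>+1).
        nrm S (\<theta>+\<beta>+1) (Nc x - Nc y)
          \<le> C * nrm S (\<theta>+1) (x - y) * (1 + nrm S (\<theta>+1) x + nrm S (\<theta>+1) y) ^ (n - 1)))"

text \<open>F(u), DF(u)F(u) for u \<in> H, obtained from the coordinate versions.
  DFF ... u i j = DF(u)[F(u) e_j] e_i  (the first tensor slot is the integrator slot).\<close>
definition Fu :: "(real \<Rightarrow> 'h \<Rightarrow> 'h::real_normed_vector) \<Rightarrow> ('h \<Rightarrow> 'h ^ 'd) \<Rightarrow> 'h \<Rightarrow> 'h ^ 'd" where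
  "Fu S Fc u = (\<chi> i. dec S (Fc (enc S u) $ i))"

definition DFF :: "(real \<Rightarrow> 'h \<Rightarrow> 'h::real_normed_vector) \<Rightarrow> ('h \<Rightarrow> 'h ^ 'd) \<Rightarrow>
    ('h \<Rightarrow> 'h \<Rightarrow> 'h ^ 'd) \<Rightarrow> 'h \<Rightarrow> 'd \<Rightarrow> 'd \<Rightarrow> 'h" where
  "DFF S Fc DF u i j = dec S (DF (enc S u) (Fc (enc S u) $ j) $ i)"

definition tensor :: "real ^ 'd \<Rightarrow> real ^ 'd \<Rightarrow> real ^ 'd ^ 'd" where
  "tensor a b = (\<chi> i j. a $ i * b $ j)"

definition smooth2 :: "(real \<Rightarrow> real \<Rightarrow> 'a::real_normed_vector) \<Rightarrow> bool" where
  "smooth2 f \<longleftrightarrow> (\<exists>D :: nat \<Rightarrow> nat \<Rightarrow> real \<Rightarrow> real \<Rightarrow> 'a. D 0 0 = f \<and>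
     (\<forall>m k. continuous_on UNIV (\<lambda>p. D m k (fst p) (snd p))) \<and>
     (\<forall>m k t s. ((\<lambda>t'. D m k t' s) has_vector_derivative D (Suc m) k t s) (at t)) \<and>
     (\<forall>m k t s. ((\<lambda>s'. D m k t s') has_vector_derivative D m (Suc k) t s) (at s)))"

definition chen :: "real \<Rightarrow> (real \<Rightarrow> real \<Rightarrow> real ^ 'd) \<Rightarrow> (real \<Rightarrow> real \<Rightarrow> real ^ 'd ^ 'd) \<Rightarrow> bool" where
  "chen T X XX \<longleftrightarrow> (\<forall>t\<in>{0..T}. \<forall>u\<in>{0..T}. \<forall>s\<in>{0..T}.
     X t s = X t u + X u s \<and> XX t s - XX t u - XX u s = tensor (X t u) (X u s))"

definition holder_bound :: "real \<Rightarrow> real \<Rightarrow> (real \<Rightarrow> real \<Rightarrow> 'a::real_normed_vector) \<Rightarrow> real \<Rightarrow> bool" where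
  "holder_bound T \<gamma> f K \<longleftrightarrow> (\<forall>t\<in>{0..T}. \<forall>s\<in>{0..T}. norm (f t s) \<le> K * \<bar>t - s\<bar> powr \<gamma>)"

definition rho_lt :: "real \<Rightarrow> real \<Rightarrow> (real \<Rightarrow> real \<Rightarrow> real ^ 'd) \<Rightarrow> (real \<Rightarrow> real \<Rightarrow> real ^ 'd ^ 'd) \<Rightarrow>
    (real \<Rightarrow> real \<Rightarrow> real ^ 'd) \<Rightarrow> (real \<Rightarrow> real \<Rightarrow> real ^ 'd ^ 'd) \<Rightarrow> real \<Rightarrow> bool" where
  "rho_lt T \<gamma> X XX Y YY \<epsilon> \<longleftrightarrow> (\<exists>K1 K2. K1 + K2 < \<epsilon> \<and>
     holder_bound T \<gamma> (\<lambda>t s. X t s - Y t s) K1 \<and> holder_bound T (2 * \<gamma>) (\<lambda>t s. XX t s - YY t s) K2)"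

definition rough_path :: "real \<Rightarrow> real \<Rightarrow> (real \<Rightarrow> real \<Rightarrow> real ^ 'd) \<Rightarrow> (real \<Rightarrow> real \<Rightarrow> real ^ 'd ^ 'd) \<Rightarrow> bool" where
  "rough_path T \<gamma> X XX \<longleftrightarrow> (\<forall>\<epsilon>>0. \<exists>Y YY. smooth2 Y \<and> smooth2 YY \<and> chen T Y YY \<and> rho_lt T \<gamma> X XX Y YY \<epsilon>)"

definition rough_path_Rplus :: "real \<Rightarrow> (real \<Rightarrow> real \<Rightarrow> real ^ 'd) \<Rightarrow> (real \<Rightarrow> real \<Rightarrow> real ^ 'd ^ 'd) \<Rightarrow> bool" where
  "rough_path_Rplus \<gamma> X XX \<longleftrightarrow> (\<forall>T>0. rough_path T \<gamma> X XX)"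

definition controlled :: "(real \<Rightarrow> 'h \<Rightarrow> 'h::real_normed_vector) \<Rightarrow> real \<Rightarrow> real \<Rightarrow>
    (real \<Rightarrow> real \<Rightarrow> real ^ 'd) \<Rightarrow> (real \<Rightarrow> 'h) \<Rightarrow> (real \<Rightarrow> 'h ^ 'd) \<Rightarrow> bool" where
  "controlled S T \<gamma> X Y Y' \<longleftrightarrow>
     (\<exists>C. \<forall>t\<in>{0..T}. norm (Y t) \<le> C \<and> (\<forall>i. norm (Y' t $ i) \<le> C)) \<and>
     (\<exists>C. \<forall>s t. 0 \<le> s \<longrightarrow> s \<le> t \<longrightarrow> t \<le> T \<longrightarrow>
        nneg S (2 * \<gamma>) (Y t - S (t - s) (Y s)) \<le> C * (t - s) powr \<gamma> \<and>
        vnneg S (2 * \<gamma>) (\<chi> i. Y' t $ i - S (t - s) (Y' s $ i)) \<le> C * (t - s) powr \<gamma> \<and>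
        nneg S (2 * \<gamma>) (Y t - S (t - s) (Y s) - S (t - s) (\<Sum>i\<in>UNIV. X t s $ i *\<^sub>R Y' s $ i))
          \<le> C * (t - s) powr (2 * \<gamma>))"

definition is_partition :: "real \<Rightarrow> real \<Rightarrow> real list \<Rightarrow> bool" where
  "is_partition a b p \<longleftrightarrow> p \<noteq> [] \<and> hd p = a \<and> last p = b \<and> sorted_wrt (<) p"

definition mesh_lt :: "real list \<Rightarrow> real \<Rightarrow> bool" where
  "mesh_lt p \<eta> \<longleftrightarrow> (\<forall>i. Suc i < length p \<longrightarrow> p ! Suc i - p ! i < \<eta>)"

definition psum :: "real list \<Rightarrow> (real \<Rightarrow> real \<Rightarrow> 'a::comm_monoid_add) \<Rightarrow> 'a" where
  "psum p g = (\<Sum>i<length p - 1. g (p ! Suc i) (p ! i))"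

definition rs_limit :: "real \<Rightarrow> (real \<Rightarrow> real \<Rightarrow> 'a::comm_monoid_add) \<Rightarrow> ('a \<Rightarrow> 'b::metric_space) \<Rightarrow> 'b \<Rightarrow> bool" where
  "rs_limit t g \<Phi> l \<longleftrightarrow> (\<forall>\<epsilon>>0. \<exists>\<eta>>0. \<forall>p. is_partition 0 t p \<and> mesh_lt p \<eta> \<longrightarrow> dist (\<Phi> (psum p g)) l < \<epsilon>)"

text \<open>Mild solution.  The integral of S_{t-r} N(u_r) is taken in H; the rough convolution
  is the limit of the sums in H_{-2gamma} (represented isometrically in H through
  (-L)^(-2gamma)); the equation is an identity in H_{-2gamma}.\<close>
definition mild_solution :: "('h::real_inner \<Rightarrow> 'h) \<Rightarrow> (real \<Rightarrow> 'h \<Rightarrow> 'h) \<Rightarrow> real \<Rightarrow> real \<Rightarrow>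
    (real \<Rightarrow> real \<Rightarrow> real ^ 'd) \<Rightarrow> (real \<Rightarrow> real \<Rightarrow> real ^ 'd ^ 'd) \<Rightarrow>
    ('h \<Rightarrow> 'h ^ 'd) \<Rightarrow> ('h \<Rightarrow> 'h \<Rightarrow> 'h ^ 'd) \<Rightarrow> ('h \<Rightarrow> 'h) \<Rightarrow> 'h \<Rightarrow> (real \<Rightarrow> 'h) \<Rightarrow> bool" where
  "mild_solution L S T \<gamma> X XX Fc DF Nc \<xi> u \<longleftrightarrow> (\<forall>t\<in>{0..T}.
     (\<lambda>r. dec S (S (t - r) (Nc (enc S (u r))))) integrable_on {0..t} \<and>
     (\<exists>v. rs_limit t (\<lambda>q r. S (t - r) ((\<Sum>i\<in>UNIV. X q r $ i *\<^sub>R Fu S Fc (u r) $ i)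
                + (\<Sum>i\<in>UNIV. \<Sum>j\<in>UNIV. XX q r $ i $ j *\<^sub>R DFF S Fc DF (u r) i j)))
            (fracA S (2 * \<gamma>)) v \<and>
          fracA S (2 * \<gamma>) (u t) = fracA S (2 * \<gamma>) (S t \<xi>
              + integral {0..t} (\<lambda>r. dec S (S (t - r) (Nc (enc S (u r)))))) + v))"

text \<open>Weak solution.  For h \<in> H_1, the pairing of N(u_s) \<in> H_{-delta} with h is
  inner (coordinate of N(u_s)) ((-L) h).\<close>
definition weak_solution :: "('h::real_inner \<Rightarrow> 'h) \<Rightarrow> (real \<Rightarrow> 'h \<Rightarrow> 'h) \<Rightarrow> real \<Rightarrow>
    (real \<Rightarrow> real \<Rightarrow> real ^ 'd) \<Rightarrow> (real \<Rightarrow> real \<Rightarrow> real ^ 'd ^ 'd) \<Rightarrow>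
    ('h \<Rightarrow> 'h ^ 'd) \<Rightarrow> ('h \<Rightarrow> 'h \<Rightarrow> 'h ^ 'd) \<Rightarrow> ('h \<Rightarrow> 'h) \<Rightarrow> (real \<Rightarrow> 'h) \<Rightarrow> bool" where
  "weak_solution L S T X XX Fc DF Nc u \<longleftrightarrow> (\<forall>h\<in>Hsp S 1. \<forall>t\<in>{0..T}.
     (\<lambda>s. inner (u s) (L h)) integrable_on {0..t} \<and>
     (\<lambda>s. inner (Nc (enc S (u s))) (- L h)) integrable_on {0..t} \<and>
     (\<exists>l. rs_limit t (\<lambda>q r. (\<Sum>i\<in>UNIV. X q r $ i * inner (Fu S Fc (u r) $ i) h)
                + (\<Sum>i\<in>UNIV. \<Sum>j\<in>UNIV. XX q r $ i $ j * inner (DFF S Fc DF (u r) i j) h)) id l \<and>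
          inner (u t) h = inner (u 0) h + integral {0..t} (\<lambda>s. inner (u s) (L h))
             + integral {0..t} (\<lambda>s. inner (Nc (enc S (u s))) (- L h)) + l))"

end

theory Submission
  imports Defs
begin

text \<open>Write $\Xi_{q,r} = F(u_r)X_{q,r} + DF(u_r)F(u_r)\mathbb{X}_{q,r}$.  Since $S_\tau - 1$ is of order
  $\tau^\theta$ from $\mathcal{H}$ to $\mathcal{H}_{-2\gamma}$ for every $\theta < 2\gamma$, Taylor's formula for $F$ in
  $\mathcal{H}_{-2\gamma}$ and Chen's relation bound the sewing defects of $\Xi$ and of $S_{t-r}\Xi_{q,r}$ in
  $\mathcal{H}_{-2\gamma}$ by $|q-r|^\kappa$ with $\kappa = (1+3\gamma)/2 > 1$.  So each of the two equations is
  equivalent to a local expansion of the increments of $u$ with an error $o(|q-r|)$, and, tested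
  against $h \in \mathcal{H}_1$, the two expansions differ by $o(|q-r|)$ only.

  From mild to weak, the weak equation results by summing the local expansions.  From weak to mild,
  they first hold with an error controlled by $\|L^2h\|$; the uniqueness in the sewing lemma improves
  this to $\|h\|_{2\gamma}$, hence to the norm of $\mathcal{H}_{-2\gamma}$.  To make sense of
  $\int S_{t-r}N(u_r)\,dr$ in $\mathcal{H}$ one needs $u$ to be strongly continuous; this follows by
  halving $[s,t]$ repeatedly towards $t$ and using $\|LS_\tau\| \le 1/\tau$ on each piece.\<close>

text \<open>Spectral calculus is avoided: the powers \<open>(-L)^(-a)\<close> are Balakrishnan
  integrals, and smoothing estimates are pointwise bounds on \<open><S_t x, y>\<close> integrated
  against the kernel. Negative norms never leave \<open>H\<close>, since an element of
  \<open>H_{-a}\<close> appears as its image under \<open>fracA S a\<close>.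

  Two obstacles shape both directions. The controlled bounds give only weak continuity of
  \<open>u\<close>, so integrability of the drift is not settled in advance; each equation supplies
  it for the real functions that occur in it, and it has to be carried over to those of the other.
  Secondly, for \<open>h\<close> in \<open>H_1\<close> the vector \<open>L h\<close> is a mere
  element of \<open>H\<close>, so \<open>S_\<tau> L h - L h\<close> tends to 0 without a rate. Hence
  errors that are only \<open>o(q - r)\<close> from mild to weak, and smoother test vectors from
  weak to mild, whose constants involve \<open>L^2 h\<close> until uniqueness of sewing removes
  them.\<close>

section \<open>Integration in complete normed spaces\<close>

text \<open>The sort of the Hilbert space does not entail the class \<open>banach\<close>, which most of the
  library's integration theory requires; its results are transported along an isometric copy.\<close>

typedef 'a banach_copy = "UNIV :: 'a set"
  by simp

lemmas banach_copy_simps [simp] = Abs_banach_copy_inverse[OF UNIV_I] Rep_banach_copy_inverse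

instantiation banach_copy :: (real_normed_vector) real_normed_vector
begin

definition "0 = Abs_banach_copy 0"
definition "x + y = Abs_banach_copy (Rep_banach_copy x + Rep_banach_copy y)"
definition "x - y = Abs_banach_copy (Rep_banach_copy x - Rep_banach_copy y)"
definition "- x = Abs_banach_copy (- Rep_banach_copy x)"
definition "r *\<^sub>R x = Abs_banach_copy (r *\<^sub>R Rep_banach_copy x)"
definition "norm x = norm (Rep_banach_copy x)"
definition "dist x y = dist (Rep_banach_copy x) (Rep_banach_copy y)"
definition "sgn x = Abs_banach_copy (sgn (Rep_banach_copy x))"
definition "(uniformity :: ('a banach_copy \<times> 'a banach_copy) filter) =
  (INF e\<in>{0 <..}. principal {(x, y). dist x y < e})"
definition "open (U :: 'a banach_copy set) \<longleftrightarrow>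
  (\<forall>x\<in>U. \<forall>\<^sub>F (x', y) in uniformity. x' = x \<longrightarrow> y \<in> U)"

instance
  by intro_classes
     (simp_all add: zero_banach_copy_def plus_banach_copy_def minus_banach_copy_def
        uminus_banach_copy_def scaleR_banach_copy_def norm_banach_copy_def dist_banach_copy_def
        sgn_banach_copy_def uniformity_banach_copy_def open_banach_copy_def sgn_div_norm
        dist_norm algebra_simps Rep_banach_copy_inject[symmetric] norm_triangle_ineq)

end

lemma bounded_linear_Rep_banach_copy: "bounded_linear Rep_banach_copy"
  by (rule bounded_linear_intro[of _ 1])
     (simp_all add: plus_banach_copy_def scaleR_banach_copy_def norm_banach_copy_def)

lemma bounded_linear_Abs_banach_copy: "bounded_linear Abs_banach_copy"
  by (rule bounded_linear_intro[of _ 1])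
     (simp_all add: plus_banach_copy_def scaleR_banach_copy_def norm_banach_copy_def)

instance banach_copy :: ("{real_normed_vector, complete_space}") banach
proof
  fix X :: "nat \<Rightarrow> 'a banach_copy"
  assume "Cauchy X"
  then have "Cauchy (\<lambda>n. Rep_banach_copy (X n))"
    by (simp add: Cauchy_def dist_banach_copy_def)
  then obtain l where "(\<lambda>n. Rep_banach_copy (X n)) \<longlonglongrightarrow> l"
    using Cauchy_convergent_iff convergent_def by blast
  then have "(\<lambda>n. Abs_banach_copy (Rep_banach_copy (X n))) \<longlonglongrightarrow> Abs_banach_copy l"
    by (rule bounded_linear.tendsto[OF bounded_linear_Abs_banach_copy])
  then show "convergent X"
    by (auto simp: convergent_def)
qed

lemma integrable_on_of_banach_copy:
  fixes f :: "'n::euclidean_space \<Rightarrow> 'a::real_normed_vector"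
  assumes "(\<lambda>x. Abs_banach_copy (f x)) integrable_on A"
  shows "f integrable_on A"
  using integrable_linear[OF assms bounded_linear_Rep_banach_copy] by (simp add: o_def)

text \<open>An antiderivative \<open>F\<close> of \<open>f\<close> on the open interval inherits the
  modulus of continuity of the indefinite integral of \<open>G\<close>, hence extends continuously
  to the end points; the fundamental theorem with interior derivatives then gives integrability. It
  serves integrands that blow up at an end, as \<open>L (S (t - r) x)\<close> may at
  \<open>r = t\<close>.\<close>

lemma integrable_on_Icc_of_continuous_dominated_banach:
  fixes f :: "real \<Rightarrow> 'a::banach"
  assumes "a < b" and cont: "continuous_on {a<..<b} f"
    and G: "G integrable_on {a..b}" and le: "\<And>x. x \<in> {a<..<b} \<Longrightarrow> norm (f x) \<le> G x"
  shows "f integrable_on {a..b}"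
proof -
  define c where "c = (a + b) / 2"
  have c: "a < c" "c < b" using assms(1) by (auto simp: c_def)
  define F where "F x = (if c \<le> x then integral {c..x} f else - integral {x..c} f)" for x
  have int: "f integrable_on {x..y}" if "a < x" "y < b" for x y
    using that by (intro integrable_continuous_real continuous_on_subset[OF cont]) auto
  have F_diff: "F y - F x = integral {x..y} f" if "a < x" "x \<le> y" "y < b" for x y
  proof -
    consider "c \<le> x" | "x < c" "c \<le> y" | "y < c" by linarith
    then show ?thesis
    proof cases
      case 1
      then show ?thesis
        using Henstock_Kurzweil_Integration.integral_combine[of c x y f] int[of c y] that c
        by (auto simp: F_def algebra_simps)
    next
      case 2
      then show ?thesis
        using Henstock_Kurzweil_Integration.integral_combine[of x c y f] int[of x y] that c
        by (auto simp: F_def algebra_simps)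
    next
      case 3
      then show ?thesis
        using Henstock_Kurzweil_Integration.integral_combine[of x y c f] int[of x c] that c
        by (auto simp: F_def algebra_simps)
    qed
  qed
  define H where "H x = integral {a..x} G" for x
  have "continuous_on {a..b} H"
    unfolding H_def by (rule indefinite_integral_continuous_1[OF G])
  then have ucH: "uniformly_continuous_on {a..b} H"
    by (rule compact_uniformly_continuous) auto
  have Gi: "G integrable_on {x..y}" if "a \<le> x" "y \<le> b" for x y
    by (rule integrable_on_subinterval[OF G]) (use that in auto)
  have FH: "norm (F y - F x) \<le> norm (H y - H x)" if "a < x" "x \<le> y" "y < b" for x y
  proof -
    have "norm (F y - F x) \<le> integral {x..y} G"
      unfolding F_diff[OF that] using that
      by (intro integral_norm_bound_integral int Gi le) auto
    also have "\<dots> = H y - H x"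
      using Henstock_Kurzweil_Integration.integral_combine[of a x y G] Gi[of a y] that
      by (auto simp: H_def algebra_simps)
    finally show ?thesis by simp
  qed
  have FH': "norm (F y - F x) \<le> norm (H y - H x)" if "x \<in> {a<..<b}" "y \<in> {a<..<b}" for x y
    using FH[of x y] FH[of y x] that by (cases "x \<le> y") (auto simp: norm_minus_commute)
  have "uniformly_continuous_on {a<..<b} F"
    unfolding uniformly_continuous_on_def
  proof (intro allI impI)
    fix e :: real
    assume "e > 0"
    then obtain d where "d > 0" and d: "\<And>x y. x \<in> {a..b} \<Longrightarrow> y \<in> {a..b} \<Longrightarrow> dist y x < d \<Longrightarrow> dist (H y) (H x) < e"
      using ucH unfolding uniformly_continuous_on_def by metis
    then show "\<exists>d>0. \<forall>x\<in>{a<..<b}. \<forall>x'\<in>{a<..<b}. dist x' x < d \<longrightarrow> dist (F x') (F x) < e"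
    proof (intro exI[of _ d] conjI ballI impI)
      fix x x' assume "x \<in> {a<..<b}" "x' \<in> {a<..<b}" "dist x' x < d"
      then show "dist (F x') (F x) < e"
        using FH'[of x x'] d[of x x'] by (simp add: dist_norm)
    qed
  qed
  then obtain g where g: "uniformly_continuous_on (closure {a<..<b}) g" "\<And>x. x \<in> {a<..<b} \<Longrightarrow> F x = g x"
    using uniformly_continuous_on_extension_on_closure by metis
  have contg: "continuous_on {a..b} g"
    using g(1) assms(1) by (simp add: uniformly_continuous_imp_continuous)
  have der: "(g has_vector_derivative f x) (at x)" if x: "x \<in> {a<..<b}" for x
  proof -
    define l r where "l = (a + x) / 2" and "r = (x + b) / 2"
    have lr: "a < l" "l < x" "x < r" "r < b" using x by (auto simp: l_def r_def)
    have "((\<lambda>u. integral {l..u} f) has_vector_derivative f x) (at x within {l..r})"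
      by (rule integral_has_vector_derivative)
         (use lr in \<open>auto intro: continuous_on_subset[OF cont]\<close>)
    then have "((\<lambda>u. integral {l..u} f) has_vector_derivative f x) (at x)"
      using lr by (simp add: at_within_Icc_at)
    then have "((\<lambda>u. F l + integral {l..u} f) has_vector_derivative f x) (at x)"
      by (auto intro!: derivative_eq_intros)
    then show ?thesis
    proof (rule has_vector_derivative_transform_within_open[of _ _ _ "{l<..<b}"])
      show "F l + integral {l..u} f = g u" if "u \<in> {l<..<b}" for u
        using F_diff[of l u] g(2)[of u] lr that by (auto simp: algebra_simps)
    qed (use lr in auto)
  qed
  show ?thesis
    using fundamental_theorem_of_calculus_interior[OF _ contg der] assms(1)
    by (auto simp: integrable_on_def)
qed

lemma integrable_on_Icc_of_continuous_dominated:
  fixes f :: "real \<Rightarrow> 'a::{real_normed_vector, complete_space}"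
  assumes "a < b" and cont: "continuous_on {a<..<b} f"
    and G: "G integrable_on {a..b}" and le: "\<And>x. x \<in> {a<..<b} \<Longrightarrow> norm (f x) \<le> G x"
  shows "f integrable_on {a..b}"
proof (rule integrable_on_of_banach_copy, rule integrable_on_Icc_of_continuous_dominated_banach[OF assms(1) _ G])
  show "continuous_on {a<..<b} (\<lambda>x. Abs_banach_copy (f x))"
    by (intro bounded_linear.continuous_on[OF bounded_linear_Abs_banach_copy] cont)
qed (use le in \<open>simp add: norm_banach_copy_def\<close>)

lemma integrable_on_greaterThan_of_continuous_dominated:
  fixes f :: "real \<Rightarrow> 'a::{real_normed_vector, complete_space}"
  assumes cont: "continuous_on {0<..} f"
    and G: "G integrable_on {0<..}" and le: "\<And>x. x \<in> {0<..} \<Longrightarrow> norm (f x) \<le> G x"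
  shows "f integrable_on {0<..}"
proof (rule integrable_on_of_banach_copy, rule integrable_on_all_intervals_integrable_bound[OF _ _ G])
  show "norm (Abs_banach_copy (f x)) \<le> G x" if "x \<in> {0<..}" for x
    using le[OF that] by (simp add: norm_banach_copy_def)
  let ?f = "\<lambda>x. if x \<in> {0<..} then Abs_banach_copy (f x) else 0"
  show "?f integrable_on cbox a b" for a b
  proof (cases "a < b")
    case False
    then show ?thesis
      by (cases "a = b") (use integrable_on_refl in fastforce)+
  next
    case True
    have "?f integrable_on {a'..b'}" if "a' < b'" "0 \<le> a'" for a' b'
    proof -
      have "(\<lambda>x. Abs_banach_copy (f x)) integrable_on {a'..b'}"
      proof (rule integrable_on_Icc_of_continuous_dominated_banach[OF \<open>a' < b'\<close>])
        show "continuous_on {a'<..<b'} (\<lambda>x. Abs_banach_copy (f x))"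
          by (intro bounded_linear.continuous_on[OF bounded_linear_Abs_banach_copy]
              continuous_on_subset[OF cont]) (use that in auto)
        have "(\<lambda>x. if x \<in> {0<..} then G x else 0) integrable_on {a'..b'}"
          using integrable_altD(1)[OF G] by (metis box_real(2))
        then show "(\<lambda>x. if x \<in> {0<..} then G x else 0) integrable_on {a'..b'}" .
        show "norm (Abs_banach_copy (f x)) \<le> (if x \<in> {0<..} then G x else 0)" if "x \<in> {a'<..<b'}" for x
          using le[of x] that \<open>0 \<le> a'\<close> by (auto simp: norm_banach_copy_def)
      qed
      then show ?thesis
        by (rule integrable_spike[where S = "{0}"]) (use that in auto)
    qed
    note pos = this
    have neg: "?f integrable_on {a'..b'}" if "b' \<le> 0" for a' b'
      by (rule integrable_eq[of "\<lambda>_. 0"]) (use that in auto)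
    consider "b \<le> 0" | "0 \<le> a" | "a < 0" "0 < b" by linarith
    then have "?f integrable_on {a..b}"
    proof cases
      case 3
      then show ?thesis
        using Henstock_Kurzweil_Integration.integrable_combine[of a 0 b ?f] pos[of 0 b] neg[of 0 a] by auto
    qed (use pos neg True in auto)
    then show ?thesis by simp
  qed
qed

lemma integrable_on_subinterval_complete:
  fixes f :: "real \<Rightarrow> 'a::{real_normed_vector, complete_space}"
  assumes "f integrable_on A" "{a..b} \<subseteq> A"
  shows "f integrable_on {a..b}"
proof (rule integrable_on_of_banach_copy)
  have "(\<lambda>x. Abs_banach_copy (f x)) integrable_on A"
    using integrable_linear[OF assms(1) bounded_linear_Abs_banach_copy] by (simp add: o_def)
  then show "(\<lambda>x. Abs_banach_copy (f x)) integrable_on {a..b}"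
    by (rule integrable_on_subinterval[OF _ assms(2)])
qed

section \<open>Bounds by duality and weak integrals\<close>

lemma norm_le_of_inner_le:
  fixes x :: "'h::real_inner"
  assumes "\<And>y. inner x y \<le> C * norm y" "0 \<le> C"
  shows "norm x \<le> C"
proof (cases "x = 0")
  case False
  have "norm x * norm x \<le> C * norm x"
    using assms(1)[of x] by (simp add: dot_square_norm power2_eq_square)
  then show ?thesis using False by simp
qed (use assms in simp)

lemma inner_integral_left:
  fixes f :: "real \<Rightarrow> 'h::real_inner"
  assumes "f integrable_on A"
  shows "(\<lambda>x. inner (f x) y) integrable_on A" "integral A (\<lambda>x. inner (f x) y) = inner (integral A f) y"
  using integrable_linear[OF assms bounded_linear_inner_left[of y]]
        integral_linear[OF assms bounded_linear_inner_left[of y]]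
  by (simp_all add: o_def)

text \<open>One equation asserts integrability of \<open><N(u_r), k>\<close>, the other that of its
  convolution version; local uniform approximation transfers it. \<open>Bolzano\<close> glues the
  local approximants into one on the whole interval, and uniform limits of integrable functions are
  integrable.\<close>

lemma integrable_on_Icc_of_local_approx:
  fixes f :: "real \<Rightarrow> real"
  assumes "a \<le> b"
    and approx: "\<And>e. e > 0 \<Longrightarrow> \<exists>d>0. \<forall>x y. a \<le> x \<longrightarrow> x \<le> y \<longrightarrow> y \<le> b \<longrightarrow> y - x < d \<longrightarrow>
      (\<exists>g. g integrable_on {x..y} \<and> (\<forall>r\<in>{x..y}. \<bar>f r - g r\<bar> \<le> e))"
  shows "f integrable_on {a..b}"
proof -
  have "\<exists>g. (\<forall>x\<in>cbox a b. norm (f x - g x) \<le> e) \<and> g integrable_on cbox a b" if e: "e > 0" for e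
  proof -
    obtain d where "d > 0" and d: "\<And>x y. a \<le> x \<Longrightarrow> x \<le> y \<Longrightarrow> y \<le> b \<Longrightarrow> y - x < d \<Longrightarrow>
      (\<exists>g. g integrable_on {x..y} \<and> (\<forall>r\<in>{x..y}. \<bar>f r - g r\<bar> \<le> e))"
      using approx[OF e] by blast
    define P where "P x y \<longleftrightarrow> (a \<le> x \<longrightarrow> x \<le> y \<longrightarrow> y \<le> b \<longrightarrow>
      (\<exists>g. g integrable_on {x..y} \<and> (\<forall>r\<in>{x..y}. \<bar>f r - g r\<bar> \<le> e)))" for x y
    have "P a b"
      using \<open>a \<le> b\<close>
    proof (induction rule: Bolzano)
      case (trans x y z)
      show ?case
        unfolding P_def
      proof (intro impI)
        assume *: "a \<le> x" "x \<le> z" "z \<le> b"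
        obtain g1 g2 where g: "g1 integrable_on {x..y}" "\<And>r. r\<in>{x..y} \<Longrightarrow> \<bar>f r - g1 r\<bar> \<le> e"
          "g2 integrable_on {y..z}" "\<And>r. r\<in>{y..z} \<Longrightarrow> \<bar>f r - g2 r\<bar> \<le> e"
          using trans * unfolding P_def by (meson order_trans)
        let ?g = "\<lambda>r. if r \<le> y then g1 r else g2 r"
        have "?g integrable_on {x..y}"
          by (rule integrable_eq[OF g(1)]) auto
        moreover have "?g integrable_on {y..z}"
          by (rule integrable_spike[OF g(3), of "{y}"]) auto
        ultimately have "?g integrable_on {x..z}"
          using Henstock_Kurzweil_Integration.integrable_combine[of x y z ?g] trans by auto
        then show "\<exists>g. g integrable_on {x..z} \<and> (\<forall>r\<in>{x..z}. \<bar>f r - g r\<bar> \<le> e)"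
          using g by (intro exI[of _ ?g]) auto
      qed
    next
      case (local x)
      then show ?case
        unfolding P_def using \<open>d > 0\<close> d by (intro exI[of _ d]) auto
    qed
    then show ?thesis
      unfolding P_def using \<open>a \<le> b\<close> by auto
  qed
  from integrable_uniform_limit[OF this] show ?thesis by simp
qed

section \<open>Semigroups generated by negative selfadjoint operators\<close>

text \<open>The generator provides derivatives from the right only, so the mean value theorem does
  not apply yet. Instead, the set where \<open>f x \<le> f a + e * (x - a)\<close> is closed, and
  from any of its points before \<open>b\<close> the right derivative continues it, so its supremum
  is \<open>b\<close>.\<close>

lemma nonincreasing_of_right_derivative_nonpos:
  fixes f :: "real \<Rightarrow> real"
  assumes "a \<le> b" and cont: "continuous_on {a..b} f"
    and der: "\<And>x. a \<le> x \<Longrightarrow> x < b \<Longrightarrow> (f has_real_derivative f' x) (at x within {x..})"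
    and nonpos: "\<And>x. a \<le> x \<Longrightarrow> x < b \<Longrightarrow> f' x \<le> 0"
  shows "f b \<le> f a"
proof (rule field_le_epsilon)
  fix e0 :: real
  assume "e0 > 0"
  define e where "e = e0 / (b - a + 1)"
  have e: "e > 0" "e * (b - a) \<le> e0"
    using \<open>e0 > 0\<close> \<open>a \<le> b\<close> by (auto simp: e_def field_simps)
  define A where "A = {x \<in> {a..b}. f x \<le> f a + e * (x - a)}"
  have "closed A"
    unfolding A_def
    by (rule continuous_on_closed_Collect_le[OF cont]) (auto intro!: continuous_intros)
  have A: "A \<noteq> {}" "bdd_above A" "A \<subseteq> {a..b}"
    using \<open>a \<le> b\<close> by (auto simp: A_def intro!: bdd_aboveI[of _ b])
  define s where "s = Sup A"
  have "s \<in> A"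
    unfolding s_def using A \<open>closed A\<close> by (intro closed_contains_Sup)
  have "s = b"
  proof (rule ccontr)
    assume "s \<noteq> b"
    with \<open>s \<in> A\<close> A have s: "a \<le> s" "s < b" by auto
    have "\<forall>\<^sub>F y in at s within {s..}. (f y - f s) / (y - s) < e"
      using order_tendstoD(2)[OF der[OF s, unfolded has_field_derivative_iff]] nonpos[OF s] e by auto
    moreover have "\<forall>\<^sub>F y in at s within {s..}. y < b"
      using s by (auto simp: eventually_at intro!: exI[of _ "b - s"] simp: dist_real_def)
    moreover have "\<forall>\<^sub>F y in at s within {s..}. y > s"
      by (auto simp: eventually_at intro!: exI[of _ 1])
    ultimately have "\<forall>\<^sub>F y in at s within {s..}. y \<in> A \<and> y > s"
    proof eventually_elim
      case (elim y)
      then have "f y - f s \<le> e * (y - s)" by (simp add: field_simps)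
      with elim \<open>s \<in> A\<close> show ?case by (auto simp: A_def algebra_simps)
    qed
    moreover have "at s within {s..} \<noteq> bot"
      by (simp add: at_within_Ici_at_right)
    ultimately obtain y where "y \<in> A" "y > s"
      using eventually_happens by blast
    then show False
      using cSup_upper[OF _ A(2), of y] by (simp add: s_def)
  qed
  with \<open>s \<in> A\<close> have "f b \<le> f a + e * (b - a)" by (simp add: A_def)
  with e show "f b \<le> f a + e0" by simp
qed

text \<open>Polarisation: \<open>4 <A x, y>\<close> is the difference of the form at
  \<open>x + y\<close> and \<open>x - y\<close>, and the parallelogram law turns the form bound into
  \<open>4 M |x|^2\<close> once \<open>|y| = |x|\<close>. Taking \<open>y\<close> along
  \<open>A x\<close> gives the operator norm; with \<open>M = 0\<close>, a symmetric operator is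
  determined by its quadratic form.\<close>

lemma norm_le_of_symmetric_form_bound:
  fixes A :: "'h::real_inner \<Rightarrow> 'h"
  assumes lin: "linear A" and sym: "\<And>x y. inner (A x) y = inner x (A y)"
    and form: "\<And>x. \<bar>inner (A x) x\<bar> \<le> M * (norm x)\<^sup>2"
  shows "norm (A x) \<le> M * norm x"
proof (cases "A x = 0 \<or> x = 0")
  case True
  have "0 \<le> M * (norm x)\<^sup>2" using form[of x] by linarith
  then show ?thesis using True linear_0[OF lin]
    by (auto simp: zero_le_mult_iff)
next
  case False
  define y where "y = (norm x / norm (A x)) *\<^sub>R A x"
  have ny: "norm y = norm x" using False by (simp add: y_def)
  have "4 * inner (A x) y = inner (A (x + y)) (x + y) - inner (A (x - y)) (x - y)"
    using sym[of x y] by (simp add: linear_add[OF lin] linear_diff[OF lin] inner_simps inner_commute)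
  also have "\<dots> \<le> M * (norm (x + y))\<^sup>2 + M * (norm (x - y))\<^sup>2"
    using form[of "x + y"] form[of "x - y"] by linarith
  also have "\<dots> = 4 * M * (norm x)\<^sup>2"
  proof -
    have "(norm (x + y))\<^sup>2 + (norm (x - y))\<^sup>2 = 2 * (norm x)\<^sup>2 + 2 * (norm y)\<^sup>2"
      unfolding power2_norm_eq_inner by (simp add: inner_simps inner_commute)
    then show ?thesis
      using ny by (simp add: distrib_left[symmetric])
  qed
  finally have "inner (A x) y \<le> M * (norm x)\<^sup>2" by simp
  moreover have "inner (A x) y = norm x * norm (A x)"
    using False by (simp add: y_def dot_square_norm power2_eq_square)
  ultimately have "norm x * norm (A x) \<le> norm x * (M * norm x)"
    by (simp add: power2_eq_square algebra_simps)
  then show ?thesis using False by simp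
qed

section \<open>Contraction, differentiability and symmetry of the semigroup\<close>

locale selfadjoint_semigroup =
  fixes L :: "'h::{real_inner, complete_space} \<Rightarrow> 'h" and D :: "'h set"
    and S :: "real \<Rightarrow> 'h \<Rightarrow> 'h"
  assumes neg_selfadjoint: "neg_selfadjoint L D"
    and generates: "generates L D S"
begin

lemma subspace_D: "subspace D" and closure_D: "closure D = UNIV"
  using neg_selfadjoint unfolding neg_selfadjoint_def by blast+

lemma L_lin: "x \<in> D \<Longrightarrow> y \<in> D \<Longrightarrow> L (a *\<^sub>R x + b *\<^sub>R y) = a *\<^sub>R L x + b *\<^sub>R L y"
  using neg_selfadjoint unfolding neg_selfadjoint_def by blast

lemma L_scaleR: "x \<in> D \<Longrightarrow> L (a *\<^sub>R x) = a *\<^sub>R L x"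
  using L_lin[of x x a 0] by simp

lemma L_add: "x \<in> D \<Longrightarrow> y \<in> D \<Longrightarrow> L (x + y) = L x + L y"
  using L_lin[of x y 1 1] by simp

lemma L_diff: "x \<in> D \<Longrightarrow> y \<in> D \<Longrightarrow> L (x - y) = L x - L y"
  using L_lin[of x y 1 "-1"] by simp

lemma L_sym: "x \<in> D \<Longrightarrow> y \<in> D \<Longrightarrow> inner (L x) y = inner x (L y)"
  using neg_selfadjoint unfolding neg_selfadjoint_def by blast

text \<open>The half of selfadjointness beyond symmetry: it is what places limits and the values of
  \<open>fracA S 1\<close> in \<open>D\<close>.\<close>

lemma L_adjointI: "(\<And>x. x \<in> D \<Longrightarrow> inner (L x) y = inner x z) \<Longrightarrow> y \<in> D \<and> L y = z"
  using neg_selfadjoint unfolding neg_selfadjoint_def by blast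

definition rate :: real where
  "rate = (SOME w. w > 0 \<and> (\<forall>x\<in>D. inner x (L x) \<le> - w * inner x x))"

lemma rate: "rate > 0" "x \<in> D \<Longrightarrow> inner x (L x) \<le> - rate * inner x x"
proof -
  obtain c where "c < 0" "\<forall>x\<in>D. inner x (L x) \<le> c * inner x x"
    using neg_selfadjoint unfolding neg_selfadjoint_def by blast
  then have "\<exists>w. w > 0 \<and> (\<forall>x\<in>D. inner x (L x) \<le> - w * inner x x)"
    by (intro exI[of _ "- c"]) auto
  from someI_ex[OF this] show "rate > 0" "x \<in> D \<Longrightarrow> inner x (L x) \<le> - rate * inner x x"
    by (auto simp: rate_def)
qed

lemma S_0 [simp]: "S 0 x = x"
  using generates by (auto simp: generates_def)

lemma bounded_linear_S: "t \<ge> 0 \<Longrightarrow> bounded_linear (S t)"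
  using generates by (auto simp: generates_def)

lemma linear_S: "t \<ge> 0 \<Longrightarrow> linear (S t)"
  using bounded_linear_S bounded_linear.linear by blast

lemmas S_add = linear_add[OF linear_S]
  and S_diff = linear_diff[OF linear_S]
  and S_minus = linear_neg[OF linear_S]
  and S_scaleR = linear_scale[OF linear_S]

lemma S_zero [simp]: "t \<ge> 0 \<Longrightarrow> S t 0 = 0"
  using linear_0[OF linear_S] .

lemma S_S: "t \<ge> 0 \<Longrightarrow> s \<ge> 0 \<Longrightarrow> S t (S s x) = S (t + s) x"
  using generates by (auto simp: generates_def)

lemma S_commute: "t \<ge> 0 \<Longrightarrow> s \<ge> 0 \<Longrightarrow> S t (S s x) = S s (S t x)"
  by (simp add: S_S add.commute)

lemma continuous_on_S: "continuous_on {0..} (\<lambda>t. S t x)"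
  using generates by (auto simp: generates_def)

lemma S_deriv_0: "x \<in> D \<Longrightarrow> ((\<lambda>t. S t x) has_vector_derivative L x) (at 0 within {0..})"
  using generates by (auto simp: generates_def)

lemma D_iff: "x \<in> D \<longleftrightarrow> (\<exists>y. ((\<lambda>t. S t x) has_vector_derivative y) (at 0 within {0..}))"
  using generates by (auto simp: generates_def)

lemma S_D:
  assumes "x \<in> D" "t \<ge> 0"
  shows "S t x \<in> D" "L (S t x) = S t (L x)"
proof -
  have "((\<lambda>s. S t (S s x)) has_vector_derivative S t (L x)) (at 0 within {0..})"
    by (rule bounded_linear.has_vector_derivative[OF bounded_linear_S[OF assms(2)] S_deriv_0[OF assms(1)]])
  then have *: "((\<lambda>s. S s (S t x)) has_vector_derivative S t (L x)) (at 0 within {0..})"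
    by (rule has_vector_derivative_transform[rotated 2]) (use assms in \<open>auto simp: S_commute\<close>)
  then show "S t x \<in> D" using D_iff by blast
  from S_deriv_0[OF this] * show "L (S t x) = S t (L x)"
    by (rule vector_derivative_unique_within[rotated])
       (simp add: at_within_Ici_at_right)
qed

lemma D_induct:
  assumes "closed {x. P x}" "\<And>x. x \<in> D \<Longrightarrow> P x"
  shows "P x"
proof -
  have "closure D \<subseteq> {x. P x}"
    using assms by (intro closure_minimal) auto
  then show ?thesis using closure_D by auto
qed

lemma S_continuous_apply: "t \<ge> 0 \<Longrightarrow> continuous_on A f \<Longrightarrow> continuous_on A (\<lambda>x. S t (f x))"
  by (rule bounded_linear.continuous_on[OF bounded_linear_S])

lemma S_right_deriv:
  assumes "x \<in> D" "t \<ge> 0"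
  shows "((\<lambda>u. S u x) has_vector_derivative S t (L x)) (at t within {t..})"
proof -
  have "((\<lambda>u. S u (S t x)) has_vector_derivative L (S t x)) (at (t - t) within (\<lambda>u. u - t) ` {t..})"
  proof -
    have "(\<lambda>u. u - t) ` {t..} = {0..}" by (auto simp: image_iff intro!: bexI[of _ "_ + t"])
    then show ?thesis using S_deriv_0[OF S_D(1)[OF assms]] by simp
  qed
  moreover have "((\<lambda>u. u - t) has_vector_derivative 1) (at t within {t..})"
    by (auto intro!: derivative_eq_intros)
  ultimately have "((\<lambda>u. S (u - t) (S t x)) has_vector_derivative S t (L x)) (at t within {t..})"
    using vector_diff_chain_within[of "\<lambda>u. u - t" 1 t "{t..}" "\<lambda>u. S u (S t x)" "L (S t x)"]
    by (simp add: o_def S_D[OF assms])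
  then show ?thesis
    by (rule has_vector_derivative_transform[rotated 2]) (use assms in \<open>auto simp: S_S\<close>)
qed

text \<open>Energy estimate: the form bound makes \<open>exp (2 * rate * s) * |S_s x|^2\<close>
  nonincreasing for \<open>x\<close> in \<open>D\<close>, and density extends the result.\<close>

lemma norm_S:
  assumes "t \<ge> 0"
  shows "norm (S t x) \<le> exp (- rate * t) * norm x"
proof (rule D_induct[where P = "\<lambda>x. norm (S t x) \<le> exp (- rate * t) * norm x"])
  show "closed {x. norm (S t x) \<le> exp (- rate * t) * norm x}"
    using assms by (intro closed_Collect_le continuous_intros S_continuous_apply)
next
  fix x assume x: "x \<in> D"
  define f :: "real \<Rightarrow> real" where "f s = exp (2 * rate * s) * inner (S s x) (S s x)" for s
  have "f t \<le> f 0"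
  proof (rule nonincreasing_of_right_derivative_nonpos[OF assms])
    show "continuous_on {0..t} f"
      unfolding f_def
      by (intro continuous_intros continuous_on_subset[OF continuous_on_S]) auto
    fix s :: real assume s: "0 \<le> s"
    show "(f has_real_derivative (2 * rate * exp (2 * rate * s) * inner (S s x) (S s x)
        + exp (2 * rate * s) * (2 * inner (S s x) (L (S s x))))) (at s within {s..})"
    proof -
      have "((\<lambda>s. inner (S s x) (S s x)) has_real_derivative
          inner (S s x) (S s (L x)) + inner (S s (L x)) (S s x)) (at s within {s..})"
        unfolding has_real_derivative_iff_has_vector_derivative
        by (rule bounded_bilinear.has_vector_derivative[OF bounded_bilinear_inner])
           (use S_right_deriv x s in auto)
      then show ?thesis
        unfolding f_def
        by (auto intro!: derivative_eq_intros simp: S_D[OF x s] inner_commute)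
    qed
    show "2 * rate * exp (2 * rate * s) * inner (S s x) (S s x)
        + exp (2 * rate * s) * (2 * inner (S s x) (L (S s x))) \<le> 0"
      using mult_left_mono[OF rate(2)[OF S_D(1)[OF x s]], of "2 * exp (2 * rate * s)"]
      by (simp add: algebra_simps)
  qed
  then have "(exp (rate * t) * norm (S t x))\<^sup>2 \<le> (norm x)\<^sup>2"
    using exp_double[of "rate * t"]
    by (simp add: f_def power_mult_distrib dot_square_norm mult.assoc)
  then have "exp (rate * t) * norm (S t x) \<le> norm x"
    by (rule power2_le_imp_le) simp
  then have "exp (- rate * t) * (exp (rate * t) * norm (S t x)) \<le> exp (- rate * t) * norm x"
    by (rule mult_left_mono) simp
  moreover have "exp (- rate * t) * (exp (rate * t) * norm (S t x)) = norm (S t x)"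
    by (simp add: exp_minus)
  ultimately show "norm (S t x) \<le> exp (- rate * t) * norm x" by linarith
qed

lemma norm_S_le:
  assumes "t \<ge> 0"
  shows "norm (S t x) \<le> norm x"
proof -
  have "exp (- rate * t) * norm x \<le> 1 * norm x"
    using rate(1) assms by (intro mult_right_mono) auto
  then show ?thesis using norm_S[OF assms, of x] by simp
qed

lemma norm_S_diff_commute:
  assumes "0 \<le> s" "s \<le> t"
  shows "norm (S t x - S s x) \<le> norm (S (t - s) x - x)"
proof -
  have "S t x - S s x = S s (S (t - s) x - x)"
    using assms by (simp add: S_diff S_S)
  then show ?thesis using norm_S_le[OF assms(1)] by simp
qed

text \<open>To the left of \<open>t\<close> the smaller time \<open>y = t - h\<close> is factored
  out of the difference quotient, which leaves \<open>h *\<^sub>R (S h (L x) - L x)\<close> minus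
  the first-order remainder at 0. Strong continuity makes the first term \<open>o(h)\<close>, and
  contraction keeps \<open>S y\<close> from enlarging either.\<close>

lemma S_deriv:
  assumes x: "x \<in> D" and t: "t \<ge> 0"
  shows "((\<lambda>u. S u x) has_vector_derivative S t (L x)) (at t within {0..})"
  unfolding has_vector_derivative_def has_derivative_within_alt
proof (intro conjI allI impI)
  show "bounded_linear (\<lambda>r. r *\<^sub>R S t (L x))"
    by (rule bounded_linear_scaleR_left)
next
  fix e :: real assume e: "e > 0"
  obtain d1 where d1: "d1 > 0" "\<And>y. y \<ge> 0 \<Longrightarrow> y < d1 \<Longrightarrow> norm (S y x - x - y *\<^sub>R L x) \<le> e / 2 * y"
    using S_deriv_0[OF x] e unfolding has_vector_derivative_def has_derivative_within_alt
    by (auto dest!: spec[of _ "e / 2"])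
  have "continuous (at 0 within {0..}) (\<lambda>t. S t (L x))"
    using continuous_on_S by (simp add: continuous_on_eq_continuous_within)
  then obtain d2 where d2: "d2 > 0" "\<And>y. y \<ge> 0 \<Longrightarrow> y < d2 \<Longrightarrow> norm (S y (L x) - L x) \<le> e / 2"
    using e unfolding continuous_within_eps_delta
    by (auto dest!: spec[of _ "e / 2"] simp: dist_norm less_imp_le)
  show "\<exists>d>0. \<forall>y\<in>{0..}. norm (y - t) < d \<longrightarrow>
      norm (S y x - S t x - (y - t) *\<^sub>R S t (L x)) \<le> e * norm (y - t)"
  proof (intro exI[of _ "min d1 d2"] conjI ballI impI)
    fix y assume y: "y \<in> {0..}" "norm (y - t) < min d1 d2"
    show "norm (S y x - S t x - (y - t) *\<^sub>R S t (L x)) \<le> e * norm (y - t)"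
    proof (cases "t \<le> y")
      case True
      have "S y x - S t x - (y - t) *\<^sub>R S t (L x) = S t (S (y - t) x - x - (y - t) *\<^sub>R L x)"
        using t True by (simp add: S_diff S_S S_scaleR)
      also have "norm \<dots> \<le> e / 2 * (y - t)"
        using norm_S_le[OF t] d1(2)[of "y - t"] y True by (smt (verit, best) real_norm_def)
      also have "\<dots> \<le> e * norm (y - t)" using e True by (simp add: field_simps)
      finally show ?thesis .
    next
      case False
      define h where "h = t - y"
      have h: "h > 0" "h < d1" "h < d2" "t = y + h" using False y by (auto simp: h_def)
      have "S y x - S t x - (y - t) *\<^sub>R S t (L x) =
          S y (h *\<^sub>R (S h (L x) - L x) - (S h x - x - h *\<^sub>R L x))"
        using y h by (simp add: S_diff S_S S_scaleR scaleR_diff_right)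
      also have "norm \<dots> \<le> norm (h *\<^sub>R (S h (L x) - L x) - (S h x - x - h *\<^sub>R L x))"
        using y by (intro norm_S_le) auto
      also have "\<dots> \<le> h * norm (S h (L x) - L x) + norm (S h x - x - h *\<^sub>R L x)"
        using norm_triangle_ineq4[of "h *\<^sub>R (S h (L x) - L x)" "S h x - x - h *\<^sub>R L x"] h by simp
      also have "\<dots> \<le> h * (e / 2) + e / 2 * h"
        using d1(2)[of h] d2(2)[of h] h by (intro add_mono mult_left_mono) auto
      also have "\<dots> = e * norm (y - t)" using h by (simp add: field_simps)
      finally show ?thesis .
    qed
  qed (use d1 d2 in auto)
qed

lemma S_integral:
  assumes "x \<in> D" "0 \<le> t"
  shows "((\<lambda>s. S s (L x)) has_integral (S t x - x)) {0..t}"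
proof -
  have "((\<lambda>s. S s (L x)) has_integral (S t x - S 0 x)) {0..t}"
  proof (rule fundamental_theorem_of_calculus_interior[where f = "\<lambda>s. S s x", OF assms(2)])
    show "continuous_on {0..t} (\<lambda>s. S s x)"
      by (rule continuous_on_subset[OF continuous_on_S]) auto
    fix s assume s: "s \<in> {0<..<t}"
    then have "at s within {0..} = at s"
      by (intro at_within_interior) (auto simp: interior_Ici[of "-1"])
    then show "((\<lambda>s. S s x) has_vector_derivative S s (L x)) (at s)"
      using S_deriv[OF assms(1), of s] s by simp
  qed
  then show ?thesis by simp
qed

lemma norm_S_minus_id:
  assumes "x \<in> D" "0 \<le> t"
  shows "norm (S t x - x) \<le> t * norm (L x)"
proof -
  have "norm (S t x - x) \<le> norm (L x) * measure lborel (cbox 0 t)"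
    by (rule has_integral_bound[of _ "\<lambda>s. S s (L x)"])
       (use S_integral[OF assms] norm_S_le in auto)
  then show ?thesis using assms by (simp add: mult.commute)
qed

text \<open>For vectors in \<open>D\<close> the function
  \<open>s \<mapsto> <S_s x, S_{t-s} y>\<close> has derivative 0, because \<open>L\<close> is
  symmetric; its values at \<open>t\<close> and \<open>0\<close> are the two sides.\<close>

lemma S_sym:
  assumes t: "t \<ge> 0"
  shows "inner (S t x) y = inner x (S t y)"
proof -
  have DD: "inner (S t x) y = inner x (S t y)" if x: "x \<in> D" and y: "y \<in> D" for x y
  proof -
    define f where "f s = inner (S s x) (S (t - s) y)" for s
    have "(f has_field_derivative 0) (at s within {0..t})" if s: "s \<in> {0..t}" for s
    proof -
      have 1: "((\<lambda>u. S u x) has_vector_derivative S s (L x)) (at s within {0..t})"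
        by (rule has_vector_derivative_within_subset[OF S_deriv[OF x]]) (use s in auto)
      have "((\<lambda>u. S u y) has_vector_derivative S (t - s) (L y)) (at (t - s) within (\<lambda>u. t - u) ` {0..t})"
        by (rule has_vector_derivative_within_subset[OF S_deriv[OF y]]) (use s in auto)
      moreover have "((\<lambda>u. t - u) has_vector_derivative - 1) (at s within {0..t})"
        by (auto intro!: derivative_eq_intros)
      ultimately have 2: "((\<lambda>u. S (t - u) y) has_vector_derivative - S (t - s) (L y)) (at s within {0..t})"
        using vector_diff_chain_within[of "\<lambda>u. t - u" "- 1" s "{0..t}" "\<lambda>u. S u y" "S (t - s) (L y)"]
        by (simp add: o_def)
      have "(f has_vector_derivative inner (S s x) (- S (t - s) (L y)) + inner (S s (L x)) (S (t - s) y)) (at s within {0..t})"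
        unfolding f_def by (rule bounded_bilinear.has_vector_derivative[OF bounded_bilinear_inner 1 2])
      moreover have "inner (S s (L x)) (S (t - s) y) = inner (S s x) (S (t - s) (L y))"
        using s S_D[OF x, of s] S_D[OF y, of "t - s"] L_sym by (metis atLeastAtMost_iff diff_ge_0_iff_ge)
      ultimately show ?thesis
        by (simp add: has_real_derivative_iff_has_vector_derivative)
    qed
    then obtain c where "\<And>s. s \<in> {0..t} \<Longrightarrow> f s = c"
      using has_field_derivative_zero_constant[of "{0..t}" f] by auto
    from this[of 0] this[of t] t show ?thesis by (simp add: f_def)
  qed
  have "inner (S t x) y = inner x (S t y)" if y: "y \<in> D" for x y
    by (rule D_induct[where P = "\<lambda>x. inner (S t x) y = inner x (S t y)"])
       (use DD y t in \<open>auto intro!: closed_Collect_eq continuous_intros S_continuous_apply\<close>)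
  then show ?thesis
    by (rule_tac D_induct[where P = "\<lambda>y. inner (S t x) y = inner x (S t y)"])
       (use t in \<open>auto intro!: closed_Collect_eq continuous_intros S_continuous_apply\<close>)
qed

section \<open>Analyticity of the semigroup\<close>

lemma inner_S_eq_norm: "t \<ge> 0 \<Longrightarrow> inner (S t x) x = (norm (S (t / 2) x))\<^sup>2"
  using S_sym[of "t/2" "S (t/2) x" x] S_S[of "t/2" "t/2" x]
  by (simp add: dot_square_norm)

text \<open>Time \<open>(s + t) / 2\<close> splits as \<open>s / 2 + t / 2\<close>, so symmetry
  turns the left side into an inner product to which \<open>2 <x, y> \<le> |x|^2 + |y|^2\<close>
  applies.\<close>

lemma inner_S_midpoint:
  assumes "s \<ge> 0" "t \<ge> 0"
  shows "2 * inner (S ((s + t) / 2) x) x \<le> inner (S s x) x + inner (S t x) x"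
proof -
  have "inner (S ((s + t) / 2) x) x = inner (S (s / 2) x) (S (t / 2) x)"
    using assms S_sym[of "t/2" "S (s/2) x" x] S_S[of "t/2" "s/2" x] by (simp add: field_simps)
  also have "2 * \<dots> \<le> (norm (S (s / 2) x))\<^sup>2 + (norm (S (t / 2) x))\<^sup>2"
    using inner_ge_zero[of "S (s / 2) x - S (t / 2) x"]
    by (simp add: inner_diff_left inner_diff_right inner_commute power2_norm_eq_inner)
  finally show ?thesis using assms by (simp add: inner_S_eq_norm)
qed

text \<open>The second differences of $k \mapsto \langle S_{k\tau}x,x\rangle$ are nonnegative, so its
  $n$-th decrement is at most the average of the first $n$; this gives analyticity without
  spectral calculus.\<close>

lemma norm_S_Suc_diff:
  assumes "\<tau> \<ge> 0"
  shows "real n * norm (S (real n * \<tau>) x - S (real (Suc n) * \<tau>) x) \<le> norm x"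
proof (cases "n = 0")
  case False
  define d where "d x k = inner (S (real k * \<tau>) x) x - inner (S (real (Suc k) * \<tau>) x) x" for x k
  have "d x (Suc k) \<le> d x k" for x k
  proof -
    have "(real k * \<tau> + real (Suc (Suc k)) * \<tau>) / 2 = real (Suc k) * \<tau>"
      by (simp add: field_simps)
    then show ?thesis
      using inner_S_midpoint[of "real k * \<tau>" "real (Suc (Suc k)) * \<tau>" x] assms
      by (simp add: d_def del: of_nat_Suc)
  qed
  then have mono: "d x n \<le> d x k" if "k \<le> n" for x k
    using that lift_Suc_antimono_le[of "d x"] by blast
  have nonneg: "d x n \<ge> 0" for x
  proof -
    have "norm (S (real (Suc n) * \<tau> / 2) x) \<le> norm (S (real n * \<tau> / 2) x)"
      using norm_S_le[of "\<tau> / 2" "S (real n * \<tau> / 2) x"] assms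
      by (simp add: S_S field_simps)
    then show ?thesis
      using assms by (simp add: d_def inner_S_eq_norm del: of_nat_Suc)
  qed
  have "real n * d x n \<le> (norm x)\<^sup>2" for x
  proof -
    have "real n * d x n = (\<Sum>k<n. d x n)" by simp
    also have "\<dots> \<le> (\<Sum>k<n. d x k)" by (intro sum_mono mono) auto
    also have "\<dots> = inner x x - inner (S (real n * \<tau>) x) x"
      using sum_lessThan_telescope'[of "\<lambda>k. inner (S (real k * \<tau>) x) x" n] by (simp add: d_def)
    also have "\<dots> \<le> (norm x)\<^sup>2"
      using assms by (simp add: inner_S_eq_norm dot_square_norm)
    finally show ?thesis .
  qed
  note bound = this
  \<comment> \<open>So far only the quadratic form of the increment operator is bounded; symmetry
    upgrades this to the operator norm.\<close>
  let ?A = "\<lambda>x. S (real n * \<tau>) x - S (real (Suc n) * \<tau>) x"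
  have "norm (?A x) \<le> (1 / real n) * norm x"
  proof (rule norm_le_of_symmetric_form_bound[where A = ?A])
    show "linear ?A"
      using assms by (intro linear_compose_sub linear_S) auto
    show "inner (?A x) y = inner x (?A y)" for x y
      using assms by (simp add: inner_diff_left inner_diff_right S_sym)
    show "\<bar>inner (?A x) x\<bar> \<le> 1 / real n * (norm x)\<^sup>2" for x
      using bound[of x] nonneg[of x] False by (simp add: d_def inner_diff_left field_simps)
  qed
  then show ?thesis using False by (simp add: field_simps)
qed simp

text \<open>With step \<open>\<tau> = t / Suc n\<close> the time \<open>t\<close> is the
  \<open>Suc n\<close>-th node, so the previous bound reads
  \<open>|S_\<tau> S_t x - S_t x| \<le> \<tau> |x| / t\<close>; dividing by \<open>\<tau>\<close>
  and letting it tend to 0 bounds the derivative.\<close>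

lemma norm_LS_D:
  assumes x: "x \<in> D" and t: "t > 0"
  shows "norm (L (S t x)) \<le> norm x / t"
proof -
  define \<tau> where "\<tau> n = t / real (Suc n)" for n
  have \<tau>: "\<tau> n > 0" "real (Suc n) * \<tau> n = t" for n using t by (auto simp: \<tau>_def)
  have "(\<lambda>n. \<tau> n) \<longlonglongrightarrow> 0"
    unfolding \<tau>_def using LIMSEQ_inverse_real_of_nat[THEN tendsto_mult_left, of t]
    by (simp add: divide_inverse)
  have bound: "norm (S (\<tau> n) (S t x) - S t x) \<le> \<tau> n * (norm x / t)" for n
  proof -
    have "real (Suc n) * norm (S t x - S (real (Suc (Suc n)) * \<tau> n) x) \<le> norm x"
      using norm_S_Suc_diff[of "\<tau> n" "Suc n" x] \<tau>[of n] by simp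
    moreover have "S (real (Suc (Suc n)) * \<tau> n) x = S (\<tau> n) (S t x)"
    proof -
      have "real (Suc (Suc n)) * \<tau> n = \<tau> n + t"
        using \<tau>(2)[of n] by (simp add: algebra_simps)
      then show ?thesis using \<tau>(1)[of n] t by (simp add: S_S)
    qed
    ultimately have "norm (S (\<tau> n) (S t x) - S t x) \<le> norm x / real (Suc n)"
      by (simp add: norm_minus_commute field_simps del: of_nat_Suc)
    also have "\<dots> = \<tau> n * (norm x / t)" using t by (simp add: \<tau>_def)
    finally show ?thesis .
  qed
  show ?thesis
  proof (rule field_le_epsilon)
    fix e :: real assume "e > 0"
    then obtain d where d: "d > 0" "\<And>y. y \<ge> 0 \<Longrightarrow> y < d \<Longrightarrow>
        norm (S y (S t x) - S t x - y *\<^sub>R L (S t x)) \<le> e * y"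
      using S_deriv_0[OF S_D(1)[OF x, of t]] t
      unfolding has_vector_derivative_def has_derivative_within_alt by auto
    obtain n where "\<tau> n < d"
      using order_tendstoD(2)[OF \<open>\<tau> \<longlonglongrightarrow> 0\<close> d(1)] by (auto simp: eventually_sequentially)
    then have n: "norm (S (\<tau> n) (S t x) - S t x - \<tau> n *\<^sub>R L (S t x)) \<le> e * \<tau> n"
      using d(2) \<tau>(1)[of n] by simp
    have "\<tau> n * norm (L (S t x)) = norm (\<tau> n *\<^sub>R L (S t x))"
      using \<tau>(1)[of n] by simp
    also have "\<dots> \<le> \<tau> n * (norm x / t) + e * \<tau> n"
      using n bound[of n] norm_triangle_sub[of "\<tau> n *\<^sub>R L (S t x)" "S (\<tau> n) (S t x) - S t x"]
      by (simp add: norm_minus_commute)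
    also have "\<dots> = \<tau> n * (norm x / t + e)" by (simp add: algebra_simps)
    finally show "norm (L (S t x)) \<le> norm x / t + e"
      using \<tau>(1)[of n] by simp
  qed
qed

text \<open>The bound on \<open>D\<close> makes \<open>L (S t (X n))\<close> Cauchy along a sequence
  tending to \<open>x\<close>; closedness of \<open>L\<close>, in the form of
  \<open>L_adjointI\<close>, identifies the limit.\<close>

lemma S_in_D:
  assumes t: "t > 0"
  shows "S t x \<in> D" "norm (L (S t x)) \<le> norm x / t"
proof -
  obtain X where X: "\<And>n. X n \<in> D" "X \<longlonglongrightarrow> x"
    using closure_D closure_sequential[of x D] by auto
  have "norm (L (S t (X m)) - L (S t (X n))) \<le> dist (X m) (X n) / t" for m n
  proof -
    have "L (S t (X m)) - L (S t (X n)) = L (S t (X m - X n))"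
      using t X S_D(1) by (simp add: S_diff L_diff)
    then show ?thesis
      using norm_LS_D[OF subspace_diff[OF subspace_D X(1) X(1)] t] by (simp add: dist_norm)
  qed
  note bound = this
  have "Cauchy (\<lambda>n. L (S t (X n)))"
  proof (rule metric_CauchyI)
    fix e :: real assume "e > 0"
    then obtain M where "\<And>m n. m \<ge> M \<Longrightarrow> n \<ge> M \<Longrightarrow> dist (X m) (X n) < e * t"
      using metric_CauchyD[OF LIMSEQ_imp_Cauchy[OF X(2)], of "e * t"] t by auto
    then show "\<exists>M. \<forall>m\<ge>M. \<forall>n\<ge>M. dist (L (S t (X m))) (L (S t (X n))) < e"
      using bound t by (intro exI[of _ M]) (smt (verit) dist_norm divide_less_eq mult.commute)
  qed
  then obtain z where z: "(\<lambda>n. L (S t (X n))) \<longlonglongrightarrow> z"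
    using Cauchy_convergent_iff convergent_def by blast
  have SX: "(\<lambda>n. S t (X n)) \<longlonglongrightarrow> S t x"
    by (rule bounded_linear.tendsto[OF bounded_linear_S X(2)]) (use t in simp)
  have "S t x \<in> D \<and> L (S t x) = z"
  proof (rule L_adjointI)
    fix y assume "y \<in> D"
    have "(\<lambda>n. inner (L y) (S t (X n))) \<longlonglongrightarrow> inner (L y) (S t x)"
      by (intro tendsto_intros SX)
    moreover have "inner (L y) (S t (X n)) = inner y (L (S t (X n)))" for n
      using L_sym[OF \<open>y \<in> D\<close> S_D(1)[OF X(1)]] t by simp
    ultimately have "(\<lambda>n. inner y (L (S t (X n)))) \<longlonglongrightarrow> inner (L y) (S t x)" by simp
    moreover have "(\<lambda>n. inner y (L (S t (X n)))) \<longlonglongrightarrow> inner y z"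
      by (intro tendsto_intros z)
    ultimately show "inner (L y) (S t x) = inner y z"
      using LIMSEQ_unique by blast
  qed
  then show "S t x \<in> D" and "norm (L (S t x)) \<le> norm x / t"
  proof -
    assume *: "S t x \<in> D \<and> L (S t x) = z"
    then show "S t x \<in> D" ..
    have "(\<lambda>n. norm (X n) / t) \<longlonglongrightarrow> norm x / t"
      using t by (intro tendsto_intros X) auto
    then show "norm (L (S t x)) \<le> norm x / t"
      using * norm_LS_D[OF X(1) t] LIMSEQ_le[OF tendsto_norm[OF z]] by blast
  qed
qed

lemma L_S: "t > 0 \<Longrightarrow> s \<ge> 0 \<Longrightarrow> L (S (s + t) x) = S s (L (S t x))"
  using S_D(2)[OF S_in_D(1)] by (metis S_S less_imp_le)

text \<open>Half of the time is spent on decay and half on smoothing. The decay matters because the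
  Balakrishnan integral runs to infinity.\<close>

lemma norm_LS_exp:
  assumes t: "t > 0"
  shows "norm (L (S t x)) \<le> 2 / t * exp (- (rate / 2) * t) * norm x"
proof -
  have "L (S t x) = S (t / 2) (L (S (t / 2) x))"
    using L_S[of "t/2" "t/2" x] t by simp
  then have "norm (L (S t x)) \<le> exp (- rate * (t / 2)) * norm (L (S (t / 2) x))"
    using norm_S[of "t/2"] t by simp
  also have "\<dots> \<le> exp (- rate * (t / 2)) * (norm x / (t / 2))"
    using S_in_D(2)[of "t/2" x] t by (intro mult_left_mono) auto
  finally show ?thesis by (simp add: field_simps)
qed

text \<open>Again one half of \<open>t\<close> pays for decay. The entries of the minimum come from
  contraction and from smoothing; interpolating between them yields the fractional orders.\<close>

lemma norm_S_increment:
  assumes t: "t > 0" and "\<tau> \<ge> 0"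
  shows "norm (S (t + \<tau>) x - S t x) \<le> exp (- (rate / 2) * t) * min 2 (2 * \<tau> / t) * norm x"
proof -
  have eq: "S (t + \<tau>) x - S t x = S (t / 2) (S (t / 2 + \<tau>) x - S (t / 2) x)"
    using assms by (simp add: S_diff S_S)
  have a: "norm (S (t / 2 + \<tau>) x - S (t / 2) x) \<le> 2 * norm x"
    using norm_triangle_ineq4[of "S (t / 2 + \<tau>) x" "S (t / 2) x"] norm_S_le[of "t/2" x]
      norm_S_le[of "t/2 + \<tau>" x] assms by simp
  have b: "norm (S (t / 2 + \<tau>) x - S (t / 2) x) \<le> 2 * \<tau> / t * norm x"
  proof -
    have "norm (S \<tau> (S (t / 2) x) - S (t / 2) x) \<le> \<tau> * norm (L (S (t / 2) x))"
      using assms by (intro norm_S_minus_id S_in_D) auto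
    also have "\<dots> \<le> \<tau> * (norm x / (t / 2))"
      using assms by (intro mult_left_mono S_in_D) auto
    finally show ?thesis using assms by (simp add: S_S add.commute mult_ac)
  qed
  have "norm (S (t + \<tau>) x - S t x) \<le> exp (- rate * (t / 2)) * norm (S (t / 2 + \<tau>) x - S (t / 2) x)"
    unfolding eq using t by (intro norm_S) auto
  also have "\<dots> \<le> exp (- rate * (t / 2)) * (min 2 (2 * \<tau> / t) * norm x)"
    using a b by (intro mult_left_mono) (auto simp: min_def)
  finally show ?thesis by (simp add: mult.assoc)
qed

end

section \<open>Fractional powers\<close>

lemma integrable_powr_exp:
  fixes a w :: real
  assumes "a > 0" "w > 0"
  shows "(\<lambda>t. t powr (a - 1) * exp (- w * t)) integrable_on {0<..}"
proof -
  have "(\<lambda>t. norm (complex_of_real t powr (of_real a - 1) / of_real (exp (w * t)))) integrable_on {0<..}"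
    using absolutely_integrable_Gamma_integral[of "of_real a" w] assms
    by (simp add: absolutely_integrable_on_def)
  then show ?thesis
    by (rule integrable_eq)
       (auto simp: norm_divide norm_powr_real_powr exp_minus field_simps)
qed

text \<open>The Riemann-Liouville kernel; restricted to \<open>t > 0\<close> these form a
  convolution semigroup in \<open>a\<close>, the source of the law
  \<open>(-L)^(-a) (-L)^(-b) = (-L)^(-a-b)\<close>.\<close>

definition gamma_kernel :: "real \<Rightarrow> real \<Rightarrow> real" where
  "gamma_kernel a t = t powr (a - 1) / Gamma a"

lemma gamma_kernel_pos: "a > 0 \<Longrightarrow> t > 0 \<Longrightarrow> gamma_kernel a t > 0"
  using Gamma_real_pos[of a] by (simp add: gamma_kernel_def)

lemma gamma_kernel_nonneg: "a > 0 \<Longrightarrow> gamma_kernel a t \<ge> 0"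
  using Gamma_real_pos[of a] by (simp add: gamma_kernel_def)

lemma continuous_on_gamma_kernel [continuous_intros]:
  assumes "a > 0" "0 \<notin> A"
  shows "continuous_on A (gamma_kernel a)"
proof -
  have "Gamma a \<noteq> 0" using Gamma_real_pos[OF assms(1)] by linarith
  then show ?thesis
    using assms unfolding gamma_kernel_def by (intro continuous_intros) auto
qed

text \<open>Substituting \<open>s = r * y\<close> produces the Beta integral. The nonnegative form
  fits directly into Tonelli's theorem.\<close>

lemma nn_integral_powr_convolution:
  fixes a b r :: real
  assumes a: "a > 0" and b: "b > 0" and r: "r > 0"
  defines "k \<equiv> \<lambda>c t. indicator {0<..} t * gamma_kernel c t"
  shows "(\<integral>\<^sup>+ s. ennreal (k a s * k b (r - s)) \<partial>lborel) = ennreal (k (a + b) r)"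
proof -
  have [measurable]: "k c \<in> borel_measurable borel" for c unfolding k_def gamma_kernel_def by measurable
  have G: "Gamma a > 0" "Gamma b > 0" "Gamma (a + b) > 0" using a b by (auto intro: Gamma_real_pos)
  define C where "C = r powr (a + b - 2) / (Gamma a * Gamma b)"
  have "(\<integral>\<^sup>+ s. ennreal (k a s * k b (r - s)) \<partial>lborel)
      = ennreal r * (\<integral>\<^sup>+ y. ennreal (k a (r * y) * k b (r - r * y)) \<partial>lborel)"
    using r by (subst nn_integral_real_affine[where c = r and t = 0]) auto
  also have "(\<integral>\<^sup>+ y. ennreal (k a (r * y) * k b (r - r * y)) \<partial>lborel)
      = (\<integral>\<^sup>+ y. ennreal C * (ennreal (y powr (a - 1) * (1 - y) powr (b - 1)) * indicator {0..1} y) \<partial>lborel)"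
  proof (rule nn_integral_cong)
    fix y :: real
    consider "0 < y" "y < 1" | "y \<le> 0" | "1 \<le> y" by linarith
    then show "ennreal (k a (r * y) * k b (r - r * y)) =
        ennreal C * (ennreal (y powr (a - 1) * (1 - y) powr (b - 1)) * indicator {0..1} y)"
    proof cases
      case 1
      have e: "r - r * y = r * (1 - y)" by (simp add: algebra_simps)
      have "k a (r * y) * k b (r - r * y) = C * (y powr (a - 1) * (1 - y) powr (b - 1))"
      proof -
        have "r powr (a + b - 2) = r powr (a - 1) * r powr (b - 1)"
          by (simp add: powr_add[symmetric] algebra_simps)
        then show ?thesis
          unfolding e using 1 r by (simp add: k_def C_def powr_mult gamma_kernel_def)
      qed
      moreover have "C \<ge> 0" using G by (simp add: C_def)
      ultimately show ?thesis using 1 by (simp add: ennreal_mult)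
    next
      case 2
      then have "k a (r * y) = 0" using r by (auto simp: k_def indicator_def zero_less_mult_iff)
      \<comment> \<open>At \<open>y = 0\<close>, and likewise at \<open>y = 1\<close> below, the
        right side vanishes because \<open>0 powr p = 0\<close>; so the closed interval of the Beta
        integral matches the open supports.\<close>
      then show ?thesis using 2 by (cases "y = 0") (auto simp: indicator_def)
    next
      case 3
      then have "k b (r - r * y) = 0" using r by (auto simp: k_def indicator_def)
      then show ?thesis using 3 by (cases "y = 1") (auto simp: indicator_def)
    qed
  qed
  also have "\<dots> = ennreal C * ennreal (Beta a b)"
    using nn_integral_has_integral_lebesgue'[OF _ has_integral_Beta_real[OF a b]]
    by (subst nn_integral_cmult) auto
  also have "ennreal r * (ennreal C * ennreal (Beta a b)) = ennreal (k (a + b) r)"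
  proof -
    have "r * (C * Beta a b) = k (a + b) r"
      using r G powr_add[of r 1 "a + b - 2"]
      by (simp add: C_def k_def Beta_def gamma_kernel_def field_simps)
    moreover have "C \<ge> 0" "Beta a b \<ge> 0" using G by (auto simp: C_def Beta_def)
    ultimately show ?thesis using r by (metis ennreal_mult' ennreal_mult'' less_imp_le)
  qed
  finally show ?thesis .
qed

context selfadjoint_semigroup
begin

section \<open>Negative powers: symmetry, boundedness, injectivity, composition\<close>

lemma fracA_0 [simp]: "fracA S 0 x = x"
  by (simp add: fracA_def)

lemma fracA_integrable:
  assumes "a > 0"
  shows "(\<lambda>t. gamma_kernel a t *\<^sub>R S t x) integrable_on {0<..}"
proof (rule integrable_on_greaterThan_of_continuous_dominated)
  show "continuous_on {0<..} (\<lambda>t. gamma_kernel a t *\<^sub>R S t x)"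
    using assms
    by (intro continuous_intros continuous_on_subset[OF continuous_on_S]) auto
  show "(\<lambda>t. (t powr (a - 1) * exp (- rate * t)) * (norm x / Gamma a)) integrable_on {0<..}"
    by (intro integrable_on_mult_left integrable_powr_exp assms rate)
  show "norm (gamma_kernel a t *\<^sub>R S t x) \<le> (t powr (a - 1) * exp (- rate * t)) * (norm x / Gamma a)"
    if "t \<in> {0<..}" for t
    using that norm_S[of t x] Gamma_real_pos[OF assms]
    by (simp add: gamma_kernel_def divide_simps mult.assoc mult_left_mono)
qed

lemma
  assumes "a > 0"
  shows integrable_inner_fracA: "(\<lambda>t. gamma_kernel a t * inner (S t x) y) integrable_on {0<..}"
    and inner_fracA: "inner (fracA S a x) y = integral {0<..} (\<lambda>t. gamma_kernel a t * inner (S t x) y)"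
  using inner_integral_left[OF fracA_integrable[OF assms, of x], of y] assms by (auto simp: fracA_def gamma_kernel_def)

text \<open>Reduces estimates of a negative power to pointwise bounds on \<open><S_t x, y>\<close>:
  the weight \<open>t^(a-1)\<close> absorbs a singularity \<open>t^(-q)\<close> when
  \<open>q < a\<close>, and \<open>C\<close> depends on neither vector.\<close>

lemma inner_fracA_bound:
  assumes "0 \<le> q" "q < a" "v > 0"
  obtains C where "C \<ge> 0" "\<And>x y B. (\<And>t. t > 0 \<Longrightarrow> inner (S t x) y \<le> B * (t powr (- q) * exp (- v * t))) \<Longrightarrow>
    inner (fracA S a x) y \<le> C * B"
proof -
  have a: "a > 0" using assms by simp
  let ?G = "\<lambda>t. (t powr (a - q - 1) * exp (- v * t)) * (1 / Gamma a)"
  have G: "?G integrable_on {0<..}"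
    using assms by (intro integrable_on_mult_left integrable_powr_exp) auto
  have bound: "inner (fracA S a x) y \<le> integral {0<..} ?G * B"
    if le: "\<And>t. t > 0 \<Longrightarrow> inner (S t x) y \<le> B * (t powr (- q) * exp (- v * t))" for x y B
  proof -
    have "inner (fracA S a x) y \<le> integral {0<..} (\<lambda>t. ?G t * B)"
      unfolding inner_fracA[OF a]
    proof (rule integral_le)
      show "gamma_kernel a t * inner (S t x) y \<le> ?G t * B" if "t \<in> {0<..}" for t
      proof -
        have "gamma_kernel a t * inner (S t x) y
          \<le> gamma_kernel a t * (B * (t powr (- q) * exp (- v * t)))"
          using that le[of t] gamma_kernel_pos[OF a] by (intro mult_left_mono) (auto intro: less_imp_le)
        also have "\<dots> = (t powr (a - 1) * t powr (- q)) * exp (- v * t) * (1 / Gamma a) * B"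
          by (simp add: gamma_kernel_def)
        also have "t powr (a - 1) * t powr (- q) = t powr (a - q - 1)"
          by (simp add: powr_add[symmetric] algebra_simps)
        finally show ?thesis .
      qed
    qed (intro integrable_on_mult_left[OF G] integrable_inner_fracA[OF a])+
    then show ?thesis by simp
  qed
  show thesis
  proof (rule that[OF _ bound])
    show "0 \<le> integral {0<..} ?G"
      using Gamma_real_pos[OF a] by (intro integral_nonneg[OF G]) auto
  qed
qed

lemma fracA_inner_sym:
  assumes "a \<ge> 0"
  shows "inner (fracA S a x) y = inner x (fracA S a y)"
proof (cases "a = 0")
  case False
  then have a: "a > 0" using assms by simp
  have "integral {0<..} (\<lambda>t. gamma_kernel a t * inner (S t x) y)
      = integral {0<..} (\<lambda>t. gamma_kernel a t * inner (S t y) x)"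
    by (rule Henstock_Kurzweil_Integration.integral_cong) (metis S_sym greaterThan_iff inner_commute less_imp_le)
  then show ?thesis using a by (simp add: inner_fracA inner_commute[of x])
qed simp

lemma eq_by_inner: "(\<And>z. inner x z = inner y z) \<Longrightarrow> x = y"
  for x y :: 'h
  using vector_eq_rdot by blast

lemma bounded_linear_fracA:
  assumes "a \<ge> 0"
  shows "bounded_linear (fracA S a)"
proof (cases "a = 0")
  case True
  then have "fracA S a = (\<lambda>x. x)" by (auto simp: fracA_def)
  then show ?thesis using bounded_linear_ident by simp
next
  case False
  then have a: "a > 0" using assms by simp
  obtain C where C: "C \<ge> 0" "\<And>x y B. (\<And>t. t > 0 \<Longrightarrow> inner (S t x) y \<le> B * (t powr (- 0) * exp (- rate * t))) \<Longrightarrow>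
    inner (fracA S a x) y \<le> C * B"
    using inner_fracA_bound[of 0 a rate] a rate(1) by auto
  show ?thesis
  proof (rule bounded_linear_intro[of _ C])
    show "fracA S a (x + y) = fracA S a x + fracA S a y" for x y
      by (rule eq_by_inner) (simp add: fracA_inner_sym[OF assms] inner_add_left)
    show "fracA S a (r *\<^sub>R x) = r *\<^sub>R fracA S a x" for r x
      by (rule eq_by_inner) (simp add: fracA_inner_sym[OF assms])
    show "norm (fracA S a x) \<le> norm x * C" for x
    proof (rule norm_le_of_inner_le)
      fix y
      have "inner (fracA S a x) y \<le> C * (norm x * norm y)"
      proof (rule C(2))
        fix t :: real assume "t > 0"
        then have "inner (S t x) y \<le> exp (- rate * t) * norm x * norm y"
          using norm_cauchy_schwarz[of "S t x" y] norm_S[of t x]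
          by (meson less_imp_le mult_right_mono norm_ge_zero order_trans)
        then show "inner (S t x) y \<le> norm x * norm y * (t powr - 0 * exp (- rate * t))"
          using \<open>t > 0\<close> by (simp add: mult_ac)
      qed
      then show "inner (fracA S a x) y \<le> norm x * C * norm y" by (simp add: mult_ac)
    qed (use C in auto)
  qed
qed

lemma linear_fracA: "a \<ge> 0 \<Longrightarrow> linear (fracA S a)"
  using bounded_linear_fracA bounded_linear.linear by blast

lemmas fracA_add = linear_add[OF linear_fracA]
  and fracA_diff = linear_diff[OF linear_fracA]
  and fracA_minus = linear_neg[OF linear_fracA]
  and fracA_scaleR = linear_scale[OF linear_fracA]

lemma fracA_bound:
  assumes "a \<ge> 0"
  obtains M where "M > 0" "\<And>x. norm (fracA S a x) \<le> M * norm x"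
  using bounded_linear.pos_bounded[OF bounded_linear_fracA[OF assms]] by (metis mult.commute)

lemma fracA_S:
  assumes "a \<ge> 0" "s \<ge> 0"
  shows "fracA S a (S s x) = S s (fracA S a x)"
proof (cases "a = 0")
  case False
  then have a: "a > 0" using assms by simp
  show ?thesis
  proof (rule eq_by_inner)
    fix z
    have "integral {0<..} (\<lambda>t. gamma_kernel a t * inner (S t (S s x)) z)
        = integral {0<..} (\<lambda>t. gamma_kernel a t * inner (S t x) (S s z))"
      using assms by (intro Henstock_Kurzweil_Integration.integral_cong)
         (auto simp: S_sym[symmetric] S_commute)
    then show "inner (fracA S a (S s x)) z = inner (S s (fracA S a x)) z"
      using a assms by (simp add: inner_fracA S_sym)
  qed
qed simp

text \<open>\<open><fracA S a x, x>\<close> is the integral of a positive weight times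
  \<open>|S_{t/2} x|^2\<close>; if it vanishes, so does \<open>S s x\<close> for all
  \<open>s > 0\<close>, and strong continuity at 0 gives \<open>x = 0\<close>.\<close>

lemma fracA_inj:
  assumes "a \<ge> 0" "fracA S a x = 0"
  shows "x = 0"
proof (cases "a = 0")
  case True
  with assms(2) show ?thesis by simp
next
  case False
  then have a: "a > 0" using assms by simp
  let ?f = "\<lambda>t. gamma_kernel a t * inner (S t x) x"
  have nonneg: "?f t \<ge> 0" if "t > 0" for t
    using that gamma_kernel_nonneg[OF a] by (simp add: inner_S_eq_norm)
  have zero: "S s x = 0" if "s > 0" for s
  proof -
    \<comment> \<open>The window starts at \<open>2 * s\<close> since \<open>inner_S_eq_norm\<close>
      halves the time.\<close>
    have cont: "continuous_on {2 * s..2 * s+1} ?f"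
      using that a
      by (intro continuous_intros continuous_on_subset[OF continuous_on_S]) auto
    have "integral {2 * s..2 * s+1} ?f \<le> integral {0<..} ?f"
      using that nonneg
      by (intro integral_subset_le integrable_inner_fracA a integrable_continuous_real cont) auto
    also have "\<dots> = 0" using assms inner_fracA[OF a, of x x] by simp
    finally have "integral {2 * s..2 * s+1} ?f \<le> 0" .
    moreover have "0 \<le> integral {2 * s..2 * s+1} ?f"
      using that nonneg by (intro integral_nonneg integrable_continuous_real cont) auto
    ultimately have "?f (2 * s) = 0"
      using integral_eq_0_iff[OF cont] nonneg that by auto
    then show ?thesis
      using that gamma_kernel_pos[OF a, of "2 * s"] by (simp add: inner_S_eq_norm)
  qed
  have "((\<lambda>s. S s x) \<longlongrightarrow> S 0 x) (at 0 within {0..})"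
    using continuous_on_S[of x] unfolding continuous_on_def by (rule bspec) simp
  then have "((\<lambda>s. S s x) \<longlongrightarrow> S 0 x) (at_right 0)"
    by (simp add: at_within_Ici_at_right)
  moreover have "((\<lambda>s. S s x) \<longlongrightarrow> 0) (at_right 0)"
    by (rule tendsto_eventually) (auto simp: eventually_at_filter zero)
  ultimately show ?thesis
    using tendsto_unique[OF trivial_limit_at_right_real] by fastforce
qed

lemma fracA_inject: "a \<ge> 0 \<Longrightarrow> fracA S a x = fracA S a y \<longleftrightarrow> x = y"
  using fracA_inj[of a "x - y"] by (auto simp: fracA_diff)

text \<open>On the diagonal all integrands are nonnegative, so the double integral may be rearranged
  by Tonelli; the substitution \<open>r = s + t\<close> and the convolution of the kernels collapse
  it to a single integral.\<close>

lemma inner_fracA_fracA: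
  assumes a: "a > 0" and b: "b > 0"
  shows "inner (fracA S a (fracA S b x)) x = inner (fracA S (a + b) x) x"
proof -
  define k :: "real \<Rightarrow> real \<Rightarrow> real" where "k c t = indicator {0<..} t * gamma_kernel c t" for c t
  \<comment> \<open>Cutting off at 0 makes \<open>\<phi>\<close> continuous on the whole line, hence
    measurable; the kernels vanish wherever the cut-off is active.\<close>
  define \<phi> :: "real \<Rightarrow> real" where "\<phi> r = inner (S (max 0 r) x) x" for r
  have [measurable]: "k c \<in> borel_measurable borel" for c unfolding k_def gamma_kernel_def by measurable
  have "continuous_on UNIV \<phi>"
    unfolding \<phi>_def
    by (intro continuous_intros continuous_on_compose2[OF continuous_on_S]) auto
  then have [measurable]: "\<phi> \<in> borel_measurable borel" by (rule borel_measurable_continuous_onI)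
  have \<phi>_nonneg: "\<phi> r \<ge> 0" for r by (simp add: \<phi>_def inner_S_eq_norm)
  have k_nonneg: "k c t \<ge> 0" if "c > 0" for c t
    using gamma_kernel_nonneg[OF that] by (simp add: k_def)
  have frac: "(\<integral>\<^sup>+ t. ennreal (k c t * \<phi> (s + t)) \<partial>lborel) = ennreal (inner (fracA S c x) (S s x))"
    if "c > 0" "s \<ge> 0" for c s
  proof -
    let ?f = "\<lambda>t. gamma_kernel c t * inner (S t x) (S s x)"
    have eq: "inner (S t x) (S s x) = \<phi> (s + t)" if "t > 0" for t
      using that \<open>s \<ge> 0\<close> by (simp add: \<phi>_def S_sym[symmetric] S_S)
    have "(?f has_integral inner (fracA S c x) (S s x)) {0<..}"
      using integrable_inner_fracA[OF that(1)] by (simp add: inner_fracA[OF that(1)] integrable_integral)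
    then have "(\<integral>\<^sup>+ t. ennreal (?f t) * indicator {0<..} t \<partial>lborel) = ennreal (inner (fracA S c x) (S s x))"
      using gamma_kernel_nonneg[OF that(1)]
      by (intro nn_integral_has_integral_lebesgue') (auto simp: eq \<phi>_nonneg)
    moreover have "ennreal (?f t) * indicator {0<..} t = ennreal (k c t * \<phi> (s + t))" for t
      by (cases "t > 0") (auto simp: k_def eq)
    ultimately show ?thesis by simp
  qed
  have nonneg: "inner (fracA S c x) (S s x) \<ge> 0" if "c > 0" "s \<ge> 0" for c s
  proof -
    let ?f = "\<lambda>t. gamma_kernel c t * inner (S t x) (S s x)"
    have "inner (S t x) (S s x) = \<phi> (s + t)" if "t > 0" for t
      using that \<open>s \<ge> 0\<close> by (simp add: \<phi>_def S_sym[symmetric] S_S)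
    then show ?thesis
      unfolding inner_fracA[OF that(1)] using gamma_kernel_nonneg[OF that(1)] \<phi>_nonneg
      by (intro integral_nonneg integrable_inner_fracA that) auto
  qed
  have "ennreal (inner (fracA S a (fracA S b x)) x)
      = (\<integral>\<^sup>+ s. ennreal (gamma_kernel a s * inner (S s (fracA S b x)) x) * indicator {0<..} s \<partial>lborel)"
  proof (rule sym, rule nn_integral_has_integral_lebesgue')
    show "((\<lambda>s. gamma_kernel a s * inner (S s (fracA S b x)) x) has_integral inner (fracA S a (fracA S b x)) x) {0<..}"
      using integrable_inner_fracA[OF a] by (simp add: inner_fracA[OF a] integrable_integral)
    show "0 \<le> gamma_kernel a s * inner (S s (fracA S b x)) x" if "s \<in> {0<..}" for s
      using that nonneg[OF b, of s] gamma_kernel_nonneg[OF a] by (simp add: S_sym)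
  qed
  also have "\<dots> = (\<integral>\<^sup>+ s. \<integral>\<^sup>+ t. ennreal (k a s * (k b t * \<phi> (s + t))) \<partial>lborel \<partial>lborel)"
  proof (rule nn_integral_cong)
    fix s :: real
    show "ennreal (gamma_kernel a s * inner (S s (fracA S b x)) x) * indicator {0<..} s
        = (\<integral>\<^sup>+ t. ennreal (k a s * (k b t * \<phi> (s + t))) \<partial>lborel)"
    proof (cases "s > 0")
      case True
      have "(\<integral>\<^sup>+ t. ennreal (k a s * (k b t * \<phi> (s + t))) \<partial>lborel)
          = (\<integral>\<^sup>+ t. ennreal (k a s) * ennreal (k b t * \<phi> (s + t)) \<partial>lborel)"
        by (intro nn_integral_cong) (simp add: ennreal_mult k_nonneg a b \<phi>_nonneg)
      also have "\<dots> = ennreal (k a s) * ennreal (inner (fracA S b x) (S s x))"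
        using True by (subst nn_integral_cmult) (auto simp: frac[OF b])
      also have "\<dots> = ennreal (gamma_kernel a s * inner (S s (fracA S b x)) x) * indicator {0<..} s"
        using True nonneg[OF b, of s] gamma_kernel_nonneg[OF a] by (simp add: k_def ennreal_mult S_sym)
      finally show ?thesis by simp
    qed (simp add: k_def)
  qed
  also have "\<dots> = (\<integral>\<^sup>+ s. \<integral>\<^sup>+ r. ennreal (k a s * (k b (r - s) * \<phi> r)) \<partial>lborel \<partial>lborel)"
  proof (rule nn_integral_cong)
    fix s :: real
    show "(\<integral>\<^sup>+ t. ennreal (k a s * (k b t * \<phi> (s + t))) \<partial>lborel)
        = (\<integral>\<^sup>+ r. ennreal (k a s * (k b (r - s) * \<phi> r)) \<partial>lborel)"
      by (subst nn_integral_real_affine[where c = 1 and t = "- s"]) auto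
  qed
  also have "\<dots> = (\<integral>\<^sup>+ r. \<integral>\<^sup>+ s. ennreal (k a s * (k b (r - s) * \<phi> r)) \<partial>lborel \<partial>lborel)"
    by (rule lborel_pair.Fubini') measurable
  also have "\<dots> = (\<integral>\<^sup>+ r. ennreal (k (a + b) r * \<phi> (0 + r)) \<partial>lborel)"
  proof (rule nn_integral_cong)
    fix r :: real
    have "(\<integral>\<^sup>+ s. ennreal (k a s * (k b (r - s) * \<phi> r)) \<partial>lborel)
        = (\<integral>\<^sup>+ s. ennreal (k a s * k b (r - s)) * ennreal (\<phi> r) \<partial>lborel)"
      by (intro nn_integral_cong) (simp add: ennreal_mult[symmetric] k_nonneg a b \<phi>_nonneg mult.assoc)
    also have "\<dots> = (\<integral>\<^sup>+ s. ennreal (k a s * k b (r - s)) \<partial>lborel) * ennreal (\<phi> r)"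
      by (rule nn_integral_multc) measurable
    also have "(\<integral>\<^sup>+ s. ennreal (k a s * k b (r - s)) \<partial>lborel) = ennreal (k (a + b) r)"
    proof (cases "r > 0")
      case True
      then show ?thesis using nn_integral_powr_convolution[OF a b True] by (simp add: k_def)
    next
      case False
      then have "ennreal (k a s * k b (r - s)) = 0" for s by (auto simp: k_def indicator_def)
      moreover have "k (a + b) r = 0" using False by (simp add: k_def)
      ultimately show ?thesis by (simp only: nn_integral_const) simp
    qed
    finally show "(\<integral>\<^sup>+ s. ennreal (k a s * (k b (r - s) * \<phi> r)) \<partial>lborel) = ennreal (k (a + b) r * \<phi> (0 + r))"
      using a b by (simp add: ennreal_mult k_nonneg \<phi>_nonneg)
  qed
  also have "\<dots> = ennreal (inner (fracA S (a + b) x) x)"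
    using frac[of "a + b" 0] a b by simp
  finally have "ennreal (inner (fracA S a (fracA S b x)) x) = ennreal (inner (fracA S (a + b) x) x)" .
  moreover have "inner (fracA S (a + b) x) x \<ge> 0" using nonneg[of "a + b" 0] a b by simp
  moreover have "inner (fracA S a (fracA S b x)) x \<ge> 0"
    unfolding inner_fracA[OF a]
    by (intro integral_nonneg integrable_inner_fracA a)
       (use nonneg[OF b] gamma_kernel_nonneg[OF a] in \<open>auto simp: S_sym\<close>)
  ultimately show ?thesis by simp
qed

text \<open>Once the factors commute, the difference of the two sides is symmetric with vanishing
  quadratic form, hence zero.\<close>

lemma fracA_fracA:
  assumes "a \<ge> 0" "b \<ge> 0"
  shows "fracA S a (fracA S b x) = fracA S (a + b) x"
proof (cases "a = 0 \<or> b = 0")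
  case False
  then have ab: "a > 0" "b > 0" using assms by auto
  have comm: "fracA S a (fracA S b x) = fracA S b (fracA S a x)" for x
  proof (rule eq_by_inner)
    fix z
    have "integral {0<..} (\<lambda>t. gamma_kernel a t * inner (S t (fracA S b x)) z)
        = integral {0<..} (\<lambda>t. gamma_kernel a t * inner (S t x) (fracA S b z))"
      using assms by (intro Henstock_Kurzweil_Integration.integral_cong)
         (auto simp: fracA_S[symmetric] fracA_inner_sym)
    then show "inner (fracA S a (fracA S b x)) z = inner (fracA S b (fracA S a x)) z"
      using ab fracA_inner_sym[of b "fracA S a x" z]
      by (simp add: inner_fracA[OF ab(1), symmetric])
  qed
  let ?A = "\<lambda>x. fracA S a (fracA S b x) - fracA S (a + b) x"
  have "norm (?A x) \<le> 0 * norm x"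
  proof (rule norm_le_of_symmetric_form_bound[where A = ?A])
    show "linear ?A"
      by (rule linear_compose_sub) (use assms linear_compose[OF linear_fracA linear_fracA] linear_fracA in \<open>auto simp: o_def\<close>)
    show "inner (?A x) y = inner x (?A y)" for x y
      using assms by (simp add: inner_diff_left inner_diff_right fracA_inner_sym comm)
    show "\<bar>inner (?A x) x\<bar> \<le> 0 * (norm x)\<^sup>2" for x
      by (simp add: inner_diff_left inner_fracA_fracA[OF ab])
  qed
  then show ?thesis by simp
qed auto

text \<open>\<open>S t (L x)\<close> is the time derivative of \<open>S t x\<close>, so its integral
  over \<open>[0, k]\<close> is \<open>S k x - x\<close>, and \<open>S k x\<close> decays; dominated
  convergence, after testing with \<open>y\<close>, gives the improper integral.\<close>

lemma fracA_1_L: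
  assumes x: "x \<in> D"
  shows "fracA S 1 (L x) = - x"
proof (rule eq_by_inner)
  fix y
  define f where "f t = inner (S t (L x)) y" for t
  have f_int: "f integrable_on {0<..}"
  proof (rule integrable_eq[OF integrable_inner_fracA[of 1 "L x" y]])
    show "gamma_kernel 1 t * inner (S t (L x)) y = f t" if "t \<in> {0<..}" for t
      using that by (simp add: gamma_kernel_def f_def)
  qed simp
  have f_eq: "inner (fracA S 1 (L x)) y = integral {0<..} f"
    unfolding inner_fracA[OF zero_less_one]
    by (rule Henstock_Kurzweil_Integration.integral_cong) (simp add: gamma_kernel_def f_def)
  define g where "g k t = (if t \<in> {0..real k} then f t else 0)" for k :: nat and t
  have g_int: "(g k has_integral inner (S (real k) x - x) y) {0<..}" for k
  proof -
    have "(f has_integral inner (S (real k) x - x) y) {0..real k}"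
      unfolding f_def
      using has_integral_linear[OF S_integral[OF x, of "real k"] bounded_linear_inner_left[of y]]
      by (simp add: o_def)
    then have "(g k has_integral inner (S (real k) x - x) y) UNIV"
      unfolding g_def by (simp only: has_integral_restrict_UNIV)
    then have "((\<lambda>t. if t \<in> {0<..} then g k t else 0) has_integral inner (S (real k) x - x) y) UNIV"
      by (rule has_integral_spike[OF negligible_sing[of 0], rotated]) (auto simp: g_def)
    then show ?thesis by (simp only: has_integral_restrict_UNIV)
  qed
  have "(\<lambda>k. integral {0<..} (g k)) \<longlonglongrightarrow> integral {0<..} f"
  proof (rule dominated_convergence)
    show "g k integrable_on {0<..}" for k using g_int by blast
    show "(\<lambda>t. t powr (1 - 1) * exp (- rate * t) * (norm (L x) * norm y)) integrable_on {0<..}"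
      by (intro integrable_on_mult_left integrable_powr_exp rate) simp
    show "norm (g k t) \<le> t powr (1 - 1) * exp (- rate * t) * (norm (L x) * norm y)"
      if "t \<in> {0<..}" for k t
    proof -
      have "norm (g k t) \<le> norm (S t (L x)) * norm y"
        using Cauchy_Schwarz_ineq2[of "S t (L x)" y] by (auto simp: g_def f_def)
      also have "\<dots> \<le> exp (- rate * t) * norm (L x) * norm y"
        using that by (intro mult_right_mono norm_S) auto
      finally show ?thesis using that by (simp add: mult_ac)
    qed
    show "(\<lambda>k. g k t) \<longlonglongrightarrow> f t" if "t \<in> {0<..}" for t
    proof (rule tendsto_eventually)
      show "\<forall>\<^sub>F k in sequentially. g k t = f t"
        using eventually_ge_at_top[of "nat \<lceil>t\<rceil>"]
        by eventually_elim (use that in \<open>auto simp: g_def nat_ceiling_le_eq\<close>)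
    qed
  qed
  moreover have "integral {0<..} (g k) = inner (S (real k) x - x) y" for k
    using g_int by blast
  ultimately have lim: "(\<lambda>k. inner (S (real k) x - x) y) \<longlonglongrightarrow> inner (fracA S 1 (L x)) y"
    by (simp add: f_eq)
  have "(\<lambda>k. S (real k) x) \<longlonglongrightarrow> 0"
  proof (rule Lim_null_comparison)
    show "\<forall>\<^sub>F k in sequentially. norm (S (real k) x) \<le> exp (- rate * real k) * norm x"
      using norm_S by (intro always_eventually allI) simp
    have "(\<lambda>k. exp (- rate) ^ k * norm x) \<longlonglongrightarrow> 0 * norm x"
      using rate(1) by (intro tendsto_intros LIMSEQ_realpow_zero) auto
    then show "(\<lambda>k. exp (- rate * real k) * norm x) \<longlonglongrightarrow> 0"
      by (simp add: exp_of_nat_mult[symmetric] mult.commute)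
  qed
  then have "(\<lambda>k. inner (S (real k) x - x) y) \<longlonglongrightarrow> inner (0 - x) y"
    by (intro tendsto_intros)
  with lim show "inner (fracA S 1 (L x)) y = inner (- x) y"
    using LIMSEQ_unique by force
qed

text \<open>Symmetry and the left inverse show that \<open>fracA S 1 x\<close> satisfies the adjoint
  identity with \<open>- x\<close>; selfadjointness puts it into \<open>D\<close>, so
  \<open>fracA S 1\<close> is a two-sided inverse of \<open>-L\<close>.\<close>

lemma fracA_1: "fracA S 1 x \<in> D" "L (fracA S 1 x) = - x"
proof -
  have "fracA S 1 x \<in> D \<and> L (fracA S 1 x) = - x"
  proof (rule L_adjointI)
    fix y assume "y \<in> D"
    then show "inner (L y) (fracA S 1 x) = inner y (- x)"
      by (simp add: fracA_inner_sym[of 1 "L y" x, symmetric] fracA_1_L)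
  qed
  then show "fracA S 1 x \<in> D" "L (fracA S 1 x) = - x" by auto
qed

lemma Hsp_1: "Hsp S 1 = D"
proof
  show "D \<subseteq> Hsp S 1"
  proof
    fix x assume "x \<in> D"
    then have "x = fracA S 1 (- L x)" by (simp add: fracA_minus fracA_1_L)
    then show "x \<in> Hsp S 1" unfolding Hsp_def by blast
  qed
qed (auto simp: Hsp_def fracA_1)

section \<open>Norms, pairings and smoothing estimates on the scale\<close>

lemma nrm_fracA [simp]: "a \<ge> 0 \<Longrightarrow> nrm S a (fracA S a y) = norm y"
  by (simp add: nrm_def fracA_inject)

lemma dec_enc [simp]: "dec S (enc S v) = v"
  by (simp add: dec_def enc_def fracA_inject)

lemma dec_D: "w \<in> D \<Longrightarrow> dec S w = - L w"
  using dec_enc[of "- L w"] by (simp add: enc_def fracA_minus fracA_1_L)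

lemma inner_le_fracA_1:
  assumes "h \<in> D"
  shows "\<bar>inner x h\<bar> \<le> norm (fracA S 1 x) * norm (L h)"
proof -
  have "inner x h = inner (fracA S 1 x) (- L h)"
    using assms by (simp add: fracA_inner_sym[of 1 x "L h"] fracA_1_L)
  then show ?thesis using Cauchy_Schwarz_ineq2[of "fracA S 1 x" "L h"] by simp
qed

text \<open>The embedding of \<open>H_{-a}\<close> into \<open>H_{-1}\<close>; through it bounds in
  \<open>H_{-2\<gamma>}\<close> can be tested against \<open>h\<close> in \<open>D\<close>.\<close>

lemma fracA_1_bound:
  assumes "0 \<le> a" "a \<le> 1"
  obtains M where "M > 0" "\<And>x. norm (fracA S 1 x) \<le> M * norm (fracA S a x)"
proof -
  obtain M where "M > 0" "\<And>x. norm (fracA S (1 - a) x) \<le> M * norm x"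
    using fracA_bound[of "1 - a"] assms by auto
  then show thesis
    using that[of M] fracA_fracA[of "1 - a" a] assms by (metis add.commute diff_add_cancel diff_ge_0_iff_ge)
qed

lemma norm_le_of_inner_le_D:
  assumes "\<And>y. y \<in> D \<Longrightarrow> inner x y \<le> C * norm y" "0 \<le> C"
  shows "norm x \<le> C"
proof (rule norm_le_of_inner_le[OF _ assms(2)])
  show "inner x y \<le> C * norm y" for y
    by (rule D_induct[where P = "\<lambda>y. inner x y \<le> C * norm y"])
       (auto intro!: closed_Collect_le continuous_intros assms)
qed

text \<open>The bounds \<open>2\<close> and \<open>2 \<tau> / t\<close> interpolate to
  \<open>2 (\<tau> / t)^q\<close>, and the singularity \<open>t^(-q)\<close> is integrated against
  \<open>t^(a-1)\<close>. At \<open>q = a\<close> this integral diverges at 0, so the order stays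
  strictly below \<open>a\<close>.\<close>

lemma norm_S_minus_id_fracA:
  assumes "0 \<le> q" "q \<le> 1" "q < a"
  obtains C where "C \<ge> 0" "\<And>x \<tau>. \<tau> \<ge> 0 \<Longrightarrow> norm (fracA S a (S \<tau> x - x)) \<le> C * \<tau> powr q * norm x"
proof -
  obtain C where C: "C \<ge> 0" "\<And>x y B. (\<And>t. t > 0 \<Longrightarrow> inner (S t x) y \<le> B * (t powr (- q) * exp (- (rate / 2) * t))) \<Longrightarrow>
    inner (fracA S a x) y \<le> C * B"
    using inner_fracA_bound[of q a "rate / 2"] assms rate(1) by auto
  have "norm (fracA S a (S \<tau> x - x)) \<le> 2 * C * \<tau> powr q * norm x" if \<tau>: "\<tau> \<ge> 0" for x \<tau>
  proof (rule norm_le_of_inner_le)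
    fix y
    have "inner (fracA S a (S \<tau> x - x)) y \<le> C * (2 * \<tau> powr q * norm x * norm y)"
    proof (rule C(2))
      fix t :: real assume t: "t > 0"
      have m: "min 2 (2 * \<tau> / t) \<le> 2 * (\<tau> / t) powr q"
      proof (cases "\<tau> \<le> t")
        case True
        have "\<tau> / t = (\<tau> / t) powr 1" using \<tau> t by simp
        also have "\<dots> \<le> (\<tau> / t) powr q"
          using True \<tau> t assms by (intro powr_mono') auto
        finally show ?thesis by simp
      next
        case False
        then have "1 \<le> (\<tau> / t) powr q" using assms t by (intro ge_one_powr_ge_zero) auto
        then show ?thesis by simp
      qed
      have "inner (S t (S \<tau> x - x)) y \<le> norm (S (t + \<tau>) x - S t x) * norm y"
        using norm_cauchy_schwarz[of "S t (S \<tau> x - x)" y] t \<tau> by (simp add: S_diff S_S)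
      also have "\<dots> \<le> exp (- (rate / 2) * t) * min 2 (2 * \<tau> / t) * norm x * norm y"
        using t \<tau> by (intro mult_right_mono norm_S_increment) auto
      also have "\<dots> \<le> exp (- (rate / 2) * t) * (2 * (\<tau> / t) powr q) * norm x * norm y"
        by (intro mult_right_mono mult_left_mono m) auto
      also have "(\<tau> / t) powr q = \<tau> powr q * t powr (- q)"
        using t \<tau> by (simp add: powr_divide powr_minus_divide)
      finally show "inner (S t (S \<tau> x - x)) y \<le> 2 * \<tau> powr q * norm x * norm y * (t powr (- q) * exp (- (rate / 2) * t))"
        by (simp add: mult_ac)
    qed
    then show "inner (fracA S a (S \<tau> x - x)) y \<le> 2 * C * \<tau> powr q * norm x * norm y"
      by (simp add: mult_ac)
  qed (use C in auto)
  then show thesis using that[of "2 * C"] C by auto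
qed

text \<open>The gain of the negative power is distributed by
  \<open>t^q \<sigma>^(1-q) \<le> t + \<sigma>\<close>: the kernel absorbs \<open>t^(-q)\<close>,
  and \<open>\<sigma>^(q-1)\<close> remains, which is integrable at 0 when \<open>q > 0\<close>.
  Testing with \<open>y\<close> in \<open>D\<close> lets \<open>L\<close> be moved to the other
  side.\<close>

lemma norm_LS_fracA:
  assumes "0 \<le> q" "q \<le> 1" "q < a"
  obtains C where "C \<ge> 0" "\<And>x \<sigma>. \<sigma> > 0 \<Longrightarrow> norm (L (S \<sigma> (fracA S a x))) \<le> C * \<sigma> powr (q - 1) * norm x"
proof -
  obtain C where C: "C \<ge> 0" "\<And>x y B. (\<And>t. t > 0 \<Longrightarrow> inner (S t x) y \<le> B * (t powr (- q) * exp (- (rate / 2) * t))) \<Longrightarrow>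
    inner (fracA S a x) y \<le> C * B"
    using inner_fracA_bound[of q a "rate / 2"] assms rate(1) by auto
  have "norm (L (S \<sigma> (fracA S a x))) \<le> 2 * C * \<sigma> powr (q - 1) * norm x" if \<sigma>: "\<sigma> > 0" for x \<sigma>
  proof (rule norm_le_of_inner_le_D)
    fix y assume y: "y \<in> D"
    have "inner (L (S \<sigma> (fracA S a x))) y = inner (fracA S a x) (S \<sigma> (L y))"
      using L_sym[OF S_in_D(1)[OF \<sigma>] y] \<sigma> by (simp add: S_sym)
    also have "\<dots> \<le> C * (2 * \<sigma> powr (q - 1) * norm x * norm y)"
    proof (rule C(2))
      fix t :: real assume t: "t > 0"
      have "inner (S t x) (S \<sigma> (L y)) = inner (L (S (t + \<sigma>) x)) y"
        using L_sym[OF S_in_D(1) y, of "t + \<sigma>" x] t \<sigma> by (simp add: S_sym S_S add.commute)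
      also have "\<dots> \<le> norm (L (S (t + \<sigma>) x)) * norm y"
        by (rule norm_cauchy_schwarz)
      also have "\<dots> \<le> 2 / (t + \<sigma>) * exp (- (rate / 2) * (t + \<sigma>)) * norm x * norm y"
        using t \<sigma> by (intro mult_right_mono norm_LS_exp) auto
      also have "\<dots> \<le> 2 * (t powr (- q) * \<sigma> powr (q - 1)) * exp (- (rate / 2) * t) * norm x * norm y"
      proof (intro mult_right_mono mult_mono)
        have "t powr q * \<sigma> powr (1 - q) \<le> (t + \<sigma>) powr q * (t + \<sigma>) powr (1 - q)"
          using t \<sigma> assms by (intro mult_mono powr_mono2) auto
        also have "\<dots> = t + \<sigma>" using t \<sigma> by (simp add: powr_add[symmetric])
        finally have "1 / (t + \<sigma>) \<le> 1 / (t powr q * \<sigma> powr (1 - q))"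
          using t \<sigma> by (intro divide_left_mono) auto
        also have "\<dots> = t powr (- q) * \<sigma> powr (q - 1)"
          using powr_minus[of \<sigma> "1 - q"] by (simp add: powr_minus field_simps)
        finally show "2 / (t + \<sigma>) \<le> 2 * (t powr (- q) * \<sigma> powr (q - 1))" by simp
        show "exp (- (rate / 2) * (t + \<sigma>)) \<le> exp (- (rate / 2) * t)"
          using rate(1) \<sigma> by (simp add: algebra_simps)
      qed auto
      finally show "inner (S t x) (S \<sigma> (L y)) \<le> 2 * \<sigma> powr (q - 1) * norm x * norm y * (t powr (- q) * exp (- (rate / 2) * t))"
        by (simp add: mult_ac)
    qed
    finally show "inner (L (S \<sigma> (fracA S a x))) y \<le> 2 * C * \<sigma> powr (q - 1) * norm x * norm y"
      by (simp add: mult_ac)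
  qed (use C in auto)
  then show thesis using that[of "2 * C"] C by auto
qed

end

section \<open>Sewing along partitions\<close>

lemma norm_triangle_le_diff:
  fixes a b :: "'a::real_normed_vector"
  shows "norm a \<le> x \<Longrightarrow> norm b \<le> y \<Longrightarrow> norm (a - b) \<le> x + y"
  using norm_triangle_ineq4[of a b] by linarith

section \<open>Combinatorics of partitions\<close>

lemma psum_single [simp]: "psum [a] g = 0"
  by (simp add: psum_def)

lemma is_partition_single [simp]: "is_partition b b [b]"
  by (simp add: is_partition_def)

lemma mesh_lt_single [simp]: "mesh_lt [b] \<eta>"
  by (simp add: mesh_lt_def)

lemma is_partition_Cons: "is_partition c b p \<Longrightarrow> a < c \<Longrightarrow> is_partition a b (a # p)"
  by (cases p) (auto simp: is_partition_def)

lemma psum_Cons: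
  assumes "is_partition c b p"
  shows "psum (a # p) g = g c a + psum p g"
  using assms
  by (cases p) (auto simp: is_partition_def psum_def sum.lessThan_Suc_shift simp del: sum.lessThan_Suc)

lemma mesh_lt_Cons:
  assumes "is_partition c b p"
  shows "mesh_lt (a # p) \<eta> \<longleftrightarrow> c - a < \<eta> \<and> mesh_lt p \<eta>"
  using assms by (cases p) (auto simp: is_partition_def mesh_lt_def All_less_Suc2 nth_Cons split: nat.splits)

lemma is_partition_induct [consumes 1, case_names single Cons]:
  assumes "is_partition a b p"
    and "P b [b]"
    and "\<And>a c p. a < c \<Longrightarrow> is_partition c b p \<Longrightarrow> P c p \<Longrightarrow> P a (a # p)"
  shows "P a p"
  using assms(1)
proof (induction p arbitrary: a)
  case Nil
  then show ?case by (simp add: is_partition_def)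
next
  case (Cons x p)
  show ?case
  proof (cases p)
    case Nil
    with Cons.prems have "x = a" "a = b" by (auto simp: is_partition_def)
    with Nil assms(2) show ?thesis by simp
  next
    case (Cons y q)
    then have "is_partition y b p" "a < y" "x = a"
      using Cons.prems by (auto simp: is_partition_def)
    then show ?thesis using assms(3) Cons.IH by blast
  qed
qed

lemma is_partition_le: "is_partition a b p \<Longrightarrow> a \<le> b"
  by (induction rule: is_partition_induct) auto

lemma is_partition_same: "is_partition b b p \<Longrightarrow> p = [b]"
proof -
  have "a = b \<longrightarrow> p = [b]" if "is_partition a b p" for a
    using that by (induction rule: is_partition_induct) (auto dest: is_partition_le)
  then show "is_partition b b p \<Longrightarrow> p = [b]" by blast
qed

lemma is_partition_append:
  assumes "is_partition a b p" "is_partition b c q"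
  shows "is_partition a c (p @ tl q)"
    and "psum (p @ tl q) g = psum p g + psum q g"
    and "mesh_lt p \<eta> \<Longrightarrow> mesh_lt q \<eta> \<Longrightarrow> mesh_lt (p @ tl q) \<eta>"
proof -
  have "is_partition a c (p @ tl q) \<and> psum (p @ tl q) g = psum p g + psum q g \<and>
      (mesh_lt p \<eta> \<longrightarrow> mesh_lt q \<eta> \<longrightarrow> mesh_lt (p @ tl q) \<eta>)"
    using assms(1)
  proof (induction rule: is_partition_induct)
    case single
    have "[b] @ tl q = q" using assms(2) by (cases q) (auto simp: is_partition_def)
    with assms(2) show ?case by simp
  next
    case (Cons a d p)
    then show ?case
      using is_partition_Cons[of d c "p @ tl q" a] psum_Cons[of d c "p @ tl q" a g]
        psum_Cons[of d b p a g] mesh_lt_Cons[of d b p a \<eta>] mesh_lt_Cons[of d c "p @ tl q" a \<eta>]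
      by (simp add: add.assoc)
  qed
  then show "is_partition a c (p @ tl q)" "psum (p @ tl q) g = psum p g + psum q g"
    "mesh_lt p \<eta> \<Longrightarrow> mesh_lt q \<eta> \<Longrightarrow> mesh_lt (p @ tl q) \<eta>" by auto
qed

lemma ex_fine_partition:
  assumes "a \<le> b" "\<eta> > 0"
  obtains p where "is_partition a b p" "mesh_lt p \<eta>"
proof -
  have "a \<le> b \<longrightarrow> (\<exists>p. is_partition a b p \<and> mesh_lt p \<eta>)"
    using assms(1)
  proof (induction rule: Bolzano)
    case (trans x y z)
    then show ?case using is_partition_append by blast
  next
    case (local x)
    have "\<exists>p. is_partition s t p \<and> mesh_lt p \<eta>" if "s \<le> t" "t - s < \<eta>" for s t
    proof (cases "s = t")
      case False
      with that show ?thesis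
        by (intro exI[of _ "[s, t]"]) (auto simp: is_partition_def mesh_lt_def less_Suc_eq)
    qed (auto intro: exI[of _ "[s]"])
    then show ?case using assms(2) by (intro exI[of _ \<eta>]) auto
  qed
  then show thesis using that assms(1) by blast
qed

text \<open>The step from \<open>c\<close> to \<open>d\<close> straddling \<open>m\<close> belongs
  to neither part; so with \<open>m\<close> the midpoint both parts cover at most half the length,
  and each has strictly fewer nodes.\<close>

lemma partition_split:
  assumes "is_partition a b p" "a \<le> m" "m < b"
  shows "\<exists>c d p1 p2. p = p1 @ p2 \<and> is_partition a c p1 \<and> is_partition d b p2 \<and> c \<le> m \<and> m < d \<and> c < d
    \<and> psum p g = psum p1 g + g d c + psum p2 g"
  using assms
proof (induction rule: is_partition_induct)
  case (Cons a e p)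
  show ?case
  proof (cases "e \<le> m")
    case False
    with Cons show ?thesis
      by (intro exI[of _ a] exI[of _ e] exI[of _ "[a]"] exI[of _ p]) (auto simp: psum_Cons)
  next
    case True
    then obtain c d p1 p2 where *: "p = p1 @ p2" "is_partition e c p1" "is_partition d b p2" "c \<le> m" "m < d" "c < d"
      "psum p g = psum p1 g + g d c + psum p2 g"
      using Cons by blast
    have "psum (a # p) g = psum (a # p1) g + g d c + psum p2 g"
      using psum_Cons[OF Cons(2), of a g] psum_Cons[OF *(2), of a g] *(7) by (simp add: add.assoc)
    then show ?thesis
      using * is_partition_Cons[OF *(2) Cons(1)]
      by (intro exI[of _ c] exI[of _ d] exI[of _ "a # p1"] exI[of _ p2]) auto
  qed
qed auto

section \<open>The sewing bound for partition sums\<close>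

definition germ_bound :: "real \<Rightarrow> real \<Rightarrow> real \<Rightarrow> real \<Rightarrow> (real \<Rightarrow> real \<Rightarrow> 'a::real_normed_vector) \<Rightarrow> bool" where
  "germ_bound a b \<kappa> C g \<longleftrightarrow> (\<forall>r m q. a \<le> r \<longrightarrow> r \<le> m \<longrightarrow> m \<le> q \<longrightarrow> q \<le> b \<longrightarrow>
     norm (g q r - g q m - g m r) \<le> C * (q - r) powr \<kappa>)"

lemma germ_boundD:
  "germ_bound a b \<kappa> C g \<Longrightarrow> a \<le> r \<Longrightarrow> r \<le> m \<Longrightarrow> m \<le> q \<Longrightarrow> q \<le> b \<Longrightarrow>
    norm (g q r - g q m - g m r) \<le> C * (q - r) powr \<kappa>"
  by (simp add: germ_bound_def)

lemma germ_bound_subset: "germ_bound a b \<kappa> C g \<Longrightarrow> a \<le> a' \<Longrightarrow> b' \<le> b \<Longrightarrow> germ_bound a' b' \<kappa> C g"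
  by (force simp: germ_bound_def)

text \<open>The solution of \<open>K = 2 * 2^(-\<kappa>) * K + 2\<close>: two halves, each scaled by
  \<open>2^(-\<kappa>)\<close>, and two defects per bisection.\<close>

definition sewing_const :: "real \<Rightarrow> real" where
  "sewing_const \<kappa> = 2 / (1 - 2 powr (1 - \<kappa>))"

lemma sewing_const:
  assumes "\<kappa> > 1"
  shows "sewing_const \<kappa> > 0" "2 * (sewing_const \<kappa> * (1 / 2) powr \<kappa>) + 2 = sewing_const \<kappa>"
proof -
  have "2 powr (1 - \<kappa>) < (1::real)"
    using assms powr_less_mono[of "1 - \<kappa>" 0 2] by simp
  then have *: "1 - 2 powr (1 - \<kappa>) > (0::real)" by simp
  then show "sewing_const \<kappa> > 0" by (simp add: sewing_const_def)
  have "2 * (1 / 2) powr \<kappa> = 2 powr (1 - \<kappa>)"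
    by (simp add: powr_diff powr_divide)
  then show "2 * (sewing_const \<kappa> * (1 / 2) powr \<kappa>) + 2 = sewing_const \<kappa>"
  proof -
    let ?c = "2 powr (1 - \<kappa>) :: real"
    assume "2 * (1 / 2) powr \<kappa> = ?c"
    then have "2 * (sewing_const \<kappa> * (1 / 2) powr \<kappa>) + 2 = 2 * ?c / (1 - ?c) + 2"
      by (simp add: sewing_const_def)
    also have "\<dots> = sewing_const \<kappa>"
      using * assms by (simp add: sewing_const_def divide_simps)
    finally show ?thesis .
  qed
qed

text \<open>Bisecting at the midpoint leaves two sub-partitions of at most half the length, and the
  factor $2\cdot 2^{-\kappa} < 1$ makes the recursion summable.\<close>

lemma psum_minus_germ:
  assumes part: "is_partition a b p" and germ: "germ_bound a b \<kappa> C g" and \<kappa>: "\<kappa> > 1" and C: "C \<ge> 0"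
  shows "norm (psum p g - g b a) \<le> sewing_const \<kappa> * C * (b - a) powr \<kappa>"
  using part germ
proof (induction "length p" arbitrary: a b p rule: less_induct)
  case less
  let ?K = "sewing_const \<kappa>"
  show ?case
  proof (cases "a = b")
    case True
    have "p = [b]"
      using less.prems(1) True is_partition_same by blast
    \<comment> \<open>At coinciding times the defect is \<open>- g b b\<close> and its bound is 0,
      so a germ vanishes on the diagonal.\<close>
    moreover have "norm (g b b - g b b - g b b) \<le> C * (b - b) powr \<kappa>"
      using True by (intro germ_boundD[OF less.prems(2)]) auto
    ultimately show ?thesis using True by simp
  next
    case False
    then have ab: "a < b" using is_partition_le[OF less.prems(1)] by simp
    define m where "m = (a + b) / 2"
    obtain c d p1 p2 where *: "p = p1 @ p2" "is_partition a c p1" "is_partition d b p2" "c \<le> m" "m < d" "c < d"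
      "psum p g = psum p1 g + g d c + psum p2 g"
      using partition_split[OF less.prems(1), of m g] ab by (auto simp: m_def)
    have le: "a \<le> c" "d \<le> b" using *(2,3) is_partition_le by auto
    have len: "length p1 < length p" "length p2 < length p"
      using *(1-3) by (auto simp: is_partition_def)
    have half: "(c - a) powr \<kappa> \<le> (1 / 2) powr \<kappa> * (b - a) powr \<kappa>"
      "(b - d) powr \<kappa> \<le> (1 / 2) powr \<kappa> * (b - a) powr \<kappa>"
      using le * ab \<kappa> by (auto simp: m_def powr_mult[symmetric] intro!: powr_mono2)
    have KC: "?K * C \<ge> 0" using sewing_const[OF \<kappa>] C by simp
    have 1: "norm (psum p1 g - g c a) \<le> ?K * C * ((1 / 2) powr \<kappa> * (b - a) powr \<kappa>)"
      using less.hyps[OF len(1) *(2) germ_bound_subset[OF less.prems(2)]] le *(6) mult_left_mono[OF half(1) KC]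
      by linarith
    have 2: "norm (psum p2 g - g b d) \<le> ?K * C * ((1 / 2) powr \<kappa> * (b - a) powr \<kappa>)"
      using less.hyps[OF len(2) *(3) germ_bound_subset[OF less.prems(2)]] le *(6) mult_left_mono[OF half(2) KC]
      by linarith
    have 3: "norm (g b a - g b d - g d a) \<le> C * (b - a) powr \<kappa>"
      using le * by (intro germ_boundD[OF less.prems(2)]) auto
    have 4: "norm (g d a - g d c - g c a) \<le> C * (b - a) powr \<kappa>"
    proof -
      have "norm (g d a - g d c - g c a) \<le> C * (d - a) powr \<kappa>"
        using le * by (intro germ_boundD[OF less.prems(2)]) auto
      also have "\<dots> \<le> C * (b - a) powr \<kappa>"
        using le * \<kappa> C by (intro mult_left_mono powr_mono2) auto
      finally show ?thesis .
    qed
    \<comment> \<open>Splitting \<open>g b a\<close> at \<open>d\<close> and then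
      \<open>g d a\<close> at \<open>c\<close> costs two defects; they are the summand 2 in the
      equation for \<open>sewing_const\<close>.\<close>
    have "psum p g - g b a = (psum p1 g - g c a) + (psum p2 g - g b d)
        - (g b a - g b d - g d a) - (g d a - g d c - g c a)"
      using *(7) by simp
    then have "norm (psum p g - g b a) \<le> norm (psum p1 g - g c a) + norm (psum p2 g - g b d)
        + norm (g b a - g b d - g d a) + norm (g d a - g d c - g c a)"
      by (simp only:) (intro norm_triangle_le_diff add_mono norm_triangle_ineq order_refl)
    also have "\<dots> \<le> (2 * (?K * (1 / 2) powr \<kappa>) + 2) * C * (b - a) powr \<kappa>"
      using 1 2 3 4 by (simp add: algebra_simps)
    finally show ?thesis by (simp only: sewing_const(2)[OF \<kappa>])
  qed
qed

section \<open>Limits of partition sums\<close>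

lemma psum_cong:
  assumes "is_partition a b p" "\<And>r q. a \<le> r \<Longrightarrow> r < q \<Longrightarrow> q \<le> b \<Longrightarrow> f q r = g q r"
  shows "psum p f = psum p g"
  using assms
proof (induction rule: is_partition_induct)
  case (Cons a c p)
  have "c \<le> b" using Cons(2) is_partition_le by blast
  then have "f c a = g c a" using Cons by auto
  moreover have "psum p f = psum p g" using Cons by auto
  ultimately show ?case using Cons by (simp add: psum_Cons)
qed simp

lemma psum_linear: "linear \<Phi> \<Longrightarrow> \<Phi> (psum p g) = psum p (\<lambda>q r. \<Phi> (g q r))"
  by (simp add: psum_def linear_sum)

lemma rs_limit_linear: "linear \<Phi> \<Longrightarrow> rs_limit t g \<Phi> l \<longleftrightarrow> rs_limit t (\<lambda>q r. \<Phi> (g q r)) id l"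
  by (simp add: rs_limit_def psum_linear)

lemma rs_limit_cong:
  assumes "\<And>r q. 0 \<le> r \<Longrightarrow> r < q \<Longrightarrow> q \<le> t \<Longrightarrow> f q r = g q r"
  shows "rs_limit t f id l \<longleftrightarrow> rs_limit t g id l"
  using psum_cong[of 0 t _ f g] assms unfolding rs_limit_def by (metis (no_types, lifting))

lemma rs_limit_bounded_linear:
  fixes g :: "real \<Rightarrow> real \<Rightarrow> 'a::real_normed_vector"
  assumes lim: "rs_limit t g id l" and B: "bounded_linear B"
  shows "rs_limit t (\<lambda>q r. B (g q r)) id (B l)"
  unfolding rs_limit_def
proof (intro allI impI)
  fix e :: real assume "e > 0"
  obtain K where K: "K > 0" "\<And>x. norm (B x) \<le> norm x * K"
    using bounded_linear.pos_bounded[OF B] by blast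
  obtain \<eta> where \<eta>: "\<eta> > 0" "\<And>p. is_partition 0 t p \<Longrightarrow> mesh_lt p \<eta> \<Longrightarrow> dist (psum p g) l < e / K"
    using lim \<open>e > 0\<close> K(1) unfolding rs_limit_def by (metis divide_pos_pos id_apply)
  have "dist (id (psum p (\<lambda>q r. B (g q r)))) (B l) < e" if "is_partition 0 t p" "mesh_lt p \<eta>" for p
  proof -
    have "psum p (\<lambda>q r. B (g q r)) - B l = B (psum p g - l)"
      using B by (simp add: psum_linear[OF bounded_linear.linear[OF B]] bounded_linear.linear linear_diff)
    also have "norm \<dots> \<le> dist (psum p g) l * K"
      using K(2) by (simp add: dist_norm)
    also have "\<dots> < e" using \<eta>(2)[OF that] K(1) by (simp add: field_simps)
    finally show ?thesis by (simp add: dist_norm)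
  qed
  then show "\<exists>\<eta>>0. \<forall>p. is_partition 0 t p \<and> mesh_lt p \<eta> \<longrightarrow> dist (id (psum p (\<lambda>q r. B (g q r)))) (B l) < e"
    using \<eta>(1) by blast
qed

text \<open>Both limits are given, so a fine partition of \<open>[0, a]\<close> and its extension by
  one of \<open>[a, b]\<close> approximate them simultaneously; the difference is a partition sum
  over \<open>[a, b]\<close>, to which the sewing bound applies.\<close>

lemma rs_limit_increment:
  fixes g :: "real \<Rightarrow> real \<Rightarrow> 'a::real_normed_vector"
  assumes la: "rs_limit a g id la" and lb: "rs_limit b g id lb" and ab: "0 \<le> a" "a \<le> b"
    and germ: "germ_bound a b \<kappa> C g" and \<kappa>: "\<kappa> > 1" and C: "C \<ge> 0"
  shows "norm (lb - la - g b a) \<le> sewing_const \<kappa> * C * (b - a) powr \<kappa>"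
proof (rule field_le_epsilon)
  fix e :: real assume "e > 0"
  then obtain \<eta>1 \<eta>2 where \<eta>: "\<eta>1 > 0" "\<eta>2 > 0"
    "\<And>p. is_partition 0 a p \<Longrightarrow> mesh_lt p \<eta>1 \<Longrightarrow> dist (psum p g) la < e / 2"
    "\<And>p. is_partition 0 b p \<Longrightarrow> mesh_lt p \<eta>2 \<Longrightarrow> dist (psum p g) lb < e / 2"
    using la lb unfolding rs_limit_def by (metis half_gt_zero id_apply)
  define \<eta> where "\<eta> = min \<eta>1 \<eta>2"
  have mono: "mesh_lt p \<eta>1 \<and> mesh_lt p \<eta>2" if "mesh_lt p \<eta>" for p
    using that by (auto simp: mesh_lt_def \<eta>_def)
  obtain p1 where p1: "is_partition 0 a p1" "mesh_lt p1 \<eta>"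
    using ex_fine_partition[of 0 a \<eta>] ab \<eta> by (auto simp: \<eta>_def)
  obtain p2 where p2: "is_partition a b p2" "mesh_lt p2 \<eta>"
    using ex_fine_partition[of a b \<eta>] ab \<eta> by (auto simp: \<eta>_def)
  note join = is_partition_append[OF p1(1) p2(1)]
  have 1: "dist (psum p1 g) la < e / 2" using p1 mono \<eta>(3) by blast
  have 2: "dist (psum p1 g + psum p2 g) lb < e / 2"
    using \<eta>(4)[OF join(1)] mono[OF join(3)[OF p1(2) p2(2)]] by (simp add: join(2))
  have 3: "norm (psum p2 g - g b a) \<le> sewing_const \<kappa> * C * (b - a) powr \<kappa>"
    by (rule psum_minus_germ[OF p2(1) germ \<kappa> C])
  have "lb - la - g b a = (psum p2 g - g b a) - (psum p1 g + psum p2 g - lb) + (psum p1 g - la)"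
    by simp
  then have "norm (lb - la - g b a) \<le> norm (psum p2 g - g b a) + norm (psum p1 g + psum p2 g - lb) + norm (psum p1 g - la)"
    by (simp only:) (intro norm_triangle_le_diff order_trans[OF norm_triangle_ineq] add_mono order_refl)
  then show "norm (lb - la - g b a) \<le> sewing_const \<kappa> * C * (b - a) powr \<kappa> + e"
    using 1 2 3 by (simp add: dist_norm)
qed

section \<open>Additive functions close to a germ\<close>

lemma psum_close_additive:
  fixes A :: "real \<Rightarrow> 'a::real_normed_vector"
  assumes "is_partition a b p" "mesh_lt p \<eta>"
    and "\<And>r q. a \<le> r \<Longrightarrow> r < q \<Longrightarrow> q \<le> b \<Longrightarrow> q - r < \<eta> \<Longrightarrow> norm (A q - A r - g q r) \<le> e * (q - r)"
  shows "norm (A b - A a - psum p g) \<le> e * (b - a)"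
  using assms
proof (induction rule: is_partition_induct)
  case (Cons a c p)
  have "c \<le> b" using Cons(2) is_partition_le by blast
  have m: "c - a < \<eta>" "mesh_lt p \<eta>" using Cons(4) mesh_lt_Cons[OF Cons(2)] by auto
  have 1: "norm (A c - A a - g c a) \<le> e * (c - a)"
    using Cons(1) m \<open>c \<le> b\<close> by (intro Cons(5)) auto
  have 2: "norm (A b - A c - psum p g) \<le> e * (b - c)"
    using Cons(1) m by (intro Cons(3) Cons(5)) auto
  have eq: "A b - A a - psum (a # p) g = (A c - A a - g c a) + (A b - A c - psum p g)"
    unfolding psum_Cons[OF Cons(2), of a g] by simp
  have "norm (A b - A a - psum (a # p) g) \<le> e * (c - a) + e * (b - c)"
    unfolding eq by (rule norm_triangle_mono[OF 1 2])
  then show ?case by (simp add: algebra_simps)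
qed simp

text \<open>The error is \<open>o(q - r)\<close>, uniformly, rather than a power: in the passage
  from mild to weak, \<open>S_\<tau> L h - L h\<close> has no rate.\<close>

definition additive_approx :: "real \<Rightarrow> real \<Rightarrow> (real \<Rightarrow> 'a::real_normed_vector) \<Rightarrow> (real \<Rightarrow> real \<Rightarrow> 'a) \<Rightarrow> bool" where
  "additive_approx a b A g \<longleftrightarrow> (\<forall>e>0. \<exists>\<eta>>0. \<forall>r q. a \<le> r \<longrightarrow> r < q \<longrightarrow> q \<le> b \<longrightarrow> q - r < \<eta> \<longrightarrow>
     norm (A q - A r - g q r) \<le> e * (q - r))"

text \<open>The local errors telescope to at most \<open>e' * t\<close>, so existence and value of
  the limit come together.\<close>

lemma rs_limit_of_additive_approx:
  assumes "0 \<le> t" "additive_approx 0 t A g"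
  shows "rs_limit t g id (A t - A 0)"
  unfolding rs_limit_def
proof (intro allI impI)
  fix e :: real assume "e > 0"
  define e' where "e' = e / (2 * (t + 1))"
  have e': "e' > 0" "e' * t < e"
    using \<open>e > 0\<close> assms(1) by (auto simp: e'_def field_simps) (smt (verit, best) mult_nonneg_nonneg)
  obtain \<eta> where \<eta>: "\<eta> > 0" "\<And>r q. 0 \<le> r \<Longrightarrow> r < q \<Longrightarrow> q \<le> t \<Longrightarrow> q - r < \<eta> \<Longrightarrow>
     norm (A q - A r - g q r) \<le> e' * (q - r)"
    using assms(2) e'(1) unfolding additive_approx_def by blast
  then have "dist (id (psum p g)) (A t - A 0) < e" if "is_partition 0 t p" "mesh_lt p \<eta>" for p
    using psum_close_additive[OF that, of A g e'] e'(2) by (simp add: dist_norm norm_minus_commute)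
  then show "\<exists>\<eta>>0. \<forall>p. is_partition 0 t p \<and> mesh_lt p \<eta> \<longrightarrow> dist (id (psum p g)) (A t - A 0) < e"
    using \<eta>(1) by blast
qed

text \<open>Uniqueness in the sewing lemma: refining the partition removes the
  \<open>o(q - r)\<close> error, so the final bound depends only on the constant of the germ and not
  on how the approximation was obtained.\<close>

lemma additive_approx_germ:
  assumes approx: "additive_approx a b A g" and germ: "germ_bound a b \<kappa> C g"
    and \<kappa>: "\<kappa> > 1" and C: "C \<ge> 0" and "a \<le> b"
  shows "norm (A b - A a - g b a) \<le> sewing_const \<kappa> * C * (b - a) powr \<kappa>"
proof (rule field_le_epsilon)
  fix e :: real assume "e > 0"
  define e' where "e' = e / (b - a + 1)"
  have e': "e' > 0" "e' * (b - a) \<le> e"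
    using \<open>e > 0\<close> \<open>a \<le> b\<close> by (auto simp: e'_def field_simps)
  obtain \<eta> where \<eta>: "\<eta> > 0" "\<And>r q. a \<le> r \<Longrightarrow> r < q \<Longrightarrow> q \<le> b \<Longrightarrow> q - r < \<eta> \<Longrightarrow>
     norm (A q - A r - g q r) \<le> e' * (q - r)"
    using approx e'(1) unfolding additive_approx_def by blast
  obtain p where p: "is_partition a b p" "mesh_lt p \<eta>"
    using ex_fine_partition[OF \<open>a \<le> b\<close> \<eta>(1)] by blast
  have "norm (A b - A a - psum p g) \<le> e' * (b - a)"
    by (rule psum_close_additive[OF p \<eta>(2)])
  moreover have "norm (psum p g - g b a) \<le> sewing_const \<kappa> * C * (b - a) powr \<kappa>"
    by (rule psum_minus_germ[OF p(1) germ \<kappa> C])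
  moreover have "norm (A b - A a - g b a) \<le> norm (A b - A a - psum p g) + norm (psum p g - g b a)"
    using norm_triangle_ineq[of "A b - A a - psum p g" "psum p g - g b a"] by simp
  ultimately show "norm (A b - A a - g b a) \<le> sewing_const \<kappa> * C * (b - a) powr \<kappa> + e"
    using e'(2) by linarith
qed

lemma additive_approx_of_powr:
  assumes "\<kappa> > 1" "K \<ge> 0"
    and "\<And>r q. a \<le> r \<Longrightarrow> r < q \<Longrightarrow> q \<le> b \<Longrightarrow> norm (A q - A r - g q r) \<le> K * (q - r) powr \<kappa>"
  shows "additive_approx a b A g"
  unfolding additive_approx_def
proof (intro allI impI)
  fix e :: real assume "e > 0"
  define \<eta> where "\<eta> = (e / (K + 1)) powr (1 / (\<kappa> - 1))"
  have "norm (A q - A r - g q r) \<le> e * (q - r)" if rq: "a \<le> r" "r < q" "q \<le> b" "q - r < \<eta>" for r q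
  proof -
    have "(q - r) powr (\<kappa> - 1) \<le> \<eta> powr (\<kappa> - 1)"
      using that assms by (intro powr_mono2) auto
    also have "\<dots> = e / (K + 1)"
      using assms \<open>e > 0\<close> by (simp add: \<eta>_def powr_powr)
    finally have "K * (q - r) powr (\<kappa> - 1) \<le> e"
      using assms(2) \<open>e > 0\<close> by (simp add: field_simps) (smt (verit) powr_ge_zero)
    then have "K * (q - r) powr (\<kappa> - 1) * (q - r) \<le> e * (q - r)"
      using that by (intro mult_right_mono) auto
    also have "K * (q - r) powr (\<kappa> - 1) * (q - r) = K * (q - r) powr \<kappa>"
      using powr_add[of "q - r" "\<kappa> - 1" 1] that by simp
    finally show ?thesis using assms(3)[OF rq(1-3)] by linarith
  qed
  moreover have "\<eta> > 0" using \<open>e > 0\<close> assms by (simp add: \<eta>_def)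
  ultimately show "\<exists>\<eta>>0. \<forall>r q. a \<le> r \<longrightarrow> r < q \<longrightarrow> q \<le> b \<longrightarrow> q - r < \<eta> \<longrightarrow>
     norm (A q - A r - g q r) \<le> e * (q - r)" by blast
qed

section \<open>Rough paths and the germ of the rough convolution\<close>

lemma powr_le_powr_mult:
  fixes \<tau> T a b :: real
  assumes "0 \<le> \<tau>" "\<tau> \<le> T" "b \<le> a"
  shows "\<tau> powr a \<le> T powr (a - b) * \<tau> powr b"
proof -
  have "\<tau> powr a = \<tau> powr (a - b) * \<tau> powr b"
    by (simp add: powr_add[symmetric])
  also have "\<dots> \<le> T powr (a - b) * \<tau> powr b"
    using assms by (intro mult_right_mono powr_mono2) auto
  finally show ?thesis .
qed

text \<open>By Chen's relations smooth pairs vanish on the diagonal, so this bounds them linearly in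
  \<open>|t - s|\<close>, hence by both Hoelder powers on \<open>[0, T]\<close>, as
  \<open>2 * \<gamma> \<le> 1\<close>.\<close>

lemma smooth2_increment_bound:
  fixes f :: "real \<Rightarrow> real \<Rightarrow> 'a::real_normed_vector"
  assumes "smooth2 f"
  obtains K where "K \<ge> 0"
    "\<And>t s. t \<in> {0..T} \<Longrightarrow> s \<in> {0..T} \<Longrightarrow> norm (f t s - f s s) \<le> K * \<bar>t - s\<bar>"
proof -
  obtain D :: "nat \<Rightarrow> nat \<Rightarrow> real \<Rightarrow> real \<Rightarrow> 'a" where D0: "D 0 0 = f" "\<forall>m k. continuous_on UNIV (\<lambda>p. D m k (fst p) (snd p))"
    "\<forall>m k t s. ((\<lambda>t'. D m k t' s) has_vector_derivative D (Suc m) k t s) (at t)"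
    using assms unfolding smooth2_def by blast
  note D = D0(1) D0(2)[rule_format] D0(3)[rule_format]
  have "compact ((\<lambda>p. D 1 0 (fst p) (snd p)) ` ({0..T} \<times> {0..T}))"
    by (intro compact_continuous_image continuous_on_subset[OF D(2)] compact_Times) auto
  then obtain K where K: "K > 0" "\<And>t s. t \<in> {0..T} \<Longrightarrow> s \<in> {0..T} \<Longrightarrow> norm (D 1 0 t s) \<le> K"
    by (metis (no_types, lifting) bounded_pos compact_imp_bounded fst_conv imageI mem_Sigma_iff snd_conv)
  have "norm (f t s - f s s) \<le> K * \<bar>t - s\<bar>" if "t \<in> {0..T}" "s \<in> {0..T}" for t s
  proof -
    have "norm ((\<lambda>t. f t s) t - (\<lambda>t. f t s) s) \<le> K * norm (t - s)"
    proof (rule differentiable_bound[where S = "{0..T}"])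
      fix x assume x: "x \<in> {0..T}"
      show "((\<lambda>t. f t s) has_derivative (\<lambda>h. h *\<^sub>R D 1 0 x s)) (at x within {0..T})"
        using has_vector_derivative_at_within[OF D(3)[of 0 0 s x]]
        by (simp add: D(1) has_vector_derivative_def)
      show "onorm (\<lambda>h. h *\<^sub>R D 1 0 x s) \<le> K"
        using K(2)[OF x that(2)] K(1) by (intro onorm_le) (simp add: mult.commute[of K] mult_left_mono)
    qed (use that in auto)
    then show ?thesis by simp
  qed
  then show thesis using that[of K] K(1) by auto
qed

lemma chen_diagonal:
  assumes "chen T X XX" "s \<in> {0..T}"
  shows "X s s = 0" "XX s s = 0"
proof -
  have "X s s = X s s + X s s" "XX s s - XX s s - XX s s = tensor (X s s) (X s s)"
    using assms unfolding chen_def by blast+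
  then show "X s s = 0" "XX s s = 0" by (auto simp: tensor_def vec_eq_iff)
qed

lemma rho_lt_bounds:
  assumes "rho_lt T \<gamma> X XX Y YY \<epsilon>" "T > 0" "t \<in> {0..T}" "s \<in> {0..T}"
  shows "norm (X t s - Y t s) \<le> \<epsilon> * \<bar>t - s\<bar> powr \<gamma>"
    and "norm (XX t s - YY t s) \<le> \<epsilon> * \<bar>t - s\<bar> powr (2 * \<gamma>)"
proof -
  obtain K1 K2 where K: "K1 + K2 < \<epsilon>"
    "holder_bound T \<gamma> (\<lambda>t s. X t s - Y t s) K1" "holder_bound T (2 * \<gamma>) (\<lambda>t s. XX t s - YY t s) K2"
    using assms(1) unfolding rho_lt_def by blast
  \<comment> \<open>Each of the two constants is nonnegative, as its bound at the pair
    \<open>T, 0\<close> shows; therefore each is at most \<open>\<epsilon>\<close>.\<close>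
  have nonneg: "K \<ge> 0" if "holder_bound T \<alpha> f K" for f :: "real \<Rightarrow> real \<Rightarrow> 'z::real_normed_vector" and \<alpha> K
  proof -
    have "norm (f T 0) \<le> K * \<bar>T - 0\<bar> powr \<alpha>"
      using that assms(2) unfolding holder_bound_def by (elim ballE[of _ _ T] ballE[of _ _ 0]) auto
    then have "0 \<le> K * T powr \<alpha>" using assms(2) order_trans[OF norm_ge_zero] by fastforce
    then show ?thesis using assms(2) by (simp add: zero_le_mult_iff)
  qed
  have "K1 \<le> \<epsilon>" "K2 \<le> \<epsilon>" using K(1) nonneg[OF K(2)] nonneg[OF K(3)] by auto
  then show "norm (X t s - Y t s) \<le> \<epsilon> * \<bar>t - s\<bar> powr \<gamma>"
    "norm (XX t s - YY t s) \<le> \<epsilon> * \<bar>t - s\<bar> powr (2 * \<gamma>)"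
    using K(2,3) assms(3,4) unfolding holder_bound_def
    by (meson mult_right_mono order_trans powr_ge_zero)+
qed

text \<open>Both relations pass to pointwise limits, and approximants within
  \<open>1 / (n + 1)\<close> in the rough path metric converge pointwise.\<close>

lemma rough_path_chen:
  fixes X :: "real \<Rightarrow> real \<Rightarrow> real ^ 'd"
  assumes rough: "rough_path T \<gamma> X XX" and T: "T > 0"
  shows "chen T X XX"
proof -
  have "\<forall>n. \<exists>Y YY. chen T Y YY \<and> rho_lt T \<gamma> X XX Y YY (inverse (real (Suc n)))"
    using rough unfolding rough_path_def by (meson inverse_positive_iff_positive of_nat_0_less_iff zero_less_Suc)
  then obtain Y YY where Y: "\<And>n. chen T (Y n) (YY n)"
    "\<And>n. rho_lt T \<gamma> X XX (Y n) (YY n) (inverse (real (Suc n)))"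
    by metis
  have limY: "(\<lambda>n. Y n t s) \<longlonglongrightarrow> X t s" and limYY: "(\<lambda>n. YY n t s) \<longlonglongrightarrow> XX t s"
    if ts: "t \<in> {0..T}" "s \<in> {0..T}" for t s
  proof -
    have 0: "(\<lambda>n. inverse (real (Suc n)) * c) \<longlonglongrightarrow> 0" for c
      using tendsto_mult_right[OF LIMSEQ_inverse_real_of_nat, of c] by simp
    show "(\<lambda>n. Y n t s) \<longlonglongrightarrow> X t s"
      by (rule LIM_zero_cancel, rule Lim_null_comparison[OF _ 0[of "\<bar>t - s\<bar> powr \<gamma>"]])
         (use rho_lt_bounds(1)[OF Y(2) T ts] in \<open>auto simp: norm_minus_commute intro: always_eventually\<close>)
    show "(\<lambda>n. YY n t s) \<longlonglongrightarrow> XX t s"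
      by (rule LIM_zero_cancel, rule Lim_null_comparison[OF _ 0[of "\<bar>t - s\<bar> powr (2 * \<gamma>)"]])
         (use rho_lt_bounds(2)[OF Y(2) T ts] in \<open>auto simp: norm_minus_commute intro: always_eventually\<close>)
  qed
  show ?thesis
    unfolding chen_def
  proof (intro ballI conjI)
    fix t u s assume tus: "t \<in> {0..T}" "u \<in> {0..T}" "s \<in> {0..T}"
    have Yeq: "Y n t s = Y n t u + Y n u s" "YY n t s - YY n t u - YY n u s = tensor (Y n t u) (Y n u s)" for n
      using Y(1)[of n] tus unfolding chen_def by blast+
    have "(\<lambda>n. Y n t u + Y n u s) \<longlonglongrightarrow> X t u + X u s"
      by (intro tendsto_intros limY tus)
    then show "X t s = X t u + X u s"
      using LIMSEQ_unique[OF limY[OF tus(1,3)]] by (simp add: Yeq(1)[symmetric])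
    have "(\<lambda>n. YY n t s - YY n t u - YY n u s) \<longlonglongrightarrow> XX t s - XX t u - XX u s"
      by (intro tendsto_intros limYY tus)
    moreover have "(\<lambda>n. tensor (Y n t u) (Y n u s)) \<longlonglongrightarrow> tensor (X t u) (X u s)"
      unfolding tensor_def by (intro tendsto_vec_lambda tendsto_mult tendsto_vec_nth limY tus)
    ultimately show "XX t s - XX t u - XX u s = tensor (X t u) (X u s)"
      unfolding Yeq(2) by (rule LIMSEQ_unique)
  qed
qed

text \<open>One smooth approximant at distance less than 1 suffices: it is Lipschitz off the
  diagonal, and the difference obeys the Hoelder bounds by the definition of the metric.\<close>

lemma rough_path_holder:
  fixes X :: "real \<Rightarrow> real \<Rightarrow> real ^ 'd"
  assumes rough: "rough_path T \<gamma> X XX" and T: "T > 0" and \<gamma>: "0 \<le> \<gamma>" "\<gamma> \<le> 1 / 2"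
  obtains K where "K \<ge> 0" "\<And>t s. t \<in> {0..T} \<Longrightarrow> s \<in> {0..T} \<Longrightarrow> norm (X t s) \<le> K * \<bar>t - s\<bar> powr \<gamma>"
    "\<And>t s. t \<in> {0..T} \<Longrightarrow> s \<in> {0..T} \<Longrightarrow> norm (XX t s) \<le> K * \<bar>t - s\<bar> powr (2 * \<gamma>)"
proof -
  obtain Y YY where Y: "smooth2 Y" "smooth2 YY" "chen T Y YY" "rho_lt T \<gamma> X XX Y YY 1"
    using rough unfolding rough_path_def by (meson zero_less_one)
  obtain K1 where K1: "K1 \<ge> 0" "\<And>t s. t \<in> {0..T} \<Longrightarrow> s \<in> {0..T} \<Longrightarrow> norm (Y t s - Y s s) \<le> K1 * \<bar>t - s\<bar>"
    using smooth2_increment_bound[OF Y(1), of T] by blast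
  obtain K2 where K2: "K2 \<ge> 0" "\<And>t s. t \<in> {0..T} \<Longrightarrow> s \<in> {0..T} \<Longrightarrow> norm (YY t s - YY s s) \<le> K2 * \<bar>t - s\<bar>"
    using smooth2_increment_bound[OF Y(2), of T] by blast
  have le: "\<bar>t - s\<bar> \<le> T powr (1 - b) * \<bar>t - s\<bar> powr b" if "t \<in> {0..T}" "s \<in> {0..T}" "b \<le> 1" for t s b
    using powr_le_powr_mult[of "\<bar>t - s\<bar>" T b 1] that by auto
  define K where "K = 1 + K1 * T powr (1 - \<gamma>) + K2 * T powr (1 - 2 * \<gamma>)"
  have KK: "1 + K1 * T powr (1 - \<gamma>) \<le> K" "1 + K2 * T powr (1 - 2 * \<gamma>) \<le> K"
    using K1(1) K2(1) by (auto simp: K_def)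
  show thesis
  proof (rule that[of K])
    show "K \<ge> 0" using K1(1) K2(1) by (auto simp: K_def)
    fix t s assume ts: "t \<in> {0..T}" "s \<in> {0..T}"
    have "norm (X t s) \<le> norm (X t s - Y t s) + norm (Y t s - Y s s)"
      using norm_triangle_ineq[of "X t s - Y t s" "Y t s"] chen_diagonal(1)[OF Y(3) ts(2)] by simp
    also have "\<dots> \<le> 1 * \<bar>t - s\<bar> powr \<gamma> + K1 * (T powr (1 - \<gamma>) * \<bar>t - s\<bar> powr \<gamma>)"
      using K1(2)[OF ts] mult_left_mono[OF le[OF ts, of \<gamma>] K1(1)] \<gamma>
      by (intro add_mono rho_lt_bounds(1)[OF Y(4) T ts]) auto
    also have "\<dots> \<le> K * \<bar>t - s\<bar> powr \<gamma>"
      using mult_right_mono[OF KK(1), of "\<bar>t - s\<bar> powr \<gamma>"] by (simp add: algebra_simps)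
    finally show "norm (X t s) \<le> K * \<bar>t - s\<bar> powr \<gamma>" .
    have "norm (XX t s) \<le> norm (XX t s - YY t s) + norm (YY t s - YY s s)"
      using norm_triangle_ineq[of "XX t s - YY t s" "YY t s"] chen_diagonal(2)[OF Y(3) ts(2)] by simp
    also have "\<dots> \<le> 1 * \<bar>t - s\<bar> powr (2 * \<gamma>) + K2 * (T powr (1 - 2 * \<gamma>) * \<bar>t - s\<bar> powr (2 * \<gamma>))"
      using K2(2)[OF ts] mult_left_mono[OF le[OF ts, of "2 * \<gamma>"] K2(1)] \<gamma>
      by (intro add_mono rho_lt_bounds(2)[OF Y(4) T ts]) auto
    also have "\<dots> \<le> K * \<bar>t - s\<bar> powr (2 * \<gamma>)"
      using mult_right_mono[OF KK(2), of "\<bar>t - s\<bar> powr (2 * \<gamma>)"] by (simp add: algebra_simps)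
    finally show "norm (XX t s) \<le> K * \<bar>t - s\<bar> powr (2 * \<gamma>)" .
  qed
qed

text \<open>The mean value inequality along the segment from \<open>z\<close> to \<open>w\<close>,
  applied to \<open>f'\<close> and then to \<open>f\<close>. Second derivatives at two points of the
  ball differ by at most \<open>2 C\<close>, and the linear term adds \<open>C\<close>; hence the
  factor 3.\<close>

lemma
  fixes f :: "'a::real_normed_vector \<Rightarrow> 'b::real_normed_vector"
    and f' :: "'a \<Rightarrow> 'a \<Rightarrow> 'b" and f'' :: "'a \<Rightarrow> 'a \<Rightarrow> 'a \<Rightarrow> 'b"
  assumes lin1: "\<And>z. linear (f' z)" and lin2: "\<And>z k. linear (\<lambda>h. f'' z h k)"
    and der1: "\<And>z e. e > 0 \<Longrightarrow> \<exists>d>0. \<forall>h. norm h < d \<longrightarrow> norm (f (z + h) - f z - f' z h) \<le> e * norm h"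
    and der2: "\<And>z e. e > 0 \<Longrightarrow> \<exists>d>0. \<forall>h. norm h < d \<longrightarrow>
        (\<forall>k. norm (f' (z + h) k - f' z k - f'' z h k) \<le> e * norm h * norm k)"
    and bound: "\<And>z h k. norm z \<le> R \<Longrightarrow> norm (f'' z h k) \<le> C * norm h * norm k"
    and zw: "norm z \<le> R" "norm w \<le> R"
  shows derivative_lipschitz_of_second_derivative: "norm (f' w k - f' z k) \<le> 3 * C * norm (w - z) * norm k"
    and taylor_of_second_derivative: "norm (f w - f z - f' z (w - z)) \<le> 3 * C * (norm (w - z))\<^sup>2"
proof -
  \<comment> \<open>Reduction to one variable: an expansion in multiples of \<open>d\<close> is a
    vector derivative along the line through \<open>z\<close>.\<close>
  have line: "((\<lambda>s. g (z + s *\<^sub>R d)) has_vector_derivative g' (z + s *\<^sub>R d)) (at s within A)"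
    if g: "\<And>z e. e > 0 \<Longrightarrow> \<exists>\<delta>>0. \<forall>t. norm (t *\<^sub>R d) < \<delta> \<longrightarrow>
        norm (g (z + t *\<^sub>R d) - g z - t *\<^sub>R g' z) \<le> e * norm (t *\<^sub>R d)"
    for g g' :: "'a \<Rightarrow> 'b" and z d s A
    unfolding has_vector_derivative_def has_derivative_within_alt
  proof (intro conjI allI impI)
    fix e :: real assume e: "e > 0"
    define e' where "e' = e / (norm d + 1)"
    have e': "e' > 0" "e' * norm d \<le> e" using e by (auto simp: e'_def divide_simps add_nonneg_pos algebra_simps add_pos_nonneg)
    obtain \<delta> where \<delta>: "\<delta> > 0" "\<And>t. norm (t *\<^sub>R d) < \<delta> \<Longrightarrow>
        norm (g (z + s *\<^sub>R d + t *\<^sub>R d) - g (z + s *\<^sub>R d) - t *\<^sub>R g' (z + s *\<^sub>R d)) \<le> e' * norm (t *\<^sub>R d)"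
      using g[OF e'(1)] by blast
    show "\<exists>\<eta>>0. \<forall>y\<in>A. norm (y - s) < \<eta> \<longrightarrow>
        norm (g (z + y *\<^sub>R d) - g (z + s *\<^sub>R d) - (y - s) *\<^sub>R g' (z + s *\<^sub>R d)) \<le> e * norm (y - s)"
    proof (intro exI[of _ "\<delta> / (norm d + 1)"] conjI ballI impI)
      show "\<delta> / (norm d + 1) > 0" using \<delta>(1) by (simp add: add_nonneg_pos)
      fix y assume y: "norm (y - s) < \<delta> / (norm d + 1)"
      have "norm (y - s) * norm d \<le> norm (y - s) * (norm d + 1)" by (intro mult_left_mono) auto
      also have "\<dots> < \<delta>" using y by (simp add: pos_less_divide_eq add_nonneg_pos)
      finally have "norm ((y - s) *\<^sub>R d) < \<delta>" by simp
      moreover have "z + s *\<^sub>R d + (y - s) *\<^sub>R d = z + y *\<^sub>R d"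
        by (simp add: algebra_simps)
      ultimately have
        "norm (g (z + y *\<^sub>R d) - g (z + s *\<^sub>R d) - (y - s) *\<^sub>R g' (z + s *\<^sub>R d)) \<le> e' * (norm (y - s) * norm d)"
        using \<delta>(2)[of "y - s"] by (simp only: norm_scaleR real_norm_def)
      also have "\<dots> \<le> e * norm (y - s)"
        using mult_right_mono[OF e'(2), of "norm (y - s)"] by (simp add: mult_ac)
      finally show "norm (g (z + y *\<^sub>R d) - g (z + s *\<^sub>R d) - (y - s) *\<^sub>R g' (z + s *\<^sub>R d)) \<le> e * norm (y - s)" .
    qed
  qed (rule bounded_linear_scaleR_left)
  have seg: "norm (z + s *\<^sub>R (w - z)) \<le> R" if "norm z \<le> R" "norm w \<le> R" "s \<in> {0..1}" for z w s
  proof -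
    have "z + s *\<^sub>R (w - z) = (1 - s) *\<^sub>R z + s *\<^sub>R w" by (simp add: algebra_simps)
    also have "norm \<dots> \<le> (1 - s) * norm z + s * norm w"
      using that norm_triangle_ineq[of "(1 - s) *\<^sub>R z" "s *\<^sub>R w"] by simp
    also have "\<dots> \<le> (1 - s) * R + s * R"
      using that by (intro add_mono mult_left_mono) auto
    finally show ?thesis by (simp add: algebra_simps)
  qed
  have lip: "norm (f' w k - f' z k) \<le> 3 * C * norm (w - z) * norm k" if zw: "norm z \<le> R" "norm w \<le> R" for z w k
  proof -
    define d where "d = w - z"
    have der: "((\<lambda>s. f' (z + s *\<^sub>R d) k) has_vector_derivative f'' (z + s *\<^sub>R d) d k) (at s within {0..1})" for s
    proof (rule line[of d "\<lambda>z. f' z k" "\<lambda>z. f'' z d k"])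
      fix z :: 'a and e :: real assume "e > 0"
      define e' where "e' = e / (norm k + 1)"
      have e': "e' > 0" "e' * norm k \<le> e" using \<open>e > 0\<close> by (auto simp: e'_def divide_simps add_nonneg_pos algebra_simps add_pos_nonneg)
      obtain \<delta> where \<delta>: "\<delta> > 0" "\<And>h. norm h < \<delta> \<Longrightarrow> norm (f' (z + h) k - f' z k - f'' z h k) \<le> e' * norm h * norm k"
        using der2[OF e'(1)] by blast
      have "norm (f' (z + t *\<^sub>R d) k - f' z k - t *\<^sub>R f'' z d k) \<le> e * norm (t *\<^sub>R d)" if "norm (t *\<^sub>R d) < \<delta>" for t
      proof -
        have "f'' z (t *\<^sub>R d) k = t *\<^sub>R f'' z d k" using linear_scale[OF lin2[of z k]] by simp
        then have "norm (f' (z + t *\<^sub>R d) k - f' z k - t *\<^sub>R f'' z d k) \<le> e' * norm (t *\<^sub>R d) * norm k"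
          using \<delta>(2)[OF that] by simp
        also have "\<dots> \<le> e * norm (t *\<^sub>R d)"
          using mult_right_mono[OF e'(2), of "norm (t *\<^sub>R d)"] by (simp add: mult_ac)
        finally show ?thesis .
      qed
      with \<delta>(1) show "\<exists>\<delta>>0. \<forall>t. norm (t *\<^sub>R d) < \<delta> \<longrightarrow>
        norm (f' (z + t *\<^sub>R d) k - f' z k - t *\<^sub>R f'' z d k) \<le> e * norm (t *\<^sub>R d)" by blast
    qed
    have B: "norm (f'' (z + s *\<^sub>R d) d k) \<le> C * norm d * norm k" if "s \<in> {0..1}" for s
      using bound seg[OF zw that] by (simp add: d_def)
    have "norm (f' (z + 1 *\<^sub>R d) k - f' (z + 0 *\<^sub>R d) k - (1 - 0) *\<^sub>R f'' (z + 0 *\<^sub>R d) d k)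
        \<le> norm (1 - 0 :: real) * (2 * (C * norm d * norm k))"
      by (rule vector_differentiable_bound_linearization[OF der])
         (use B[of 0] B norm_triangle_le_diff[OF B B[of 0]] in \<open>auto simp: closed_segment_eq_real_ivl mult.assoc\<close>)
    then show ?thesis
      using B[of 0] norm_triangle_sub[of "f' w k - f' z k" "f'' z d k"] by (simp add: d_def)
  qed
  from lip[OF zw] show "norm (f' w k - f' z k) \<le> 3 * C * norm (w - z) * norm k" .
  define d where "d = w - z"
  have der: "((\<lambda>s. f (z + s *\<^sub>R d)) has_vector_derivative f' (z + s *\<^sub>R d) d) (at s within {0..1})" for s
  proof (rule line[of d f "\<lambda>z. f' z d"])
    fix z :: 'a and e :: real assume "e > 0"
    then obtain \<delta> where "\<delta> > 0" "\<And>h. norm h < \<delta> \<Longrightarrow> norm (f (z + h) - f z - f' z h) \<le> e * norm h"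
      using der1 by blast
    then show "\<exists>\<delta>>0. \<forall>t. norm (t *\<^sub>R d) < \<delta> \<longrightarrow>
        norm (f (z + t *\<^sub>R d) - f z - t *\<^sub>R f' z d) \<le> e * norm (t *\<^sub>R d)"
      using linear_scale[OF lin1[of z]] by metis
  qed
  have "norm (f (z + 1 *\<^sub>R d) - f (z + 0 *\<^sub>R d) - (1 - 0) *\<^sub>R f' (z + 0 *\<^sub>R d) d)
      \<le> norm (1 - 0 :: real) * (3 * C * norm d * norm d)"
  proof (rule vector_differentiable_bound_linearization[OF der])
    fix s :: real assume s: "s \<in> {0..1}"
    have "C * norm d * norm d \<ge> 0"
      using bound[OF zw(1), of d d] norm_ge_zero order_trans by blast
    moreover have "norm (f' (z + s *\<^sub>R d) d - f' z d) \<le> 3 * C * norm (s *\<^sub>R d) * norm d"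
      using lip[OF zw(1) seg[OF zw s], of d] by (simp add: d_def)
    moreover have "s * (C * norm d * norm d) \<le> 1 * (C * norm d * norm d)"
      using s \<open>C * norm d * norm d \<ge> 0\<close> by (intro mult_right_mono) auto
    ultimately show "norm (f' (z + s *\<^sub>R d) d - f' (z + 0 *\<^sub>R d) d) \<le> 3 * C * norm d * norm d"
      using s by (simp add: mult_ac)
  qed (auto simp: closed_segment_eq_real_ivl)
  then show "norm (f w - f z - f' z (w - z)) \<le> 3 * C * (norm (w - z))\<^sup>2"
    by (simp add: d_def power2_eq_square mult_ac)
qed

section \<open>Nonlinearities in coordinates\<close>

context selfadjoint_semigroup
begin

text \<open>The positive power \<open>(-L)^a\<close> on its domain; \<open>nrm\<close> is its norm
  and \<open>dec\<close> the case \<open>a = 1\<close>.\<close>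

definition coord :: "real \<Rightarrow> 'h \<Rightarrow> 'h" where
  "coord a w = (THE y. fracA S a y = w)"

lemma coord_fracA [simp]: "a \<ge> 0 \<Longrightarrow> coord a (fracA S a y) = y"
  by (simp add: coord_def fracA_inject)

lemma fracA_coord [simp]: "a \<ge> 0 \<Longrightarrow> w \<in> Hsp S a \<Longrightarrow> fracA S a (coord a w) = w"
  by (auto simp: Hsp_def)

lemma nrm_eq_coord: "nrm S a w = norm (coord a w)"
  by (simp add: nrm_def coord_def)

lemma Hsp_fracA [simp]: "fracA S a z \<in> Hsp S a"
  by (simp add: Hsp_def)

lemma subspace_Hsp: "a \<ge> 0 \<Longrightarrow> subspace (Hsp S a)"
  unfolding Hsp_def by (intro linear_subspace_image linear_fracA) auto

lemma
  assumes "a \<ge> 0" "x \<in> Hsp S a" "y \<in> Hsp S a"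
  shows coord_diff: "coord a (x - y) = coord a x - coord a y"
    and coord_add: "coord a (x + y) = coord a x + coord a y"
  using assms by (auto simp: Hsp_def simp flip: fracA_diff fracA_add)

lemma coord_scaleR: "a \<ge> 0 \<Longrightarrow> x \<in> Hsp S a \<Longrightarrow> coord a (r *\<^sub>R x) = r *\<^sub>R coord a x"
  by (auto simp: Hsp_def simp flip: fracA_scaleR)

lemma norm_coord_le_vnrm: "norm (coord a (g $ i)) \<le> vnrm S a g"
  unfolding vnrm_def nrm_eq_coord by (rule member_le_sum) auto

lemma Hvsp_nth: "g \<in> Hvsp S a \<Longrightarrow> g $ i \<in> Hsp S a"
  by (simp add: Hvsp_def)

text \<open>In the coordinates $z = (-L)^{\alpha}x$ of $\mathcal{H}_{\alpha}$ the nonlinearity becomes an ordinary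
  twice differentiable map of the Hilbert space into itself, to which Taylor's formula applies.\<close>

lemma C2_class_coord_estimates:
  fixes Fc :: "'h \<Rightarrow> 'h ^ 'd" and i :: 'd
  assumes F: "C2_class S \<alpha> 0 Fc DF" and a: "a = \<alpha> + 1" "a \<ge> 0"
  defines "f \<equiv> \<lambda>i z. coord a (Fc (fracA S a z) $ i)"
    and "f' \<equiv> \<lambda>i z k. coord a (DF (fracA S a z) (fracA S a k) $ i)"
  obtains C where "C \<ge> 0"
    "\<And>i z. linear (f' i z)"
    "\<And>i z. norm z \<le> R \<Longrightarrow> norm (f i z) \<le> C"
    "\<And>i z k. norm z \<le> R \<Longrightarrow> norm (f' i z k) \<le> C * norm k"
    "\<And>i z w k. norm z \<le> R \<Longrightarrow> norm w \<le> R \<Longrightarrow> norm (f' i w k - f' i z k) \<le> C * norm (w - z) * norm k"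
    "\<And>i z w. norm z \<le> R \<Longrightarrow> norm w \<le> R \<Longrightarrow> norm (f i w - f i z - f' i z (w - z)) \<le> C * (norm (w - z))\<^sup>2"
proof -
  obtain D2F :: "'h \<Rightarrow> 'h \<Rightarrow> 'h \<Rightarrow> 'h ^ 'd" where H: "\<forall>\<theta>\<ge>\<alpha>.
     (\<forall>x\<in>Hsp S (\<theta>+1).
        Fc x \<in> Hvsp S (\<theta>+0+1) \<and>
        (\<forall>h\<in>Hsp S (\<theta>+1). DF x h \<in> Hvsp S (\<theta>+0+1)) \<and>
        (\<forall>h\<in>Hsp S (\<theta>+1). \<forall>k\<in>Hsp S (\<theta>+1). D2F x h k \<in> Hvsp S (\<theta>+0+1)) \<and>
        (\<forall>h\<in>Hsp S (\<theta>+1). \<forall>k\<in>Hsp S (\<theta>+1). \<forall>a b.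
            DF x (a *\<^sub>R h + b *\<^sub>R k) = a *\<^sub>R DF x h + b *\<^sub>R DF x k) \<and>
        (\<forall>h\<in>Hsp S (\<theta>+1). \<forall>k\<in>Hsp S (\<theta>+1). \<forall>l\<in>Hsp S (\<theta>+1). \<forall>a b.
            D2F x (a *\<^sub>R h + b *\<^sub>R k) l = a *\<^sub>R D2F x h l + b *\<^sub>R D2F x k l \<and>
            D2F x l (a *\<^sub>R h + b *\<^sub>R k) = a *\<^sub>R D2F x l h + b *\<^sub>R D2F x l k) \<and>
        (\<forall>\<epsilon>>0. \<exists>\<eta>>0. \<forall>h\<in>Hsp S (\<theta>+1). nrm S (\<theta>+1) h < \<eta> \<longrightarrow>
            vnrm S (\<theta>+0+1) (Fc (x + h) - Fc x - DF x h) \<le> \<epsilon> * nrm S (\<theta>+1) h) \<and>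
        (\<forall>\<epsilon>>0. \<exists>\<eta>>0. \<forall>h\<in>Hsp S (\<theta>+1). nrm S (\<theta>+1) h < \<eta> \<longrightarrow>
            (\<forall>k\<in>Hsp S (\<theta>+1). vnrm S (\<theta>+0+1) (DF (x + h) k - DF x k - D2F x h k)
               \<le> \<epsilon> * nrm S (\<theta>+1) h * nrm S (\<theta>+1) k))) \<and>
     (\<forall>R. \<exists>C. \<forall>x\<in>Hsp S (\<theta>+1). nrm S (\<theta>+1) x \<le> R \<longrightarrow>
        vnrm S (\<theta>+0+1) (Fc x) \<le> C \<and>
        (\<forall>h\<in>Hsp S (\<theta>+1). vnrm S (\<theta>+0+1) (DF x h) \<le> C * nrm S (\<theta>+1) h) \<and>
        (\<forall>h\<in>Hsp S (\<theta>+1). \<forall>k\<in>Hsp S (\<theta>+1).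
            vnrm S (\<theta>+0+1) (D2F x h k) \<le> C * nrm S (\<theta>+1) h * nrm S (\<theta>+1) k))"
    using F unfolding C2_class_def by (elim exE) (rule that)
  have e: "\<alpha> + 1 = a" "\<alpha> + 0 + 1 = a" using a by auto
  note H1 = H[THEN spec, of \<alpha>, THEN mp, OF order_refl, unfolded e]
  note A = conjunct1[OF H1, THEN bspec, OF Hsp_fracA]
  note B = conjunct2[OF H1]
  let ?x = "\<lambda>z. fracA S a z"
  have A1: "Fc (?x z) $ i \<in> Hsp S a" for z i
    using A[of z] by (elim conjE) (rule Hvsp_nth)
  have A2: "DF (?x z) (?x h) $ i \<in> Hsp S a" for z h i
    using A[of z] by (elim conjE) (drule bspec[OF _ Hsp_fracA, of _ _ h], rule Hvsp_nth)
  have A3: "D2F (?x z) (?x h) (?x k) $ i \<in> Hsp S a" for z h k i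
    using A[of z] by (elim conjE) (rule Hvsp_nth, blast intro: Hsp_fracA)
  have A4: "DF (?x z) (r *\<^sub>R ?x h + s *\<^sub>R ?x k) = r *\<^sub>R DF (?x z) (?x h) + s *\<^sub>R DF (?x z) (?x k)" for z h k r s
    using A[of z] by (elim conjE) (blast intro: Hsp_fracA)
  have A5: "D2F (?x z) (r *\<^sub>R ?x h + s *\<^sub>R ?x k) (?x l) = r *\<^sub>R D2F (?x z) (?x h) (?x l) + s *\<^sub>R D2F (?x z) (?x k) (?x l)"
    for z h k l r s
    using A[of z] by (elim conjE) (blast intro: Hsp_fracA)
  have A6: "\<forall>\<epsilon>>0. \<exists>\<eta>>0. \<forall>h\<in>Hsp S a. nrm S a h < \<eta> \<longrightarrow>
            vnrm S a (Fc (?x z + h) - Fc (?x z) - DF (?x z) h) \<le> \<epsilon> * nrm S a h" for z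
    using A[of z] by (elim conjE)
  have A7: "\<forall>\<epsilon>>0. \<exists>\<eta>>0. \<forall>h\<in>Hsp S a. nrm S a h < \<eta> \<longrightarrow>
            (\<forall>k\<in>Hsp S a. vnrm S a (DF (?x z + h) k - DF (?x z) k - D2F (?x z) h k)
               \<le> \<epsilon> * nrm S a h * nrm S a k)" for z
    using A[of z] by (elim conjE)
  obtain C0 where C0: "\<And>x. x \<in> Hsp S a \<Longrightarrow> nrm S a x \<le> R \<Longrightarrow>
        vnrm S a (Fc x) \<le> C0 \<and>
        (\<forall>h\<in>Hsp S a. vnrm S a (DF x h) \<le> C0 * nrm S a h) \<and>
        (\<forall>h\<in>Hsp S a. \<forall>k\<in>Hsp S a. vnrm S a (D2F x h k) \<le> C0 * nrm S a h * nrm S a k)"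
    using B[THEN spec, of R] by (elim exE) blast
  define C where "C = max C0 0"
  define f'' where "f'' i z h k = coord a (D2F (?x z) (?x h) (?x k) $ i)" for i z h k
  have lin1: "linear (f' i z)" for i z
  proof (rule linearI)
    show "f' i z (h + k) = f' i z h + f' i z k" for h k
      using A4[of z 1 h 1 k] a(2) A2 by (simp add: f'_def fracA_add coord_add)
    show "f' i z (r *\<^sub>R h) = r *\<^sub>R f' i z h" for r h
      using A4[of z r h 0 h] a(2) A2 by (simp add: f'_def fracA_scaleR coord_scaleR)
  qed
  have lin2: "linear (\<lambda>h. f'' i z h k)" for i z k
  proof (rule linearI)
    show "f'' i z (h + l) k = f'' i z h k + f'' i z l k" for h l
      using A5[of z 1 h 1 l k] a(2) A3 by (simp add: f''_def fracA_add coord_add)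
    show "f'' i z (r *\<^sub>R h) k = r *\<^sub>R f'' i z h k" for r h
      using A5[of z r h 0 h k] a(2) A3 by (simp add: f''_def fracA_scaleR coord_scaleR)
  qed
  have der1: "\<exists>d>0. \<forall>h. norm h < d \<longrightarrow> norm (f i (z + h) - f i z - f' i z h) \<le> e * norm h" if e: "e > 0" for i z e
  proof -
    obtain d where d: "d > 0" "\<And>h. h \<in> Hsp S a \<Longrightarrow> nrm S a h < d \<Longrightarrow>
        vnrm S a (Fc (?x z + h) - Fc (?x z) - DF (?x z) h) \<le> e * nrm S a h"
      using A6[of z, THEN spec, of e, THEN mp, OF e] by (elim exE conjE) (rule that, auto)
    have "norm (f i (z + h) - f i z - f' i z h) \<le> e * norm h" if "norm h < d" for h
    proof -
      have eq: "f i (z + h) - f i z - f' i z h = coord a ((Fc (?x z + ?x h) - Fc (?x z) - DF (?x z) (?x h)) $ i)"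
        using a(2) A1 A2 subspace_diff[OF subspace_Hsp[OF a(2)] A1 A1]
        by (simp add: f_def f'_def coord_diff flip: fracA_add)
      have "norm (f i (z + h) - f i z - f' i z h) \<le> vnrm S a (Fc (?x z + ?x h) - Fc (?x z) - DF (?x z) (?x h))"
        unfolding eq by (rule norm_coord_le_vnrm)
      also have "\<dots> \<le> e * norm h"
        using d(2)[OF Hsp_fracA, of h] that by (simp only: nrm_fracA[OF a(2)])
      finally show ?thesis .
    qed
    with d(1) show ?thesis by blast
  qed
  have der2: "\<exists>d>0. \<forall>h. norm h < d \<longrightarrow>
      (\<forall>k. norm (f' i (z + h) k - f' i z k - f'' i z h k) \<le> e * norm h * norm k)" if e: "e > 0" for i z e
  proof -
    obtain d where d: "d > 0" "\<And>h k. h \<in> Hsp S a \<Longrightarrow> nrm S a h < d \<Longrightarrow> k \<in> Hsp S a \<Longrightarrow>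
        vnrm S a (DF (?x z + h) k - DF (?x z) k - D2F (?x z) h k) \<le> e * nrm S a h * nrm S a k"
      using A7[of z, THEN spec, of e, THEN mp, OF e] by (elim exE conjE) (rule that, auto)
    have "norm (f' i (z + h) k - f' i z k - f'' i z h k) \<le> e * norm h * norm k" if "norm h < d" for h k
    proof -
      have eq: "f' i (z + h) k - f' i z k - f'' i z h k
          = coord a ((DF (?x z + ?x h) (?x k) - DF (?x z) (?x k) - D2F (?x z) (?x h) (?x k)) $ i)"
        using a(2) A2 A3 subspace_diff[OF subspace_Hsp[OF a(2)] A2 A2]
        by (simp add: f'_def f''_def coord_diff flip: fracA_add)
      have "norm (f' i (z + h) k - f' i z k - f'' i z h k) \<le> vnrm S a (DF (?x z + ?x h) (?x k) - DF (?x z) (?x k) - D2F (?x z) (?x h) (?x k))"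
        unfolding eq by (rule norm_coord_le_vnrm)
      also have "\<dots> \<le> e * norm h * norm k"
        using d(2)[OF Hsp_fracA _ Hsp_fracA, of h k] that by (simp only: nrm_fracA[OF a(2)])
      finally show ?thesis .
    qed
    with d(1) show ?thesis by blast
  qed
  have C0C: "C0 \<le> C" "C \<ge> 0" by (auto simp: C_def)
  have f_bound: "norm (f i z) \<le> C" if "norm z \<le> R" for i z
  proof -
    have "vnrm S a (Fc (?x z)) \<le> C0" using C0[of "?x z"] that a(2) by simp
    then show ?thesis
      using norm_coord_le_vnrm[of a "Fc (?x z)" i] C0C by (simp add: f_def)
  qed
  have f'_bound: "norm (f' i z k) \<le> C * norm k" if "norm z \<le> R" for i z k
  proof -
    have "vnrm S a (DF (?x z) (?x k)) \<le> C0 * norm k"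
      using C0[OF Hsp_fracA, of z, THEN conjunct2, THEN conjunct1, THEN bspec, OF _ Hsp_fracA, of k] that
      by (simp only: nrm_fracA[OF a(2)])
    also have "\<dots> \<le> C * norm k" using C0C by (intro mult_right_mono) auto
    finally show ?thesis
      using norm_coord_le_vnrm[of a "DF (?x z) (?x k)" i] by (simp add: f'_def)
  qed
  have f''_bound: "norm (f'' i z h k) \<le> C * norm h * norm k" if "norm z \<le> R" for i z h k
  proof -
    have "vnrm S a (D2F (?x z) (?x h) (?x k)) \<le> C0 * norm h * norm k"
      using C0[OF Hsp_fracA, of z, THEN conjunct2, THEN conjunct2, THEN bspec, OF _ Hsp_fracA, of h, THEN bspec,
          OF _ Hsp_fracA, of k] that
      by (simp only: nrm_fracA[OF a(2)])
    also have "\<dots> \<le> C * norm h * norm k" using C0C by (intro mult_right_mono) auto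
    finally show ?thesis
      using norm_coord_le_vnrm[of a "D2F (?x z) (?x h) (?x k)" i] by (simp add: f''_def)
  qed
  note T = lin1 lin2 der1 der2 f''_bound
  show thesis
  proof (rule that[of "3 * C"])
    show "3 * C \<ge> 0" "\<And>i z. linear (f' i z)" using C0C lin1 by auto
    show "norm (f i z) \<le> 3 * C" if "norm z \<le> R" for i z
      using f_bound[OF that, of i] C0C by linarith
    show "norm (f' i z k) \<le> 3 * C * norm k" if "norm z \<le> R" for i z k
    proof -
      have "C * norm k \<le> 3 * C * norm k" using C0C by (intro mult_right_mono) auto
      with f'_bound[OF that, of i k] show ?thesis by linarith
    qed
    show "norm (f' i w k - f' i z k) \<le> 3 * C * norm (w - z) * norm k" if "norm z \<le> R" "norm w \<le> R" for i z w k
      by (rule derivative_lipschitz_of_second_derivative[where f' = "f' i" and f'' = "f'' i" and f = "f i", OF T that])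
    show "norm (f i w - f i z - f' i z (w - z)) \<le> 3 * C * (norm (w - z))\<^sup>2" if "norm z \<le> R" "norm w \<le> R" for i z w
      by (rule taylor_of_second_derivative[where f' = "f' i" and f'' = "f'' i" and f = "f i", OF T that])
  qed
qed

lemma C2_class_mono: "C2_class S \<alpha> \<beta> Fc DF \<Longrightarrow> \<alpha> \<le> \<alpha>' \<Longrightarrow> C2_class S \<alpha>' \<beta> Fc DF"
  unfolding C2_class_def by (elim exE, rule exI, rule allI, rule impI) (drule spec, erule mp, simp)

lemma
  assumes F: "C2_class S \<alpha> 0 Fc DF" and a: "a = \<alpha> + 1"
  shows C2_class_Hsp: "Fc (fracA S a z) $ i \<in> Hsp S a"
    and C2_class_Hsp_deriv: "DF (fracA S a z) (fracA S a h) $ i \<in> Hsp S a"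
proof -
  have e: "\<alpha> + 1 = a" "\<alpha> + 0 + 1 = a" using a by auto
  have "\<forall>x\<in>Hsp S (\<alpha> + 1). Fc x \<in> Hvsp S (\<alpha> + 0 + 1) \<and> (\<forall>h\<in>Hsp S (\<alpha> + 1). DF x h \<in> Hvsp S (\<alpha> + 0 + 1))"
    using F unfolding C2_class_def by blast
  then show "Fc (fracA S a z) $ i \<in> Hsp S a" "DF (fracA S a z) (fracA S a h) $ i \<in> Hsp S a"
    unfolding e using Hsp_fracA Hvsp_nth by blast+
qed

text \<open>Two levels of the scale are combined. Suprema come from \<open>H\<close> itself;
  differences are taken in \<open>H_{-2\<gamma>}\<close>, where \<open>(-L)^(-2\<gamma>)\<close>
  conjugates \<open>F\<close> to the map \<open>f\<close> and Taylor's formula holds. The remainder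
  of \<open>F\<close> splits into the Taylor part and \<open>DF(u)\<close> applied to
  \<open>v - u - F(u) c\<close>.\<close>

lemma C2_class_estimates:
  fixes Fc :: "'h \<Rightarrow> 'h ^ 'd"
  assumes F: "C2_class S (- 2 * \<gamma>) 0 Fc DF" and \<gamma>: "0 < \<gamma>" "\<gamma> \<le> 1 / 2"
  obtains C where "C \<ge> 0"
    "\<And>u i. norm u \<le> R \<Longrightarrow> norm (Fu S Fc u $ i) \<le> C"
    "\<And>u i j. norm u \<le> R \<Longrightarrow> norm (DFF S Fc DF u i j) \<le> C"
    "\<And>u v i c. norm u \<le> R \<Longrightarrow> norm v \<le> R \<Longrightarrow>
      norm (fracA S (2 * \<gamma>) (Fu S Fc v $ i - Fu S Fc u $ i - (\<Sum>j\<in>UNIV. c $ j *\<^sub>R DFF S Fc DF u i j)))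
        \<le> C * ((norm (fracA S (2 * \<gamma>) (v - u)))\<^sup>2
             + norm (fracA S (2 * \<gamma>) (v - u - (\<Sum>j\<in>UNIV. c $ j *\<^sub>R Fu S Fc u $ j))))"
    "\<And>u v i j. norm u \<le> R \<Longrightarrow> norm v \<le> R \<Longrightarrow>
      norm (fracA S (2 * \<gamma>) (DFF S Fc DF v i j - DFF S Fc DF u i j)) \<le> C * norm (fracA S (2 * \<gamma>) (v - u))"
proof -
  \<comment> \<open>Coordinates are shifted by one: an element of \<open>H_{-2\<gamma>}\<close> is
    represented in \<open>Hsp S (1 - 2 * \<gamma>)\<close>.\<close>
  define a where "a = 1 - 2 * \<gamma>"
  have a: "a = - 2 * \<gamma> + 1" "a \<ge> 0" using \<gamma> by (auto simp: a_def)
  have F0: "C2_class S 0 0 Fc DF" by (rule C2_class_mono[OF F]) (use \<gamma> in auto)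
  let ?A = "fracA S (2 * \<gamma>)"
  have lin: "linear ?A" using \<gamma> by (intro linear_fracA) auto
  define f where "f i z = coord a (Fc (fracA S a z) $ i)" for i z
  define f' where "f' i z k = coord a (DF (fracA S a z) (fracA S a k) $ i)" for i z k
  define G' where "G' i u k = coord 1 (DF (fracA S 1 u) (fracA S 1 k) $ i)" for i u k
  have enc_split: "fracA S 1 u = fracA S a (?A u)" for u
    using fracA_fracA[of a "2 * \<gamma>" u] \<gamma> by (simp add: a_def)
  have Fu_coord: "Fu S Fc u $ i = coord 1 (Fc (fracA S 1 u) $ i)" for u i
    by (simp add: Fu_def dec_def enc_def coord_def)
  have Fu_enc: "fracA S 1 (Fu S Fc u $ i) = Fc (fracA S 1 u) $ i" for u i
    unfolding Fu_coord by (rule fracA_coord[OF zero_le_one C2_class_Hsp[OF F0]]) simp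
  have G'_enc: "fracA S 1 (G' i u k) = DF (fracA S 1 u) (fracA S 1 k) $ i" for i u k
    unfolding G'_def by (rule fracA_coord[OF zero_le_one C2_class_Hsp_deriv[OF F0]]) simp
  have DFF_G': "DFF S Fc DF u i j = G' i u (Fu S Fc u $ j)" for u i j
    by (simp add: DFF_def G'_def Fu_enc enc_def dec_def coord_def)
  have A_Fu: "?A (Fu S Fc u $ i) = f i (?A u)" for u i
    using Fu_enc[of u i] a(2) unfolding f_def enc_split by (metis coord_fracA)
  have A_G': "?A (G' i u k) = f' i (?A u) (?A k)" for i u k
    using G'_enc[of i u k] a(2) unfolding f'_def enc_split by (metis coord_fracA)
  obtain C1 where C1: "C1 \<ge> 0" "\<And>u i. norm u \<le> R \<Longrightarrow> norm (coord 1 (Fc (fracA S 1 u) $ i)) \<le> C1"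
      "\<And>i u k. norm u \<le> R \<Longrightarrow> norm (G' i u k) \<le> C1 * norm k"
    using C2_class_coord_estimates[OF F0, of 1 R] unfolding G'_def by (metis add_0 zero_le_one)
  obtain M where M: "M > 0" "\<And>x. norm (?A x) \<le> M * norm x"
    using fracA_bound[of "2 * \<gamma>"] \<gamma> by auto
  obtain C2 where C2: "C2 \<ge> 0" "\<And>i z. linear (f' i z)"
    "\<And>i z. norm z \<le> M * R \<Longrightarrow> norm (f i z) \<le> C2"
    "\<And>i z k. norm z \<le> M * R \<Longrightarrow> norm (f' i z k) \<le> C2 * norm k"
    "\<And>i z w k. norm z \<le> M * R \<Longrightarrow> norm w \<le> M * R \<Longrightarrow> norm (f' i w k - f' i z k) \<le> C2 * norm (w - z) * norm k"
    "\<And>i z w. norm z \<le> M * R \<Longrightarrow> norm w \<le> M * R \<Longrightarrow> norm (f i w - f i z - f' i z (w - z)) \<le> C2 * (norm (w - z))\<^sup>2"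
    using C2_class_coord_estimates[OF F a, of "M * R"] unfolding f_def f'_def by blast
  have AR: "norm (?A u) \<le> M * R" if "norm u \<le> R" for u
    using M(2)[of u] mult_left_mono[OF that, of M] M(1) by linarith
  \<comment> \<open>One summand per estimate; the absolute value covers a negative
    \<open>R\<close>.\<close>
  define C where "C = C1 + C1 * C1 + C2 + (C2 * C2 + C2 * (C2 * (2 * \<bar>M * R\<bar>) + C2))"
  have parts: "0 \<le> C1 * C1" "0 \<le> C2 * C2" "0 \<le> C2 * (C2 * (2 * \<bar>M * R\<bar>) + C2)"
    using C1(1) C2(1) by auto
  have C: "C \<ge> 0" "C1 \<le> C" "C1 * C1 \<le> C" "C2 \<le> C" "C2 * C2 + C2 * (C2 * (2 * \<bar>M * R\<bar>) + C2) \<le> C"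
    unfolding C_def using parts C1(1) C2(1) by linarith+
  show thesis
  proof (rule that[OF C(1)])
    fix u v :: 'h and i j :: 'd and c :: "real ^ 'd"
    show FuC: "norm (Fu S Fc u $ i) \<le> C" if "norm u \<le> R" for u i
      using C1(2)[OF that, of i] C(2) by (simp add: Fu_coord)
    show "norm (DFF S Fc DF u i j) \<le> C" if "norm u \<le> R"
    proof -
      have "norm (DFF S Fc DF u i j) \<le> C1 * norm (Fu S Fc u $ j)"
        unfolding DFF_G' by (rule C1(3)[OF that])
      also have "\<dots> \<le> C1 * C1"
        using C1(2)[OF that, of j] C1(1) by (intro mult_left_mono) (auto simp: Fu_coord)
      finally show ?thesis using C(3) by linarith
    qed
    assume u: "norm u \<le> R" and v: "norm v \<le> R"
    let ?z = "?A u" and ?w = "?A v"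
    note z = AR[OF u] and w = AR[OF v]
    have wz: "?A (v - u) = ?w - ?z" by (rule linear_diff[OF lin])
    show "norm (?A (Fu S Fc v $ i - Fu S Fc u $ i - (\<Sum>j\<in>UNIV. c $ j *\<^sub>R DFF S Fc DF u i j)))
        \<le> C * ((norm (?A (v - u)))\<^sup>2 + norm (?A (v - u - (\<Sum>j\<in>UNIV. c $ j *\<^sub>R Fu S Fc u $ j))))"
    proof -
      let ?y = "?A (v - u - (\<Sum>j\<in>UNIV. c $ j *\<^sub>R Fu S Fc u $ j))"
      have "f' i ?z ?y = f' i ?z (?w - ?z) - (\<Sum>j\<in>UNIV. c $ j *\<^sub>R ?A (DFF S Fc DF u i j))"
        by (simp add: linear_diff[OF lin] linear_sum[OF lin] linear_scale[OF lin] linear_diff[OF C2(2)]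
            linear_sum[OF C2(2)] linear_scale[OF C2(2)] DFF_G' A_G' wz)
      then have eq: "?A (Fu S Fc v $ i - Fu S Fc u $ i - (\<Sum>j\<in>UNIV. c $ j *\<^sub>R DFF S Fc DF u i j))
          = (f i ?w - f i ?z - f' i ?z (?w - ?z)) + f' i ?z ?y"
        by (simp add: linear_diff[OF lin] linear_sum[OF lin] linear_scale[OF lin] A_Fu)
      have "norm (?A (Fu S Fc v $ i - Fu S Fc u $ i - (\<Sum>j\<in>UNIV. c $ j *\<^sub>R DFF S Fc DF u i j))) \<le> C2 * (norm (?w - ?z))\<^sup>2 + C2 * norm ?y"
        unfolding eq
        by (rule norm_triangle_mono[OF C2(6)[OF z w] C2(4)[OF z]])
      also have "\<dots> = C2 * ((norm (?A (v - u)))\<^sup>2 + norm ?y)"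
        by (simp only: wz distrib_left)
      also have "\<dots> \<le> C * ((norm (?A (v - u)))\<^sup>2 + norm ?y)"
        using C(4) by (intro mult_right_mono) auto
      finally show ?thesis .
    qed
    show "norm (?A (DFF S Fc DF v i j - DFF S Fc DF u i j)) \<le> C * norm (?A (v - u))"
    proof -
      let ?n = "norm (?w - ?z)"
      have n: "?n \<le> 2 * \<bar>M * R\<bar>" using norm_triangle_ineq4[of ?w ?z] z w by linarith
      have df: "norm (f j ?w - f j ?z) \<le> (C2 * (2 * \<bar>M * R\<bar>) + C2) * ?n"
      proof -
        have "norm (f j ?w - f j ?z) \<le> norm (f j ?w - f j ?z - f' j ?z (?w - ?z)) + norm (f' j ?z (?w - ?z))"
          using norm_triangle_ineq[of "f j ?w - f j ?z - f' j ?z (?w - ?z)" "f' j ?z (?w - ?z)"] by simp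
        also have "\<dots> \<le> C2 * ?n\<^sup>2 + C2 * ?n"
          by (intro add_mono C2(6) C2(4) z w)
        finally have "norm (f j ?w - f j ?z) \<le> C2 * ?n\<^sup>2 + C2 * ?n" .
        moreover have "C2 * ?n\<^sup>2 \<le> C2 * (2 * \<bar>M * R\<bar> * ?n)"
          unfolding power2_eq_square using n C2(1) by (intro mult_left_mono mult_right_mono) auto
        ultimately show ?thesis by (simp add: algebra_simps)
      qed
      have eq: "?A (DFF S Fc DF v i j - DFF S Fc DF u i j)
          = (f' i ?w (f j ?w) - f' i ?z (f j ?w)) + f' i ?z (f j ?w - f j ?z)"
        by (simp add: linear_diff[OF lin] DFF_G' A_G' A_Fu linear_diff[OF C2(2)])
      have "norm (?A (DFF S Fc DF v i j - DFF S Fc DF u i j)) \<le> C2 * ?n * norm (f j ?w) + C2 * norm (f j ?w - f j ?z)"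
        unfolding eq
        by (rule norm_triangle_mono[OF C2(5)[OF z w] C2(4)[OF z]])
      also have "\<dots> \<le> C2 * ?n * C2 + C2 * ((C2 * (2 * \<bar>M * R\<bar>) + C2) * ?n)"
        using C2(1) by (intro add_mono mult_left_mono C2(3) w df) auto
      also have "\<dots> = (C2 * C2 + C2 * (C2 * (2 * \<bar>M * R\<bar>) + C2)) * ?n"
        by (simp add: algebra_simps)
      also have "\<dots> \<le> C * ?n" using C(5) by (intro mult_right_mono) auto
      finally show ?thesis by (simp add: wz)
    qed
  qed
qed

section \<open>The germ of the rough integral and its defect\<close>

definition rough_germ ::
  "(real \<Rightarrow> real \<Rightarrow> real ^ 'd) \<Rightarrow> (real \<Rightarrow> real \<Rightarrow> real ^ 'd ^ 'd) \<Rightarrow> ('h \<Rightarrow> 'h ^ 'd) \<Rightarrow> ('h \<Rightarrow> 'h \<Rightarrow> 'h ^ 'd) \<Rightarrow>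
    (real \<Rightarrow> 'h) \<Rightarrow> real \<Rightarrow> real \<Rightarrow> 'h" where
  "rough_germ X XX Fc DF u q r = (\<Sum>i\<in>UNIV. X q r $ i *\<^sub>R Fu S Fc (u r) $ i)
     + (\<Sum>i\<in>UNIV. \<Sum>j\<in>UNIV. XX q r $ i $ j *\<^sub>R DFF S Fc DF (u r) i j)"

text \<open>The tensor term of Chen's relation meets \<open>DF(u_r) F(u_r)\<close> and completes the
  increment of \<open>F(u)\<close> to its controlled remainder, which is of higher order.\<close>

lemma rough_germ_defect:
  fixes X :: "real \<Rightarrow> real \<Rightarrow> real ^ 'd"
  assumes "chen T X XX" "r \<in> {0..T}" "m \<in> {0..T}" "q \<in> {0..T}"
  shows "rough_germ X XX Fc DF u q r - rough_germ X XX Fc DF u q m - rough_germ X XX Fc DF u m r =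
    - (\<Sum>i\<in>UNIV. X q m $ i *\<^sub>R (Fu S Fc (u m) $ i - Fu S Fc (u r) $ i
          - (\<Sum>j\<in>UNIV. X m r $ j *\<^sub>R DFF S Fc DF (u r) i j)))
    - (\<Sum>i\<in>UNIV. \<Sum>j\<in>UNIV. XX q m $ i $ j *\<^sub>R (DFF S Fc DF (u m) i j - DFF S Fc DF (u r) i j))"
proof -
  have X: "X q r = X q m + X m r" and "XX q r - XX q m - XX m r = tensor (X q m) (X m r)"
    using assms unfolding chen_def by blast+
  then have XX: "XX q r $ i $ j = XX q m $ i $ j + XX m r $ i $ j + X q m $ i * X m r $ j" for i j
    by (simp add: tensor_def vec_eq_iff algebra_simps)
  show ?thesis
    by (simp add: rough_germ_def X XX scaleR_add_left scaleR_diff_right sum.distrib sum_subtractf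
        scaleR_sum_right)
qed

lemma norm_sum_scaleR_le:
  fixes c :: "'d::finite \<Rightarrow> real" and v :: "'d \<Rightarrow> 'b::real_normed_vector"
  assumes "\<And>i. \<bar>c i\<bar> \<le> A" "\<And>i. norm (v i) \<le> B"
  shows "norm (\<Sum>i\<in>UNIV. c i *\<^sub>R v i) \<le> real CARD('d) * (A * B)"
proof -
  have "norm (\<Sum>i\<in>UNIV. c i *\<^sub>R v i) \<le> (\<Sum>i\<in>(UNIV::'d set). A * B)"
  proof (rule sum_norm_le)
    show "norm (c i *\<^sub>R v i) \<le> A * B" for i
      using assms[of i] order_trans[OF abs_ge_zero assms(1)] by (auto intro: mult_mono)
  qed
  then show ?thesis by simp
qed

text \<open>The controlled bounds compare \<open>u_t\<close> with \<open>S_{t-s} u_s\<close>,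
  whereas Taylor's formula uses plain increments. Replacing \<open>S_{t-s}\<close> by the identity
  costs order \<open>\<theta>\<close> in \<open>H_{-2\<gamma>}\<close>, so the remainder has order
  \<open>\<theta>\<close> instead of \<open>2 \<gamma>\<close>.\<close>

lemma rough_germ_estimates:
  fixes X :: "real \<Rightarrow> real \<Rightarrow> real ^ 'd" and Fc :: "'h \<Rightarrow> 'h ^ 'd"
  assumes rough: "rough_path T \<gamma> X XX" and T: "T > 0" and \<gamma>: "1 / 3 < \<gamma>" "\<gamma> \<le> 1 / 2"
    and F: "C2_class S (- 2 * \<gamma>) 0 Fc DF"
    and ctrl: "controlled S T \<gamma> X u (\<lambda>t. Fu S Fc (u t))"
  obtains C where "C \<ge> 0"
    "\<And>t. 0 \<le> t \<Longrightarrow> t \<le> T \<Longrightarrow> norm (u t) \<le> C"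
    "\<And>s t. 0 \<le> s \<Longrightarrow> s \<le> t \<Longrightarrow> t \<le> T \<Longrightarrow> norm (fracA S (2 * \<gamma>) (u t - S (t - s) (u s))) \<le> C * (t - s) powr \<gamma>"
    "\<And>r q. 0 \<le> r \<Longrightarrow> r \<le> q \<Longrightarrow> q \<le> T \<Longrightarrow> norm (rough_germ X XX Fc DF u q r) \<le> C * (q - r) powr \<gamma>"
    "\<And>r m q. 0 \<le> r \<Longrightarrow> r \<le> m \<Longrightarrow> m \<le> q \<Longrightarrow> q \<le> T \<Longrightarrow>
      norm (fracA S (2 * \<gamma>) (rough_germ X XX Fc DF u q r - rough_germ X XX Fc DF u q m - rough_germ X XX Fc DF u m r))
        \<le> C * (q - r) powr ((1 + 3 * \<gamma>) / 2)"
proof -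
  let ?A = "fracA S (2 * \<gamma>)" and ?\<Xi> = "rough_germ X XX Fc DF u"
  have g0: "0 < \<gamma>" using \<gamma> by simp
  have lin: "linear ?A" using g0 by (intro linear_fracA) auto
  \<comment> \<open>The midpoint of \<open>1 - \<gamma>\<close> and \<open>2 \<gamma>\<close>: the
    order must stay below \<open>2 \<gamma>\<close> for \<open>S - 1\<close>, and sewing asks for
    \<open>\<gamma> + \<theta> > 1\<close>. Both are possible because
    \<open>\<gamma> > 1/3\<close>.\<close>
  define \<theta> where "\<theta> = (1 + \<gamma>) / 2"
  have \<theta>: "0 \<le> \<theta>" "\<theta> \<le> 1" "\<theta> < 2 * \<gamma>" "\<gamma> \<le> \<theta>" using \<gamma> by (auto simp: \<theta>_def)
  obtain Cu where Cu0: "\<And>t. t \<in> {0..T} \<Longrightarrow> norm (u t) \<le> Cu"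
    using ctrl unfolding controlled_def by blast
  have Cu: "norm (u t) \<le> Cu" if "0 \<le> t" "t \<le> T" for t using Cu0 that by simp
  have Cu_pos: "Cu \<ge> 0" using Cu[of 0] T norm_ge_zero[of "u 0"] by linarith
  obtain Cc0 where Cc0: "\<And>s t. 0 \<le> s \<Longrightarrow> s \<le> t \<Longrightarrow> t \<le> T \<Longrightarrow>
        nneg S (2 * \<gamma>) (u t - S (t - s) (u s)) \<le> Cc0 * (t - s) powr \<gamma> \<and>
        nneg S (2 * \<gamma>) (u t - S (t - s) (u s) - S (t - s) (\<Sum>i\<in>UNIV. X t s $ i *\<^sub>R Fu S Fc (u s) $ i))
          \<le> Cc0 * (t - s) powr (2 * \<gamma>)"
    using ctrl unfolding controlled_def by blast
  define Cc where "Cc = max Cc0 0"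
  have Cc: "Cc \<ge> 0"
    "\<And>s t. 0 \<le> s \<Longrightarrow> s \<le> t \<Longrightarrow> t \<le> T \<Longrightarrow> norm (?A (u t - S (t - s) (u s))) \<le> Cc * (t - s) powr \<gamma>"
    "\<And>s t. 0 \<le> s \<Longrightarrow> s \<le> t \<Longrightarrow> t \<le> T \<Longrightarrow>
        norm (?A (u t - S (t - s) (u s) - S (t - s) (\<Sum>i\<in>UNIV. X t s $ i *\<^sub>R Fu S Fc (u s) $ i)))
          \<le> Cc * (t - s) powr (2 * \<gamma>)"
  proof -
    show "Cc \<ge> 0" by (simp add: Cc_def)
    have le: "Cc0 * y powr p \<le> Cc * y powr p" for y p by (simp add: Cc_def mult_right_mono)
    fix s t assume st: "0 \<le> s" "s \<le> t" "t \<le> T"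
    show "norm (?A (u t - S (t - s) (u s))) \<le> Cc * (t - s) powr \<gamma>"
      "norm (?A (u t - S (t - s) (u s) - S (t - s) (\<Sum>i\<in>UNIV. X t s $ i *\<^sub>R Fu S Fc (u s) $ i)))
          \<le> Cc * (t - s) powr (2 * \<gamma>)"
      using Cc0[OF st] le order_trans unfolding nneg_def by blast+
  qed
  obtain KX where KX: "KX \<ge> 0" "\<And>t s. t \<in> {0..T} \<Longrightarrow> s \<in> {0..T} \<Longrightarrow> norm (X t s) \<le> KX * \<bar>t - s\<bar> powr \<gamma>"
    "\<And>t s. t \<in> {0..T} \<Longrightarrow> s \<in> {0..T} \<Longrightarrow> norm (XX t s) \<le> KX * \<bar>t - s\<bar> powr (2 * \<gamma>)"
    using rough_path_holder[OF rough T] \<gamma> g0 by auto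
  have X_nth: "\<bar>X t s $ i\<bar> \<le> KX * (t - s) powr \<gamma>" and XX_nth: "\<bar>XX t s $ i $ j\<bar> \<le> KX * (t - s) powr (2 * \<gamma>)"
    if "0 \<le> s" "s \<le> t" "t \<le> T" for t s i j
  proof -
    have ts: "t \<in> {0..T}" "s \<in> {0..T}" "\<bar>t - s\<bar> = t - s" using that by auto
    show "\<bar>X t s $ i\<bar> \<le> KX * (t - s) powr \<gamma>"
      using KX(2)[OF ts(1,2)] component_le_norm_cart[of "X t s" i] ts(3) by simp
    show "\<bar>XX t s $ i $ j\<bar> \<le> KX * (t - s) powr (2 * \<gamma>)"
      using KX(3)[OF ts(1,2)] component_le_norm_cart[of "XX t s $ i" j] Finite_Cartesian_Product.norm_nth_le[of "XX t s" i] ts(3)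
      by simp
  qed
  obtain CF where CF: "CF \<ge> 0"
    "\<And>u i. norm u \<le> Cu \<Longrightarrow> norm (Fu S Fc u $ i) \<le> CF"
    "\<And>u i j. norm u \<le> Cu \<Longrightarrow> norm (DFF S Fc DF u i j) \<le> CF"
    "\<And>u v i c. norm u \<le> Cu \<Longrightarrow> norm v \<le> Cu \<Longrightarrow>
      norm (?A (Fu S Fc v $ i - Fu S Fc u $ i - (\<Sum>j\<in>UNIV. c $ j *\<^sub>R DFF S Fc DF u i j)))
        \<le> CF * ((norm (?A (v - u)))\<^sup>2 + norm (?A (v - u - (\<Sum>j\<in>UNIV. c $ j *\<^sub>R Fu S Fc u $ j))))"
    "\<And>u v i j. norm u \<le> Cu \<Longrightarrow> norm v \<le> Cu \<Longrightarrow>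
      norm (?A (DFF S Fc DF v i j - DFF S Fc DF u i j)) \<le> CF * norm (?A (v - u))"
    using C2_class_estimates[OF F g0 \<gamma>(2), of Cu] by blast
  obtain CS where CS: "CS \<ge> 0" "\<And>x \<tau>. \<tau> \<ge> 0 \<Longrightarrow> norm (?A (S \<tau> x - x)) \<le> CS * \<tau> powr \<theta> * norm x"
    using norm_S_minus_id_fracA[OF \<theta>(1,2,3)] by blast
  define N where "N = real CARD('d)"
  have N: "N \<ge> 0" by (simp add: N_def)
  have pw: "\<tau> powr p \<le> T powr (p - q) * \<tau> powr q" if "0 \<le> \<tau>" "\<tau> \<le> T" "q \<le> p" for \<tau> p q
    using powr_le_powr_mult that by blast
  define K1 where "K1 = Cc + CS * T powr (\<theta> - \<gamma>) * Cu"
  have K1: "K1 \<ge> 0" using Cc(1) CS(1) Cu_pos by (auto simp: K1_def)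
  have inc1: "norm (?A (u t - u s)) \<le> K1 * (t - s) powr \<gamma>" if "0 \<le> s" "s \<le> t" "t \<le> T" for s t
  proof -
    have eq: "?A (u t - u s) = ?A (u t - S (t - s) (u s)) + ?A (S (t - s) (u s) - u s)"
      by (simp add: linear_diff[OF lin])
    have "norm (?A (u t - u s)) \<le> Cc * (t - s) powr \<gamma> + CS * (t - s) powr \<theta> * norm (u s)"
        unfolding eq
      using that by (intro norm_triangle_mono Cc CS) auto
    moreover have "CS * (t - s) powr \<theta> * norm (u s) \<le> CS * (T powr (\<theta> - \<gamma>) * (t - s) powr \<gamma>) * Cu"
      using that \<theta> CS(1) by (intro mult_mono mult_left_mono pw Cu) auto
    ultimately show ?thesis by (simp add: K1_def algebra_simps)
  qed
  let ?y = "\<lambda>t s. \<Sum>i\<in>UNIV. X t s $ i *\<^sub>R Fu S Fc (u s) $ i"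
  have ybound: "norm (?y t s) \<le> N * (KX * (t - s) powr \<gamma> * CF)" if "0 \<le> s" "s \<le> t" "t \<le> T" for s t
    unfolding N_def by (rule norm_sum_scaleR_le[OF X_nth[OF that] CF(2)]) (use that Cu in auto)
  define K2 where "K2 = Cc * T powr (2 * \<gamma> - \<theta>) + CS * Cu + CS * (N * (KX * T powr \<gamma> * CF))"
  have K2: "K2 \<ge> 0" using Cc(1) CS(1) Cu_pos N KX(1) CF(1) by (auto simp: K2_def)
  have inc2: "norm (?A (u t - u s - ?y t s)) \<le> K2 * (t - s) powr \<theta>" if "0 \<le> s" "s \<le> t" "t \<le> T" for s t
  proof -
    have yT: "norm (?y t s) \<le> N * (KX * T powr \<gamma> * CF)"
    proof -
      have "N * (KX * (t - s) powr \<gamma> * CF) \<le> N * (KX * T powr \<gamma> * CF)"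
        using that N KX(1) CF(1) g0 by (intro mult_left_mono mult_right_mono powr_mono2) auto
      then show ?thesis using ybound[OF that] by linarith
    qed
    have "u t - u s - ?y t s = (u t - S (t - s) (u s) - S (t - s) (?y t s)) + (S (t - s) (u s) - u s)
        + (S (t - s) (?y t s) - ?y t s)" by simp
    then have eq: "?A (u t - u s - ?y t s) = ?A (u t - S (t - s) (u s) - S (t - s) (?y t s)) + ?A (S (t - s) (u s) - u s)
        + ?A (S (t - s) (?y t s) - ?y t s)" by (simp only: linear_add[OF lin])
    have "norm (?A (u t - u s - ?y t s)) \<le> Cc * (t - s) powr (2 * \<gamma>) + CS * (t - s) powr \<theta> * norm (u s) + CS * (t - s) powr \<theta> * norm (?y t s)"
        unfolding eq
      using that by (intro norm_triangle_mono Cc CS) auto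
    also have "\<dots> \<le> Cc * (T powr (2 * \<gamma> - \<theta>) * (t - s) powr \<theta>) + CS * (t - s) powr \<theta> * Cu
        + CS * (t - s) powr \<theta> * (N * (KX * T powr \<gamma> * CF))"
      using that \<theta> CS(1) Cc(1) by (intro add_mono mult_left_mono pw Cu yT) auto
    finally show ?thesis by (simp add: K2_def algebra_simps)
  qed
  define \<kappa> where "\<kappa> = (1 + 3 * \<gamma>) / 2"
  have \<kappa>: "\<kappa> = \<gamma> + \<theta>" "\<kappa> \<le> 3 * \<gamma>" using \<gamma> by (auto simp: \<kappa>_def \<theta>_def field_simps)
  define C3 where "C3 = N * (KX * CF) + N * (N * (KX * T powr \<gamma> * CF))"
  define C4 where "C4 = N * (KX * (CF * (K1\<^sup>2 * T powr (2 * \<gamma> - \<theta>) + K2))) + N * (N * (KX * (CF * (K1 * T powr (3 * \<gamma> - \<kappa>)))))"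
  have C34: "C3 \<ge> 0" "C4 \<ge> 0" using N KX(1) CF(1) K1 K2 by (auto simp: C3_def C4_def)
  have germ_bound: "norm (?\<Xi> q r) \<le> C3 * (q - r) powr \<gamma>" if rq: "0 \<le> r" "r \<le> q" "q \<le> T" for r q
  proof -
    have ur: "norm (u r) \<le> Cu" using Cu rq by auto
    have "norm (\<Sum>i\<in>UNIV. 1 *\<^sub>R (\<Sum>j\<in>UNIV. XX q r $ i $ j *\<^sub>R DFF S Fc DF (u r) i j))
        \<le> real CARD('d) * (1 * (real CARD('d) * (KX * (q - r) powr (2 * \<gamma>) * CF)))"
      by (rule norm_sum_scaleR_le[OF _ norm_sum_scaleR_le[OF XX_nth[OF rq] CF(3)[OF ur]]]) simp
    then have "norm (?\<Xi> q r) \<le> N * (KX * (q - r) powr \<gamma> * CF) + N * (N * (KX * (q - r) powr (2 * \<gamma>) * CF))"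
      unfolding rough_germ_def N_def[symmetric] using norm_triangle_mono[OF ybound[OF rq]] by simp
    also have "\<dots> \<le> N * (KX * (q - r) powr \<gamma> * CF) + N * (N * (KX * (T powr (2 * \<gamma> - \<gamma>) * (q - r) powr \<gamma>) * CF))"
      using N KX(1) CF(1) rq g0 by (intro add_left_mono mult_left_mono mult_right_mono pw) auto
    also have "\<dots> = C3 * (q - r) powr \<gamma>" by (simp add: C3_def algebra_simps)
    finally show ?thesis .
  qed
  \<comment> \<open>\<open>X\<close> times the remainder of \<open>F(u)\<close> has order
    \<open>\<gamma> + \<theta> = \<kappa>\<close>, and \<open>XX\<close> times the increment of
    \<open>DFF\<close> has order \<open>3 \<gamma> \<ge> \<kappa>\<close>.\<close>
  have defect: "norm (?A (?\<Xi> q r - ?\<Xi> q m - ?\<Xi> m r)) \<le> C4 * (q - r) powr \<kappa>"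
    if rmq: "0 \<le> r" "r \<le> m" "m \<le> q" "q \<le> T" for r m q
  proof -
    have mq: "0 \<le> m" "m \<le> q" "q \<le> T" and rm: "0 \<le> r" "r \<le> m" "m \<le> T" using rmq by auto
    have ur: "norm (u r) \<le> Cu" "norm (u m) \<le> Cu" using Cu rmq by auto
    define \<tau> where "\<tau> = q - r"
    have \<tau>: "0 \<le> \<tau>" "\<tau> \<le> T" using rmq by (auto simp: \<tau>_def)
    have mono1: "(q - m) powr p \<le> \<tau> powr p" "(m - r) powr p \<le> \<tau> powr p" if "p \<ge> 0" for p
      using rmq that by (auto simp: \<tau>_def intro!: powr_mono2)
    let ?E = "\<lambda>i. Fu S Fc (u m) $ i - Fu S Fc (u r) $ i - (\<Sum>j\<in>UNIV. X m r $ j *\<^sub>R DFF S Fc DF (u r) i j)"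
    let ?G = "\<lambda>i j. DFF S Fc DF (u m) i j - DFF S Fc DF (u r) i j"
    have X\<tau>: "\<bar>X q m $ i\<bar> \<le> KX * \<tau> powr \<gamma>" for i
      using X_nth[OF mq] mult_left_mono[OF mono1(1)[of \<gamma>] KX(1)] g0 by (meson order_trans less_imp_le)
    have XX\<tau>: "\<bar>XX q m $ i $ j\<bar> \<le> KX * \<tau> powr (2 * \<gamma>)" for i j
      using XX_nth[OF mq, of i j] mult_left_mono[OF mono1(1)[of "2 * \<gamma>"] KX(1)] g0 by linarith
    have i1: "norm (?A (u m - u r)) \<le> K1 * \<tau> powr \<gamma>"
      using inc1[OF rm] mult_left_mono[OF mono1(2)[of \<gamma>] K1] g0 by linarith
    have i2: "norm (?A (u m - u r - ?y m r)) \<le> K2 * \<tau> powr \<theta>"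
      using inc2[OF rm] mult_left_mono[OF mono1(2)[of \<theta>] K2] \<theta> by linarith
    have E: "norm (?A (?E i)) \<le> CF * ((K1\<^sup>2 * T powr (2 * \<gamma> - \<theta>) + K2) * \<tau> powr \<theta>)" for i
    proof -
      have "(norm (?A (u m - u r)))\<^sup>2 \<le> (K1 * \<tau> powr \<gamma>)\<^sup>2"
        by (intro power_mono i1) auto
      also have "\<dots> = K1\<^sup>2 * \<tau> powr (2 * \<gamma>)"
        by (simp add: power_mult_distrib power2_eq_square powr_add[symmetric])
      also have "\<dots> \<le> K1\<^sup>2 * (T powr (2 * \<gamma> - \<theta>) * \<tau> powr \<theta>)"
        using \<tau> \<theta> by (intro mult_left_mono pw) auto
      finally have "(norm (?A (u m - u r)))\<^sup>2 + norm (?A (u m - u r - ?y m r))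
          \<le> (K1\<^sup>2 * T powr (2 * \<gamma> - \<theta>) + K2) * \<tau> powr \<theta>"
        using i2 by (simp add: algebra_simps)
      from mult_left_mono[OF this CF(1)] CF(4)[OF ur, of i "X m r"] show ?thesis by linarith
    qed
    have G: "norm (?A (?G i j)) \<le> CF * (K1 * \<tau> powr \<gamma>)" for i j
      using CF(5)[OF ur, of i j] mult_left_mono[OF i1 CF(1)] by linarith
    have eq: "?A (?\<Xi> q r - ?\<Xi> q m - ?\<Xi> m r) =
      - (\<Sum>i\<in>UNIV. X q m $ i *\<^sub>R ?A (?E i))
      - (\<Sum>i\<in>UNIV. 1 *\<^sub>R (\<Sum>j\<in>UNIV. XX q m $ i $ j *\<^sub>R ?A (?G i j)))"
      by (subst rough_germ_defect[OF rough_path_chen[OF rough T]])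
         (use rmq in \<open>simp_all add: linear_diff[OF lin] linear_neg[OF lin] linear_sum[OF lin] linear_scale[OF lin]\<close>)
    have "norm (?A (?\<Xi> q r - ?\<Xi> q m - ?\<Xi> m r)) \<le> N * (KX * \<tau> powr \<gamma> * (CF * ((K1\<^sup>2 * T powr (2 * \<gamma> - \<theta>) + K2) * \<tau> powr \<theta>)))
        + N * (1 * (N * (KX * \<tau> powr (2 * \<gamma>) * (CF * (K1 * \<tau> powr \<gamma>)))))"
        unfolding eq
      unfolding N_def
      by (intro norm_triangle_le_diff norm_sum_scaleR_le X\<tau> XX\<tau> E G) (simp_all, intro norm_sum_scaleR_le X\<tau> E)
    also have "\<dots> = N * (KX * (CF * (K1\<^sup>2 * T powr (2 * \<gamma> - \<theta>) + K2))) * \<tau> powr \<kappa>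
        + N * (N * (KX * (CF * K1))) * \<tau> powr (3 * \<gamma>)"
    proof -
      have p: "\<tau> powr \<kappa> = \<tau> powr \<gamma> * \<tau> powr \<theta>" "\<tau> powr (3 * \<gamma>) = \<tau> powr (2 * \<gamma>) * \<tau> powr \<gamma>"
        by (simp_all add: \<kappa>(1) powr_add[symmetric])
      show ?thesis unfolding p by (simp add: mult_ac)
    qed
    also have "\<dots> \<le> N * (KX * (CF * (K1\<^sup>2 * T powr (2 * \<gamma> - \<theta>) + K2))) * \<tau> powr \<kappa>
        + N * (N * (KX * (CF * K1))) * (T powr (3 * \<gamma> - \<kappa>) * \<tau> powr \<kappa>)"
      using \<tau> \<kappa> N KX(1) CF(1) K1 by (intro add_left_mono mult_left_mono pw) auto
    also have "\<dots> = C4 * \<tau> powr \<kappa>" by (simp add: C4_def algebra_simps)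
    finally show ?thesis by (simp add: \<tau>_def)
  qed
  define C where "C = Cu + Cc + C3 + C4"
  have C: "C \<ge> 0" "Cu \<le> C" "Cc \<le> C" "C3 \<le> C" "C4 \<le> C"
    using Cu_pos Cc(1) C34 by (auto simp: C_def)
  show thesis
  proof (rule that[OF C(1)])
    show "norm (u t) \<le> C" if "0 \<le> t" "t \<le> T" for t
      using Cu[OF that] C(2) by linarith
    show "norm (?A (u t - S (t - s) (u s))) \<le> C * (t - s) powr \<gamma>" if "0 \<le> s" "s \<le> t" "t \<le> T" for s t
      using Cc(2)[OF that] mult_right_mono[OF C(3), of "(t - s) powr \<gamma>"] by simp
    show "norm (?\<Xi> q r) \<le> C * (q - r) powr \<gamma>" if "0 \<le> r" "r \<le> q" "q \<le> T" for r q
      using germ_bound[OF that] mult_right_mono[OF C(4), of "(q - r) powr \<gamma>"] by simp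
    show "norm (?A (?\<Xi> q r - ?\<Xi> q m - ?\<Xi> m r)) \<le> C * (q - r) powr ((1 + 3 * \<gamma>) / 2)"
      if "0 \<le> r" "r \<le> m" "m \<le> q" "q \<le> T" for r m q
      using defect[OF that] mult_right_mono[OF C(5), of "(q - r) powr \<kappa>"] by (simp add: \<kappa>_def)
  qed
qed

end

section \<open>Mild and weak equations\<close>

lemma abs_integral_le_const:
  fixes f :: "real \<Rightarrow> real"
  assumes "f integrable_on {p..q}" "p \<le> q" "\<And>x. x \<in> {p..q} \<Longrightarrow> \<bar>f x\<bar> \<le> B"
  shows "\<bar>integral {p..q} f\<bar> \<le> B * (q - p)"
proof -
  have "norm (integral {p..q} f) \<le> integral {p..q} (\<lambda>_. B)"
    by (rule integral_norm_bound_integral) (use assms in auto)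
  then show ?thesis using assms(2) by (simp add: mult.commute)
qed

text \<open>\<open>K\<close> may depend on \<open>e\<close>: approximating \<open>L h\<close> by
  some \<open>k\<close> in \<open>D\<close> leaves an error \<open>e (q - r)\<close>, at the price
  of a constant that grows with \<open>|L k|\<close>.\<close>

lemma additive_approx_of_eps_powr:
  assumes \<kappa>: "\<kappa> > 1"
    and "\<And>e. e > 0 \<Longrightarrow> \<exists>K\<ge>0. \<forall>r q. a \<le> r \<longrightarrow> r < q \<longrightarrow> q \<le> b \<longrightarrow> norm (A q - A r - g q r) \<le> e * (q - r) + K * (q - r) powr \<kappa>"
  shows "additive_approx a b A g"
  unfolding additive_approx_def
proof (intro allI impI)
  fix e :: real assume "e > 0"
  then obtain K where K: "K \<ge> 0" "\<And>r q. a \<le> r \<Longrightarrow> r < q \<Longrightarrow> q \<le> b \<Longrightarrow>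
      norm (A q - A r - g q r) \<le> e / 2 * (q - r) + K * (q - r) powr \<kappa>"
    using assms(2)[of "e / 2"] by auto
  have "additive_approx a b (\<lambda>_. 0 :: real) (\<lambda>q r. K * (q - r) powr \<kappa>)"
    by (rule additive_approx_of_powr[OF \<kappa> K(1)]) (use K(1) in auto)
  then obtain \<eta> where \<eta>: "\<eta> > 0" "\<And>r q. a \<le> r \<Longrightarrow> r < q \<Longrightarrow> q \<le> b \<Longrightarrow> q - r < \<eta> \<Longrightarrow>
      norm (0 - 0 - K * (q - r) powr \<kappa>) \<le> e / 2 * (q - r)"
    unfolding additive_approx_def using \<open>e > 0\<close> by (metis half_gt_zero)
  have "norm (A q - A r - g q r) \<le> e * (q - r)" if "a \<le> r" "r < q" "q \<le> b" "q - r < \<eta>" for r q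
    using K(2)[OF that(1-3)] \<eta>(2)[OF that] K(1) by simp
  with \<eta>(1) show "\<exists>\<eta>>0. \<forall>r q. a \<le> r \<longrightarrow> r < q \<longrightarrow> q \<le> b \<longrightarrow> q - r < \<eta> \<longrightarrow>
     norm (A q - A r - g q r) \<le> e * (q - r)" by blast
qed

lemma integrable_powr_at_end:
  fixes t p :: real
  assumes "0 \<le> t" "p > -1"
  shows "(\<lambda>r. (t - r) powr p) integrable_on {0..t}"
proof -
  have "((\<lambda>r. (t - r) powr p) has_integral (- ((t - t) powr (p + 1) / (p + 1)) - - ((t - 0) powr (p + 1) / (p + 1)))) {0..t}"
  proof (rule fundamental_theorem_of_calculus_interior[OF assms(1), where f = "\<lambda>r. - ((t - r) powr (p + 1) / (p + 1))"])
    show "continuous_on {0..t} (\<lambda>r. - ((t - r) powr (p + 1) / (p + 1)))"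
      using assms by (intro continuous_intros continuous_on_powr') auto
    show "((\<lambda>r. - ((t - r) powr (p + 1) / (p + 1))) has_vector_derivative (t - r) powr p) (at r)" if "r \<in> {0<..<t}" for r
      using that assms
      by (auto intro!: derivative_eq_intros simp flip: has_real_derivative_iff_has_vector_derivative)
  qed
  then show ?thesis by blast
qed

context selfadjoint_semigroup
begin

lemma fracA_D:
  assumes "a \<ge> 0" "x \<in> D"
  shows "fracA S a x \<in> D" "L (fracA S a x) = fracA S a (L x)"
proof -
  have "fracA S a x = fracA S a (fracA S 1 (- L x))"
    using assms(2) by (simp add: fracA_minus fracA_1_L)
  also have "\<dots> = fracA S 1 (- fracA S a (L x))"
    using assms(1) by (simp add: fracA_fracA add.commute fracA_minus)
  finally have eq: "fracA S a x = fracA S 1 (- fracA S a (L x))" .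
  show "fracA S a x \<in> D" "L (fracA S a x) = fracA S a (L x)"
    unfolding eq by (simp_all add: fracA_1)
qed

lemma S_tendsto_id: "((\<lambda>s. S s x) \<longlongrightarrow> x) (at_right 0)"
proof -
  have "((\<lambda>s. S s x) \<longlongrightarrow> S 0 x) (at 0 within {0..})"
    using continuous_on_S[of x] unfolding continuous_on_def by (rule bspec) simp
  then show ?thesis by (simp add: at_within_Ici_at_right)
qed

lemma S_minus_id_small:
  assumes "e > 0"
  obtains d where "d > 0" "\<And>\<sigma>. 0 \<le> \<sigma> \<Longrightarrow> \<sigma> < d \<Longrightarrow> norm (S \<sigma> x - x) \<le> e"
proof -
  have "\<forall>\<^sub>F s in at_right 0. dist (S s x) x < e"
    using tendstoD[OF S_tendsto_id assms] .
  then obtain d where d: "d > 0" "\<And>s. s > 0 \<Longrightarrow> s < d \<Longrightarrow> dist (S s x) x < e"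
    by (auto simp: eventually_at_right_field)
  show thesis
  proof (rule that[OF d(1)])
    fix \<sigma> :: real assume "0 \<le> \<sigma>" "\<sigma> < d"
    then show "norm (S \<sigma> x - x) \<le> e"
      using d(2)[of \<sigma>] assms by (cases "\<sigma> = 0") (auto simp: dist_norm)
  qed
qed

text \<open>Contraction makes strong continuity joint: \<open>S\<close> does not amplify a change of
  its argument.\<close>

lemma continuous_on_S_compose:
  assumes "continuous_on A f" "continuous_on A g" "\<And>r. r \<in> A \<Longrightarrow> 0 \<le> f r"
  shows "continuous_on A (\<lambda>r. S (f r) (g r))"
  unfolding continuous_on_def
proof
  fix r assume r: "r \<in> A"
  have "((\<lambda>s. S (f s) (g r) - S (f r) (g r)) \<longlongrightarrow> 0) (at r within A)"
  proof -
    have "continuous_on A (\<lambda>s. S (f s) (g r))"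
      by (rule continuous_on_compose2[OF continuous_on_S assms(1)]) (use assms(3) in auto)
    then show ?thesis using r by (auto simp: continuous_on_def intro: LIM_zero)
  qed
  moreover have "((\<lambda>s. S (f s) (g s - g r)) \<longlongrightarrow> 0) (at r within A)"
  proof (rule Lim_null_comparison)
    show "\<forall>\<^sub>F s in at r within A. norm (S (f s) (g s - g r)) \<le> norm (g s - g r)"
      using assms(3) by (auto simp: eventually_at_filter intro!: always_eventually norm_S_le)
    show "((\<lambda>s. norm (g s - g r)) \<longlongrightarrow> 0) (at r within A)"
      using assms(2) r by (auto simp: continuous_on_def intro!: tendsto_norm_zero LIM_zero)
  qed
  ultimately have "((\<lambda>s. (S (f s) (g r) - S (f r) (g r)) + S (f s) (g s - g r)) \<longlongrightarrow> 0 + 0) (at r within A)"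
    by (rule tendsto_add)
  then have lim: "((\<lambda>s. (S (f s) (g r) - S (f r) (g r)) + S (f s) (g s - g r)) \<longlongrightarrow> 0) (at r within A)"
    by simp
  have "((\<lambda>s. S (f s) (g s) - S (f r) (g r)) \<longlongrightarrow> 0) (at r within A)"
    by (rule Lim_transform_eventually[OF lim])
       (use assms(3) in \<open>auto simp: eventually_at_filter S_diff intro!: always_eventually\<close>)
  then show "((\<lambda>s. S (f s) (g s)) \<longlongrightarrow> S (f r) (g r)) (at r within A)"
    by (rule LIM_zero_cancel)
qed

text \<open>The domain of \<open>L^2\<close>: for such test vectors \<open>L h\<close> lies again in
  \<open>D\<close>, so the comparison of the two equations has a rate.\<close>

definition D2 :: "'h set" where
  "D2 = {x \<in> D. L x \<in> D}"

lemma S_in_D2: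
  assumes "s > 0"
  shows "S s x \<in> D2"
proof -
  have "L (S s x) = S (s / 2) (L (S (s / 2) x))"
    using L_S[of "s / 2" "s / 2" x] assms by simp
  then show ?thesis using S_in_D(1) assms by (simp add: D2_def)
qed

lemma D2_S: "h \<in> D2 \<Longrightarrow> s \<ge> 0 \<Longrightarrow> S s h \<in> D2"
  by (simp add: D2_def S_D)

lemma D2_fracA: "a \<ge> 0 \<Longrightarrow> h \<in> D2 \<Longrightarrow> fracA S a h \<in> D2"
  by (simp add: D2_def fracA_D)

lemma norm_le_of_inner_le_D2:
  assumes "\<And>y. y \<in> D2 \<Longrightarrow> \<bar>inner x y\<bar> \<le> C * norm y" "0 \<le> C"
  shows "norm x \<le> C"
proof (rule norm_le_of_inner_le[OF _ assms(2)])
  fix y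
  have "\<forall>\<^sub>F s in at_right 0. inner x (S s y) \<le> C * norm (S s y)"
  proof (rule eventually_at_right_less[THEN eventually_mono])
    fix s :: real assume "0 < s"
    then show "inner x (S s y) \<le> C * norm (S s y)"
      using assms(1)[OF S_in_D2, of s y] by linarith
  qed
  moreover have "((\<lambda>s. inner x (S s y)) \<longlongrightarrow> inner x y) (at_right 0)"
    "((\<lambda>s. C * norm (S s y)) \<longlongrightarrow> C * norm y) (at_right 0)"
    by (intro tendsto_intros S_tendsto_id)+
  ultimately show "inner x y \<le> C * norm y"
    using tendsto_le[OF trivial_limit_at_right_real] by blast
qed

end

text \<open>The data that the equivalence rests on: \<open>z\<close> is
  \<open>(-L)^(-1) N(u)\<close> and \<open>y\<close> is \<open>(-L)^(-\<delta>) N(u)\<close>, so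
  that \<open>b = 1 - \<delta>\<close>. From \<open>1 - \<delta> > \<gamma>\<close> the bound
  \<open>b > 1/3\<close> is retained; it admits the order \<open>q = 1/3\<close> in
  \<open>norm_LS_fracA\<close>. Continuity of \<open>y\<close> is conditional because strong
  continuity of \<open>u\<close> is itself to be derived from the weak equation.\<close>

locale mild_weak_setting = selfadjoint_semigroup L D S
  for L :: "'h::{real_inner, complete_space} \<Rightarrow> 'h" and D S +
  fixes \<gamma> T C a b :: real and u z y :: "real \<Rightarrow> 'h" and \<Xi> :: "real \<Rightarrow> real \<Rightarrow> 'h"
  assumes \<gamma>: "1 / 3 < \<gamma>" "\<gamma> \<le> 1 / 2" and T: "T > 0" and C: "C \<ge> 0"
    and a: "a = 2 * \<gamma>" and b: "b > 1 / 3"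
    and u_bound: "\<And>t. 0 \<le> t \<Longrightarrow> t \<le> T \<Longrightarrow> norm (u t) \<le> C"
    and u_increment: "\<And>s t. 0 \<le> s \<Longrightarrow> s \<le> t \<Longrightarrow> t \<le> T \<Longrightarrow>
      norm (fracA S a (u t - S (t - s) (u s))) \<le> C * (t - s) powr \<gamma>"
    and \<Xi>_bound: "\<And>r q. 0 \<le> r \<Longrightarrow> r \<le> q \<Longrightarrow> q \<le> T \<Longrightarrow> norm (\<Xi> q r) \<le> C * (q - r) powr \<gamma>"
    and \<Xi>_defect: "\<And>r m q. 0 \<le> r \<Longrightarrow> r \<le> m \<Longrightarrow> m \<le> q \<Longrightarrow> q \<le> T \<Longrightarrow>
      norm (fracA S a (\<Xi> q r - \<Xi> q m - \<Xi> m r)) \<le> C * (q - r) powr ((1 + 3 * \<gamma>) / 2)"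
    and z_eq: "\<And>r. 0 \<le> r \<Longrightarrow> r \<le> T \<Longrightarrow> z r = fracA S b (y r)"
    and y_bound: "\<And>r. 0 \<le> r \<Longrightarrow> r \<le> T \<Longrightarrow> norm (y r) \<le> C"
    and y_continuous: "continuous_on {0..T} u \<Longrightarrow> continuous_on {0..T} y"
begin

abbreviation \<kappa> :: real where "\<kappa> \<equiv> (1 + 3 * \<gamma>) / 2"

lemma \<kappa>: "\<kappa> > 1" "\<kappa> \<le> 1 + \<gamma>" "\<kappa> \<le> 2"
  using \<gamma> by auto

lemma a_bounds: "0 < a" "a \<le> 1" using \<gamma> by (auto simp: a)

lemma b_pos: "b > 0" using b by simp

definition M :: real where
  "M = (SOME M. M > 0 \<and> (\<forall>x. norm (fracA S 1 x) \<le> M * norm (fracA S a x)))"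

lemma M: "M > 0" "norm (fracA S 1 x) \<le> M * norm (fracA S a x)"
proof -
  have "\<exists>M. M > 0 \<and> (\<forall>x. norm (fracA S 1 x) \<le> M * norm (fracA S a x))"
    using fracA_1_bound[of a] a_bounds by (metis less_imp_le)
  from someI_ex[OF this] show "M > 0" "norm (fracA S 1 x) \<le> M * norm (fracA S a x)"
    by (auto simp: M_def)
qed

lemma inner_D_le:
  assumes "h \<in> D"
  shows "\<bar>inner x h\<bar> \<le> M * norm (fracA S a x) * norm (L h)"
  using inner_le_fracA_1[OF assms, of x] mult_right_mono[OF M(2)[of x], of "norm (L h)"] by simp

text \<open>\<open>l\<close> is a mere vector of \<open>H\<close>, where the increment is bounded
  but not small; the approximant \<open>k\<close> in \<open>D\<close> can be paired with the small
  \<open>H_{-1}\<close> norm.\<close>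

lemma inner_increment_le:
  assumes st: "0 \<le> s" "s \<le> t" "t \<le> T" and k: "k \<in> D"
  shows "\<bar>inner (u t - S (t - s) (u s)) l\<bar> \<le> 2 * C * norm (l - k) + M * C * (t - s) powr \<gamma> * norm (L k)"
proof -
  let ?J = "u t - S (t - s) (u s)"
  have "norm ?J \<le> C + C"
    using st by (intro norm_triangle_le_diff u_bound order_trans[OF norm_S_le]) auto
  then have 1: "\<bar>inner ?J (l - k)\<bar> \<le> 2 * C * norm (l - k)"
    using Cauchy_Schwarz_ineq2[of ?J "l - k"] mult_right_mono[of "norm ?J" "2 * C" "norm (l - k)"] by simp
  have "M * norm (fracA S a ?J) * norm (L k) \<le> M * (C * (t - s) powr \<gamma>) * norm (L k)"
    using M(1) by (intro mult_right_mono mult_left_mono u_increment st) auto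
  then have 2: "\<bar>inner ?J k\<bar> \<le> M * C * (t - s) powr \<gamma> * norm (L k)"
    using inner_D_le[OF k, of ?J] by (simp add: mult.assoc)
  have "inner ?J l = inner ?J (l - k) + inner ?J k" by (simp add: inner_diff_right)
  then show ?thesis using 1 2 by linarith
qed

text \<open>Boundedness in \<open>H\<close> together with the Hoelder bound in
  \<open>H_{-2\<gamma>}\<close> gives continuity against vectors of \<open>D\<close>, and density
  does the rest. It makes the term with \<open>L h\<close> integrable.\<close>

lemma u_weakly_continuous: "continuous_on {0..T} (\<lambda>s. inner (u s) l)"
  unfolding continuous_on_iff
proof (intro ballI allI impI)
  fix t0 e :: real assume t0: "t0 \<in> {0..T}" and e: "e > 0"
  define e' where "e' = e / (4 * C + 1)"
  have e': "e' > 0" "4 * C * e' < e" using e C by (auto simp: e'_def field_simps)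
  obtain k where k: "k \<in> D" "norm (l - k) < e'"
    using closure_approachable[of l D] closure_D e'(1) by (metis UNIV_I dist_norm norm_minus_commute)
  have step: "\<bar>inner (u t - u s) l\<bar> \<le> 4 * C * e' + (M * C * (t - s) powr \<gamma> + C * (t - s)) * norm (L k)"
    if st: "0 \<le> s" "s \<le> t" "t \<le> T" for s t
  proof -
    have "inner (u t - u s) l = inner (u t - u s) (l - k) + inner (u t - S (t - s) (u s)) k + inner (u s) (S (t - s) k - k)"
      using st by (simp add: inner_diff_left inner_diff_right S_sym)
    moreover have "\<bar>inner (u t - S (t - s) (u s)) k\<bar> \<le> M * C * (t - s) powr \<gamma> * norm (L k)"
      using inner_increment_le[OF st k(1), of k] by simp
    moreover have "\<bar>inner (u t - u s) (l - k)\<bar> \<le> (C + C) * norm (l - k)"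
      using st by (intro order_trans[OF Cauchy_Schwarz_ineq2] mult_right_mono norm_triangle_le_diff u_bound) auto
    moreover have "(C + C) * norm (l - k) \<le> (C + C) * e'" using k C by (intro mult_left_mono) auto
    moreover have "\<bar>inner (u s) (S (t - s) k - k)\<bar> \<le> C * ((t - s) * norm (L k))"
      using st k C by (intro order_trans[OF Cauchy_Schwarz_ineq2] mult_mono u_bound norm_S_minus_id) auto
    moreover have "C * e' \<ge> 0" using C e' by simp
    ultimately show ?thesis by (simp add: algebra_simps)
  qed
  have "((\<lambda>d. 4 * C * e' + (M * C * d powr \<gamma> + C * d) * norm (L k)) \<longlongrightarrow> 4 * C * e' + (M * C * 0 powr \<gamma> + C * 0) * norm (L k)) (at_right 0)"
    using \<gamma> by (intro tendsto_intros tendsto_powr') (auto simp: eventually_at_right_field intro!: exI[of _ 1])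
  then have "\<forall>\<^sub>F d in at_right 0. 4 * C * e' + (M * C * d powr \<gamma> + C * d) * norm (L k) < e"
    using e' \<gamma> by (intro order_tendstoD(2)) auto
  then obtain d where d: "d > 0" "\<And>r. 0 < r \<Longrightarrow> r < d \<Longrightarrow> 4 * C * e' + (M * C * r powr \<gamma> + C * r) * norm (L k) < e"
    by (auto simp: eventually_at_right_field)
  have close: "\<bar>inner (u t - u s) l\<bar> < e" if "0 \<le> s" "s \<le> t" "t \<le> T" "t - s < d" for s t
    using step[OF that(1-3)] d(2)[of "t - s"] that e by (cases "s = t") auto
  show "\<exists>d>0. \<forall>t\<in>{0..T}. dist t t0 < d \<longrightarrow> dist (inner (u t) l) (inner (u t0) l) < e"
  proof (intro exI[of _ d] conjI ballI impI d(1))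
    fix t assume t: "t \<in> {0..T}" "dist t t0 < d"
    show "dist (inner (u t) l) (inner (u t0) l) < e"
      using close[of t0 t] close[of t t0] t t0
      by (cases "t0 \<le> t") (auto simp: dist_real_def inner_diff_left abs_minus_commute)
  qed
qed

lemma u_integrable: "0 \<le> p \<Longrightarrow> q \<le> T \<Longrightarrow> (\<lambda>s. inner (u s) l) integrable_on {p..q}"
  by (intro integrable_continuous_real continuous_on_subset[OF u_weakly_continuous]) auto

text \<open>The exponent is \<open>1/3 - 1\<close>, from the order \<open>1/3 < b\<close>; its
  integrability at 0 makes the drift convolution converge in \<open>H\<close>.\<close>

definition Cz :: real where
  "Cz = (SOME c. c \<ge> 0 \<and> (\<forall>r. 0 \<le> r \<longrightarrow> r \<le> T \<longrightarrow> norm (z r) \<le> c) \<and>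
    (\<forall>r \<sigma>. 0 \<le> r \<longrightarrow> r \<le> T \<longrightarrow> \<sigma> > 0 \<longrightarrow> norm (L (S \<sigma> (z r))) \<le> c * \<sigma> powr (- 2 / 3)))"

lemma
  shows Cz_nonneg: "Cz \<ge> 0"
    and z_bound: "0 \<le> r \<Longrightarrow> r \<le> T \<Longrightarrow> norm (z r) \<le> Cz"
    and LS_z_bound: "0 \<le> r \<Longrightarrow> r \<le> T \<Longrightarrow> \<sigma> > 0 \<Longrightarrow> norm (L (S \<sigma> (z r))) \<le> Cz * \<sigma> powr (- 2 / 3)"
proof -
  obtain M1 where M1: "M1 > 0" "\<And>x. norm (fracA S b x) \<le> M1 * norm x"
    using fracA_bound[of b] b_pos by auto
  obtain M2 where M2: "M2 \<ge> 0" "\<And>x \<sigma>. \<sigma> > 0 \<Longrightarrow> norm (L (S \<sigma> (fracA S b x))) \<le> M2 * \<sigma> powr (1 / 3 - 1) * norm x"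
    using norm_LS_fracA[of "1 / 3" b] b by auto
  define c where "c = max (M1 * C) (M2 * C)"
  have c: "M1 * C \<le> c" "M2 * C \<le> c" "0 \<le> c" using C M1(1) by (auto simp: c_def intro: max.coboundedI1)
  have "norm (z r) \<le> c" if "0 \<le> r" "r \<le> T" for r
  proof -
    have "norm (z r) \<le> M1 * norm (y r)" using M1(2) z_eq[OF that] by simp
    also have "\<dots> \<le> M1 * C" using M1(1) y_bound[OF that] by simp
    finally show ?thesis using c(1) by simp
  qed
  moreover have "norm (L (S \<sigma> (z r))) \<le> c * \<sigma> powr (- 2 / 3)" if "0 \<le> r" "r \<le> T" "\<sigma> > 0" for r \<sigma>
  proof -
    have "norm (L (S \<sigma> (z r))) \<le> M2 * \<sigma> powr (1 / 3 - 1) * norm (y r)"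
      using M2(2)[OF that(3)] z_eq[OF that(1,2)] by simp
    also have "\<dots> \<le> M2 * \<sigma> powr (1 / 3 - 1) * C"
      using M2(1) y_bound[OF that(1,2)] by (intro mult_left_mono) auto
    also have "\<dots> = (M2 * C) * \<sigma> powr (- 2 / 3)" by simp
    also have "\<dots> \<le> c * \<sigma> powr (- 2 / 3)" using c(2) by (intro mult_right_mono) auto
    finally show ?thesis .
  qed
  ultimately have "\<exists>c. c \<ge> 0 \<and> (\<forall>r. 0 \<le> r \<longrightarrow> r \<le> T \<longrightarrow> norm (z r) \<le> c) \<and>
    (\<forall>r \<sigma>. 0 \<le> r \<longrightarrow> r \<le> T \<longrightarrow> \<sigma> > 0 \<longrightarrow> norm (L (S \<sigma> (z r))) \<le> c * \<sigma> powr (- 2 / 3))"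
    using c(3) by blast
  from someI_ex[OF this, folded Cz_def] show "Cz \<ge> 0"
    "0 \<le> r \<Longrightarrow> r \<le> T \<Longrightarrow> norm (z r) \<le> Cz"
    "0 \<le> r \<Longrightarrow> r \<le> T \<Longrightarrow> \<sigma> > 0 \<Longrightarrow> norm (L (S \<sigma> (z r))) \<le> Cz * \<sigma> powr (- 2 / 3)"
    by auto
qed

lemma inner_LS_z:
  assumes "h \<in> D" "\<sigma> > 0"
  shows "inner (- L (S \<sigma> (z r))) h = inner (z r) (S \<sigma> (- L h))"
  using L_sym[OF S_in_D(1)[OF assms(2)] assms(1), of "z r"] assms by (simp add: S_sym S_minus)

section \<open>Weak integrability of the drift\<close>

definition N_integrable :: "'h \<Rightarrow> bool" where
  "N_integrable k \<longleftrightarrow> (\<lambda>r. inner (z r) k) integrable_on {0..T}"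

lemma N_integrable_subinterval:
  "N_integrable k \<Longrightarrow> 0 \<le> p \<Longrightarrow> q \<le> T \<Longrightarrow> (\<lambda>r. inner (z r) k) integrable_on {p..q}"
  unfolding N_integrable_def by (rule integrable_on_subinterval) auto

lemma inner_z_S_close:
  assumes "e > 0"
  obtains d where "d > 0" "\<And>r \<sigma>. 0 \<le> r \<Longrightarrow> r \<le> T \<Longrightarrow> 0 \<le> \<sigma> \<Longrightarrow> \<sigma> < d \<Longrightarrow> \<bar>inner (z r) (S \<sigma> k - k)\<bar> \<le> e"
proof -
  define e' where "e' = e / (Cz + 1)"
  have e': "e' > 0" "Cz * e' \<le> e" using assms Cz_nonneg by (auto simp: e'_def field_simps)
  obtain d where d: "d > 0" "\<And>\<sigma>. 0 \<le> \<sigma> \<Longrightarrow> \<sigma> < d \<Longrightarrow> norm (S \<sigma> k - k) \<le> e'"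
    using S_minus_id_small[OF e'(1), of k] by blast
  show thesis
  proof (rule that[OF d(1)])
    fix r \<sigma> assume *: "0 \<le> r" "r \<le> T" "0 \<le> \<sigma>" "\<sigma> < d"
    have "\<bar>inner (z r) (S \<sigma> k - k)\<bar> \<le> Cz * e'"
      using * Cz_nonneg by (intro order_trans[OF Cauchy_Schwarz_ineq2] mult_mono z_bound d) auto
    then show "\<bar>inner (z r) (S \<sigma> k - k)\<bar> \<le> e" using e'(2) by linarith
  qed
qed

text \<open>On an interval \<open>{p..q}\<close> shorter than \<open>d\<close>, the convolution
  ending at \<open>q\<close> involves \<open>S (q - r) k\<close>, which is uniformly close to
  \<open>k\<close>; it serves as the local approximant.\<close>

lemma N_integrable_of_convolution:
  assumes conv: "\<And>t. 0 \<le> t \<Longrightarrow> t \<le> T \<Longrightarrow> (\<lambda>r. inner (z r) (S (t - r) k)) integrable_on {0..t}"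
  shows "N_integrable k"
  unfolding N_integrable_def
proof (rule integrable_on_Icc_of_local_approx)
  show "0 \<le> T" using T by simp
  fix e :: real assume "e > 0"
  then obtain d where d: "d > 0" "\<And>r \<sigma>. 0 \<le> r \<Longrightarrow> r \<le> T \<Longrightarrow> 0 \<le> \<sigma> \<Longrightarrow> \<sigma> < d \<Longrightarrow> \<bar>inner (z r) (S \<sigma> k - k)\<bar> \<le> e"
    using inner_z_S_close[of e k] by blast
  show "\<exists>d>0. \<forall>p q. 0 \<le> p \<longrightarrow> p \<le> q \<longrightarrow> q \<le> T \<longrightarrow> q - p < d \<longrightarrow>
      (\<exists>g. g integrable_on {p..q} \<and> (\<forall>r\<in>{p..q}. \<bar>inner (z r) k - g r\<bar> \<le> e))"
  proof (intro exI[of _ d] conjI allI impI d(1))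
    fix p q assume *: "0 \<le> p" "p \<le> q" "q \<le> T" "q - p < d"
    have "(\<lambda>r. inner (z r) (S (q - r) k)) integrable_on {p..q}"
      by (rule integrable_on_subinterval[OF conv]) (use * in auto)
    moreover have "\<bar>inner (z r) k - inner (z r) (S (q - r) k)\<bar> \<le> e" if "r \<in> {p..q}" for r
      using d(2)[of r "q - r"] * that by (simp add: inner_diff_right abs_minus_commute)
    ultimately show "\<exists>g. g integrable_on {p..q} \<and> (\<forall>r\<in>{p..q}. \<bar>inner (z r) k - g r\<bar> \<le> e)"
      by blast
  qed
qed

text \<open>The converse freezes the propagator: on a short \<open>{p..q}\<close> the vector
  \<open>S (t - r) k\<close> is close to \<open>S (t - q) k\<close>, which is why all
  \<open>S \<sigma> k\<close> enter the hypothesis.\<close>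

lemma convolution_integrable_of_N:
  assumes N: "\<And>\<sigma>. \<sigma> \<ge> 0 \<Longrightarrow> N_integrable (S \<sigma> k)" and t: "0 \<le> t" "t \<le> T"
  shows "(\<lambda>r. inner (z r) (S (t - r) k)) integrable_on {0..t}"
proof (rule integrable_on_Icc_of_local_approx[OF t(1)])
  fix e :: real assume "e > 0"
  then obtain d where d: "d > 0" "\<And>r \<sigma>. 0 \<le> r \<Longrightarrow> r \<le> T \<Longrightarrow> 0 \<le> \<sigma> \<Longrightarrow> \<sigma> < d \<Longrightarrow> norm (S \<sigma> k - k) \<le> e / (Cz + 1)"
    using S_minus_id_small[of "e / (Cz + 1)" k] Cz_nonneg by (metis add_nonneg_pos divide_pos_pos zero_less_one)
  show "\<exists>d>0. \<forall>p q. 0 \<le> p \<longrightarrow> p \<le> q \<longrightarrow> q \<le> t \<longrightarrow> q - p < d \<longrightarrow>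
      (\<exists>g. g integrable_on {p..q} \<and> (\<forall>r\<in>{p..q}. \<bar>inner (z r) (S (t - r) k) - g r\<bar> \<le> e))"
  proof (intro exI[of _ d] conjI allI impI d(1))
    fix p q assume *: "0 \<le> p" "p \<le> q" "q \<le> t" "q - p < d"
    have "(\<lambda>r. inner (z r) (S (t - q) k)) integrable_on {p..q}"
      by (rule N_integrable_subinterval[OF N]) (use * t in auto)
    moreover have "\<bar>inner (z r) (S (t - r) k) - inner (z r) (S (t - q) k)\<bar> \<le> e" if r: "r \<in> {p..q}" for r
    proof -
      have "norm (S (t - r) k - S (t - q) k) \<le> norm (S (q - r) k - k)"
        using norm_S_diff_commute[of "t - q" "t - r" k] * r by simp
      also have "\<dots> \<le> e / (Cz + 1)" using d(2)[of r "q - r"] * r t by simp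
      finally have n: "norm (S (t - r) k - S (t - q) k) \<le> e / (Cz + 1)" .
      have "\<bar>inner (z r) (S (t - r) k - S (t - q) k)\<bar> \<le> Cz * (e / (Cz + 1))"
        using * r t Cz_nonneg by (intro order_trans[OF Cauchy_Schwarz_ineq2] mult_mono z_bound n) auto
      also have "\<dots> \<le> e" using Cz_nonneg \<open>e > 0\<close> by (simp add: field_simps)
      finally show ?thesis by (simp add: inner_diff_right)
    qed
    ultimately show "\<exists>g. g integrable_on {p..q} \<and> (\<forall>r\<in>{p..q}. \<bar>inner (z r) (S (t - r) k) - g r\<bar> \<le> e)"
      by blast
  qed
qed

text \<open>The error of one step of the mild equation. The drift is paired with \<open>h\<close>
  before integrating, so the expression makes sense before any integral in \<open>H\<close> is known
  to exist.\<close>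

definition mild_defect :: "'h \<Rightarrow> real \<Rightarrow> real \<Rightarrow> real" where
  "mild_defect h p q = inner (u q - S (q - p) (u p) - S (q - p) (\<Xi> q p)) h
     - integral {p..q} (\<lambda>r. inner (z r) (S (q - r) (- L h)))"

definition weak_defect :: "'h \<Rightarrow> real \<Rightarrow> real \<Rightarrow> real" where
  "weak_defect h p q = inner (u q - u p - \<Xi> q p) h
     - integral {p..q} (\<lambda>r. inner (u r) (L h)) - integral {p..q} (\<lambda>r. inner (z r) (- L h))"

text \<open>The difference has three parts: the integral of \<open><u_r - S_{r-p} u_p, L h>\<close>,
  the pairing of the germ with \<open>S_\<tau> h - h\<close>, and the drift against
  \<open>S_{q-r} L h - L h\<close>. With \<open>k\<close> in place of \<open>L h\<close> in the
  integrals their orders are \<open>1 + \<gamma>\<close>, \<open>1 + \<gamma>\<close> and 2, all at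
  least \<open>\<kappa>\<close>; the replacement costs a multiple of
  \<open>|L h - k| (q - p)\<close>.\<close>

lemma mild_weak_defect_close:
  obtains K where "K \<ge> 0" "\<And>h k p q. h \<in> D \<Longrightarrow> k \<in> D \<Longrightarrow> 0 \<le> p \<Longrightarrow> p \<le> q \<Longrightarrow> q \<le> T \<Longrightarrow>
      (\<lambda>r. inner (z r) (S (q - r) (- L h))) integrable_on {p..q} \<Longrightarrow> N_integrable (- L h) \<Longrightarrow>
      \<bar>mild_defect h p q - weak_defect h p q\<bar> \<le> K * (norm (L h - k) * (q - p) + (norm (L k) + norm (L h)) * (q - p) powr \<kappa>)"
proof -
  define G where "G = T powr (1 + \<gamma> - \<kappa>)"
  define G' where "G' = T powr (2 - \<kappa>)"
  have GG: "G \<ge> 0" "G' \<ge> 0" by (auto simp: G_def G'_def)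
  define K where "K = (2 * C + 2 * Cz) + (M * C * G + C * G + Cz * G')"
  have K: "2 * C + 2 * Cz \<le> K" "M * C * G + C * G + Cz * G' \<le> K" "K \<ge> 0"
    using C Cz_nonneg M(1) GG by (auto simp: K_def)
  have "\<bar>mild_defect h p q - weak_defect h p q\<bar> \<le> K * (norm (L h - k) * (q - p) + (norm (L k) + norm (L h)) * (q - p) powr \<kappa>)"
    if h: "h \<in> D" and k: "k \<in> D" and pq: "0 \<le> p" "p \<le> q" "q \<le> T"
      and int: "(\<lambda>r. inner (z r) (S (q - r) (- L h))) integrable_on {p..q}" and N: "N_integrable (- L h)"
    for h k p q
  proof -
    define \<tau> where "\<tau> = q - p"
    have \<tau>: "0 \<le> \<tau>" "\<tau> \<le> T" using pq by (auto simp: \<tau>_def)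
    have N': "(\<lambda>r. inner (z r) (- L h)) integrable_on {p..q}"
      by (rule N_integrable_subinterval[OF N]) (use pq in auto)
    have int_u: "(\<lambda>r. inner (u r) (L h)) integrable_on {p..q}" by (rule u_integrable) (use pq in auto)
    \<comment> \<open>\<open>S_\<tau> h - h\<close> is the integral of \<open>S_s L h\<close>, which
      turns the free evolution of \<open>u p\<close> into an integral comparable with that of
      \<open><u_r, L h>\<close>.\<close>
    have "((\<lambda>s. S s (L h)) has_integral (S \<tau> h - h)) {0..\<tau>}"
      by (rule S_integral[OF h \<tau>(1)])
    then have "((\<lambda>s. inner (u p) (S s (L h))) has_integral inner (u p) (S \<tau> h - h)) {0..\<tau>}"
      using has_integral_linear[OF _ bounded_linear_inner_right[of "u p"]] by (auto simp: o_def)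
    then have "((\<lambda>s. inner (u p) (S (s - p) (L h))) has_integral inner (u p) (S \<tau> h - h)) {p..q}"
      using has_integral_affinity'[of "\<lambda>s. inner (u p) (S s (L h))" _ 0 \<tau> 1 "- p"] by (simp add: \<tau>_def)
    then have S_int: "((\<lambda>r. inner (S (r - p) (u p)) (L h)) has_integral inner (u p) (S \<tau> h - h)) {p..q}"
      by (rule has_integral_eq[rotated]) (simp add: S_sym)
    have e1: "integral {p..q} (\<lambda>r. inner (u r) (L h)) - inner (u p) (S \<tau> h - h)
        = integral {p..q} (\<lambda>r. inner (u r - S (r - p) (u p)) (L h))"
      using S_int int_u Henstock_Kurzweil_Integration.integral_diff[OF int_u has_integral_integrable[OF S_int]]
      by (simp add: inner_diff_left integral_unique)
    have e2: "integral {p..q} (\<lambda>r. inner (z r) (S (q - r) (- L h))) - integral {p..q} (\<lambda>r. inner (z r) (- L h))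
        = integral {p..q} (\<lambda>r. inner (z r) (S (q - r) (- L h) - (- L h)))"
      using Henstock_Kurzweil_Integration.integral_diff[OF int N'] by (simp only: inner_diff_right)
    have b1: "\<bar>integral {p..q} (\<lambda>r. inner (u r - S (r - p) (u p)) (L h))\<bar>
        \<le> (2 * C * norm (L h - k) + M * C * \<tau> powr \<gamma> * norm (L k)) * (q - p)"
    proof (rule abs_integral_le_const[OF _ pq(2)])
      show "(\<lambda>r. inner (u r - S (r - p) (u p)) (L h)) integrable_on {p..q}"
        using Henstock_Kurzweil_Integration.integrable_diff[OF int_u has_integral_integrable[OF S_int]]
        by (simp only: inner_diff_left)
      fix r assume r: "r \<in> {p..q}"
      have "\<bar>inner (u r - S (r - p) (u p)) (L h)\<bar> \<le> 2 * C * norm (L h - k) + M * C * (r - p) powr \<gamma> * norm (L k)"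
        by (rule inner_increment_le[OF _ _ _ k]) (use r pq in auto)
      moreover have "M * C * (r - p) powr \<gamma> * norm (L k) \<le> M * C * \<tau> powr \<gamma> * norm (L k)"
        using r \<gamma> C M(1) by (intro mult_right_mono mult_left_mono powr_mono2) (auto simp: \<tau>_def)
      ultimately show "\<bar>inner (u r - S (r - p) (u p)) (L h)\<bar> \<le> 2 * C * norm (L h - k) + M * C * \<tau> powr \<gamma> * norm (L k)"
        by linarith
    qed
    have b2: "\<bar>integral {p..q} (\<lambda>r. inner (z r) (S (q - r) (- L h) - (- L h)))\<bar>
        \<le> (Cz * (2 * norm (L h - k) + \<tau> * norm (L k))) * (q - p)"
    proof (rule abs_integral_le_const[OF _ pq(2)])
      show "(\<lambda>r. inner (z r) (S (q - r) (- L h) - (- L h))) integrable_on {p..q}"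
        using Henstock_Kurzweil_Integration.integrable_diff[OF int N'] by (simp only: inner_diff_right)
      fix r assume r: "r \<in> {p..q}"
      then have \<sigma>: "0 \<le> q - r" "q - r \<le> \<tau>" by (auto simp: \<tau>_def)
      have "S (q - r) (- L h) - (- L h) = ((L h - k) - S (q - r) (L h - k)) - (S (q - r) k - k)"
        using \<sigma> by (simp add: S_diff S_minus)
      then have "norm (S (q - r) (- L h) - (- L h)) \<le> (norm (L h - k) + norm (L h - k)) + (q - r) * norm (L k)"
        using \<sigma> k by (simp only:) (intro norm_triangle_le_diff norm_S_le norm_S_minus_id order_refl)
      moreover have "(q - r) * norm (L k) \<le> \<tau> * norm (L k)" using \<sigma> by (intro mult_right_mono) auto
      ultimately have "norm (S (q - r) (- L h) - (- L h)) \<le> 2 * norm (L h - k) + \<tau> * norm (L k)" by linarith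
      then show "\<bar>inner (z r) (S (q - r) (- L h) - (- L h))\<bar> \<le> Cz * (2 * norm (L h - k) + \<tau> * norm (L k))"
        using r pq Cz_nonneg by (intro order_trans[OF Cauchy_Schwarz_ineq2] mult_mono z_bound) auto
    qed
    have b3: "\<bar>inner (\<Xi> q p) (S \<tau> h - h)\<bar> \<le> C * \<tau> powr \<gamma> * (\<tau> * norm (L h))"
      using pq \<tau> h C
      by (intro order_trans[OF Cauchy_Schwarz_ineq2] mult_mono norm_S_minus_id) (auto simp: \<tau>_def intro: \<Xi>_bound)
    have "mild_defect h p q - weak_defect h p q =
        (integral {p..q} (\<lambda>r. inner (u r) (L h)) - inner (u p) (S \<tau> h - h)) - inner (\<Xi> q p) (S \<tau> h - h)
        - (integral {p..q} (\<lambda>r. inner (z r) (S (q - r) (- L h))) - integral {p..q} (\<lambda>r. inner (z r) (- L h)))"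
      using \<tau> pq by (simp add: mild_defect_def weak_defect_def \<tau>_def inner_diff_left inner_diff_right S_sym)
    then have "\<bar>mild_defect h p q - weak_defect h p q\<bar> \<le>
        (2 * C * norm (L h - k) + M * C * \<tau> powr \<gamma> * norm (L k)) * \<tau>
        + C * \<tau> powr \<gamma> * (\<tau> * norm (L h)) + (Cz * (2 * norm (L h - k) + \<tau> * norm (L k))) * \<tau>"
      using b1[folded \<tau>_def] b2[folded \<tau>_def] b3 unfolding e1 e2 by linarith
    also have "\<dots> = (2 * C + 2 * Cz) * (norm (L h - k) * \<tau>) + (M * C * norm (L k) + C * norm (L h)) * (\<tau> powr \<gamma> * \<tau>)
        + Cz * norm (L k) * (\<tau> * \<tau>)"
      by (simp add: algebra_simps)
    also have "\<tau> powr \<gamma> * \<tau> = \<tau> powr (1 + \<gamma>)" using \<tau> by (simp add: powr_add)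
    also have "\<tau> * \<tau> = \<tau> powr 2" using \<tau> by (simp add: power2_eq_square)
    finally have "\<bar>mild_defect h p q - weak_defect h p q\<bar> \<le>
        (2 * C + 2 * Cz) * (norm (L h - k) * \<tau>) + (M * C * norm (L k) + C * norm (L h)) * \<tau> powr (1 + \<gamma>)
        + Cz * norm (L k) * \<tau> powr 2" .
    also have "\<dots> \<le> (2 * C + 2 * Cz) * (norm (L h - k) * \<tau>) + (M * C * norm (L k) + C * norm (L h)) * (G * \<tau> powr \<kappa>)
        + Cz * norm (L k) * (G' * \<tau> powr \<kappa>)"
      unfolding G_def G'_def using \<tau> \<kappa> C M(1) Cz_nonneg
      by (intro add_mono mult_left_mono powr_le_powr_mult) auto
    finally have le: "\<bar>mild_defect h p q - weak_defect h p q\<bar> \<le> (2 * C + 2 * Cz) * (norm (L h - k) * \<tau>)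
        + ((M * C * norm (L k) + C * norm (L h)) * (G * \<tau> powr \<kappa>) + Cz * norm (L k) * (G' * \<tau> powr \<kappa>))"
      by simp
    have "0 \<le> (M * C * G) * (norm (L h) * \<tau> powr \<kappa>) + (C * G) * (norm (L k) * \<tau> powr \<kappa>) + (Cz * G') * (norm (L h) * \<tau> powr \<kappa>)"
      using C M(1) GG Cz_nonneg by (intro add_nonneg_nonneg mult_nonneg_nonneg) auto
    then have "(M * C * norm (L k) + C * norm (L h)) * (G * \<tau> powr \<kappa>) + Cz * norm (L k) * (G' * \<tau> powr \<kappa>)
        \<le> (M * C * G + C * G + Cz * G') * ((norm (L k) + norm (L h)) * \<tau> powr \<kappa>)"
      by (simp add: algebra_simps)
    moreover have "(M * C * G + C * G + Cz * G') * ((norm (L k) + norm (L h)) * \<tau> powr \<kappa>)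
        \<le> K * ((norm (L k) + norm (L h)) * \<tau> powr \<kappa>)"
      using K(2) by (intro mult_right_mono) auto
    moreover have "(2 * C + 2 * Cz) * (norm (L h - k) * \<tau>) \<le> K * (norm (L h - k) * \<tau>)"
      using K(1) \<tau> by (intro mult_right_mono) auto
    ultimately have "\<bar>mild_defect h p q - weak_defect h p q\<bar> \<le>
        K * (norm (L h - k) * \<tau>) + K * ((norm (L k) + norm (L h)) * \<tau> powr \<kappa>)"
      using le by linarith
    then show ?thesis by (simp add: \<tau>_def distrib_left)
  qed
  with K(3) show thesis using that by blast
qed

section \<open>The two equations in the abstract setting\<close>

definition mild :: bool where
  "mild \<longleftrightarrow> (\<forall>t\<in>{0..T}. (\<lambda>r. dec S (S (t - r) (z r))) integrable_on {0..t} \<and>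
     (\<exists>v. rs_limit t (\<lambda>q r. S (t - r) (\<Xi> q r)) (fracA S a) v \<and>
       fracA S a (u t) = fracA S a (S t (u 0) + integral {0..t} (\<lambda>r. dec S (S (t - r) (z r)))) + v))"

definition weak :: bool where
  "weak \<longleftrightarrow> (\<forall>h\<in>D. \<forall>t\<in>{0..T}. (\<lambda>s. inner (u s) (L h)) integrable_on {0..t} \<and>
     (\<lambda>s. inner (z s) (- L h)) integrable_on {0..t} \<and>
     (\<exists>l. rs_limit t (\<lambda>q r. inner (\<Xi> q r) h) id l \<and>
       inner (u t) h = inner (u 0) h + integral {0..t} (\<lambda>s. inner (u s) (L h))
         + integral {0..t} (\<lambda>s. inner (z s) (- L h)) + l))"

text \<open>Besides the propagated defect of \<open>\<Xi>\<close> there appears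
  \<open>S_{m-r} - 1\<close> applied to \<open>\<Xi> q m\<close>, of order
  \<open>\<theta> + \<gamma> = \<kappa>\<close>. One constant serves all end points
  \<open>t\<close>.\<close>

lemma mild_germ_bound:
  obtains K where "K \<ge> 0" "\<And>t. t \<le> T \<Longrightarrow> germ_bound 0 t \<kappa> K (\<lambda>q r. fracA S a (S (t - r) (\<Xi> q r)))"
proof -
  define \<theta> where "\<theta> = (1 + \<gamma>) / 2"
  have \<theta>: "0 \<le> \<theta>" "\<theta> \<le> 1" "\<theta> < a" "\<kappa> = \<theta> + \<gamma>" using \<gamma> by (auto simp: \<theta>_def a field_simps)
  obtain K where K: "K \<ge> 0" "\<And>x \<tau>. \<tau> \<ge> 0 \<Longrightarrow> norm (fracA S a (S \<tau> x - x)) \<le> K * \<tau> powr \<theta> * norm x"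
    using norm_S_minus_id_fracA[OF \<theta>(1-3)] by blast
  show thesis
  proof (rule that[of "C + K * C"])
    show "C + K * C \<ge> 0" using C K(1) by simp
    fix t assume t: "t \<le> T"
    show "germ_bound 0 t \<kappa> (C + K * C) (\<lambda>q r. fracA S a (S (t - r) (\<Xi> q r)))"
      unfolding germ_bound_def
    proof (intro allI impI)
      fix r m q assume *: "0 \<le> r" "r \<le> m" "m \<le> q" "q \<le> t"
      have S_split: "S (t - r) x = S (t - m) (S (m - r) x)" for x using * by (simp add: S_S)
      have nonneg: "0 \<le> t - r" "0 \<le> t - m" "0 \<le> m - r" "0 \<le> a" using * a_bounds by auto
      have eq: "fracA S a (S (t - r) (\<Xi> q r)) - fracA S a (S (t - m) (\<Xi> q m)) - fracA S a (S (t - r) (\<Xi> m r))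
          = S (t - r) (fracA S a (\<Xi> q r - \<Xi> q m - \<Xi> m r)) + S (t - m) (fracA S a (S (m - r) (\<Xi> q m) - \<Xi> q m))"
        using nonneg by (simp add: S_diff fracA_diff fracA_S S_S)
      have "norm (fracA S a (S (t - r) (\<Xi> q r)) - fracA S a (S (t - m) (\<Xi> q m)) - fracA S a (S (t - r) (\<Xi> m r)))
          \<le> C * (q - r) powr \<kappa> + K * (m - r) powr \<theta> * norm (\<Xi> q m)"
        unfolding eq using nonneg * t
        by (intro norm_triangle_mono order_trans[OF norm_S_le] \<Xi>_defect K(2)) auto
      moreover have "K * (m - r) powr \<theta> * norm (\<Xi> q m) \<le> K * (q - r) powr \<theta> * (C * (q - r) powr \<gamma>)"
      proof (intro mult_mono mult_left_mono)
        show "norm (\<Xi> q m) \<le> C * (q - r) powr \<gamma>"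
          using * t \<gamma> C by (intro order_trans[OF \<Xi>_bound] mult_left_mono powr_mono2) auto
      qed (use * K(1) \<theta> in \<open>auto intro!: powr_mono2\<close>)
      moreover have "K * (q - r) powr \<theta> * (C * (q - r) powr \<gamma>) = K * C * (q - r) powr \<kappa>"
        unfolding \<theta>(4) by (simp add: powr_add)
      ultimately show "norm (fracA S a (S (t - r) (\<Xi> q r)) - fracA S a (S (t - m) (\<Xi> q m)) - fracA S a (S (t - r) (\<Xi> m r)))
          \<le> (C + K * C) * (q - r) powr \<kappa>" by (simp add: distrib_right)
    qed
  qed
qed

lemma weak_germ_bound:
  assumes "h \<in> D"
  shows "germ_bound 0 T \<kappa> (M * C * norm (L h)) (\<lambda>q r. inner (\<Xi> q r) h)"
  unfolding germ_bound_def
proof (intro allI impI)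
  fix r m q assume *: "0 \<le> r" "r \<le> m" "m \<le> q" "q \<le> T"
  have "\<bar>inner (\<Xi> q r - \<Xi> q m - \<Xi> m r) h\<bar> \<le> M * norm (fracA S a (\<Xi> q r - \<Xi> q m - \<Xi> m r)) * norm (L h)"
    by (rule inner_D_le[OF assms])
  also have "\<dots> \<le> M * (C * (q - r) powr \<kappa>) * norm (L h)"
    using M(1) by (intro mult_right_mono mult_left_mono \<Xi>_defect *) auto
  finally show "norm (inner (\<Xi> q r) h - inner (\<Xi> q m) h - inner (\<Xi> m r) h) \<le> M * C * norm (L h) * (q - r) powr \<kappa>"
    by (simp add: inner_diff_left mult_ac)
qed

lemma inner_dec_S_z:
  assumes "h \<in> D" "\<sigma> > 0"
  shows "inner (dec S (S \<sigma> (z r))) h = inner (z r) (S \<sigma> (- L h))"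
  using inner_LS_z[OF assms] S_in_D(1)[OF assms(2)] by (simp add: dec_D)

lemma has_integral_inner_convolution:
  assumes int: "(\<lambda>r. dec S (S (t - r) (z r))) integrable_on {0..t}" and h: "h \<in> D"
  shows "((\<lambda>r. inner (z r) (S (t - r) (- L h))) has_integral inner (integral {0..t} (\<lambda>r. dec S (S (t - r) (z r)))) h) {0..t}"
proof (rule has_integral_spike[OF negligible_sing[of t]])
  show "((\<lambda>r. inner (dec S (S (t - r) (z r))) h) has_integral inner (integral {0..t} (\<lambda>r. dec S (S (t - r) (z r)))) h) {0..t}"
    using has_integral_linear[OF integrable_integral[OF int] bounded_linear_inner_left[of h]] by (simp add: o_def)
  \<comment> \<open>At \<open>r = t\<close> the value \<open>dec S (z t)\<close> may be an
    unspecified description, as \<open>z t\<close> need not lie in \<open>D\<close>; a single point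
    is negligible.\<close>
  show "inner (z r) (S (t - r) (- L h)) = inner (dec S (S (t - r) (z r))) h" if "r \<in> {0..t} - {t}" for r
    using that by (subst inner_dec_S_z[OF h]) auto
qed

text \<open>Subtracting \<open>S_{q-p} v_p\<close> from \<open>v_q\<close> localises the rough
  convolution to \<open>{p..q}\<close>. Existence of the weak rough integral comes out together with
  the identity, as a limit of sums close to the additive function \<open>A\<close>.\<close>

lemma mild_imp_weak:
  assumes mild
  shows weak
proof -
  define I where "I t = integral {0..t} (\<lambda>r. dec S (S (t - r) (z r)))" for t
  have int: "(\<lambda>r. dec S (S (t - r) (z r))) integrable_on {0..t}" if "0 \<le> t" "t \<le> T" for t
    using assms that by (simp add: mild_def)
  have "\<forall>t\<in>{0..T}. \<exists>v. rs_limit t (\<lambda>q r. S (t - r) (\<Xi> q r)) (fracA S a) v \<and>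
       fracA S a (u t) = fracA S a (S t (u 0) + I t) + v"
    using assms by (simp add: mild_def I_def)
  then obtain v where v0: "\<forall>t\<in>{0..T}. rs_limit t (\<lambda>q r. S (t - r) (\<Xi> q r)) (fracA S a) (v t) \<and>
       fracA S a (u t) = fracA S a (S t (u 0) + I t) + v t"
    using bchoice by force
  define G where "G t q r = fracA S a (S (t - r) (\<Xi> q r))" for t q r
  have lin: "linear (fracA S a)" using a_bounds by (intro linear_fracA) auto
  have v: "rs_limit t (G t) id (v t)" "v t = fracA S a (u t) - fracA S a (S t (u 0)) - fracA S a (I t)"
    if "0 \<le> t" "t \<le> T" for t
    using v0[rule_format, of t] that unfolding G_def rs_limit_linear[OF lin] by (auto simp: linear_add[OF lin])
  have conv: "((\<lambda>r. inner (z r) (S (t - r) (- L h))) has_integral inner (I t) h) {0..t}"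
    if "0 \<le> t" "t \<le> T" "h \<in> D" for t h
    unfolding I_def by (rule has_integral_inner_convolution[OF int that(3)]) (use that in auto)
  have N: "N_integrable (- L h)" if "h \<in> D" for h
    by (rule N_integrable_of_convolution) (use conv that in blast)
  obtain Kg where Kg: "Kg \<ge> 0" "\<And>t. t \<le> T \<Longrightarrow> germ_bound 0 t \<kappa> Kg (G t)"
    unfolding G_def using mild_germ_bound by blast
  define K1 where "K1 = M * (sewing_const \<kappa> * Kg)"
  have K1: "K1 \<ge> 0" using M(1) sewing_const(1)[OF \<kappa>(1)] Kg(1) by (simp add: K1_def)
  have mild_local: "\<bar>mild_defect h p q\<bar> \<le> K1 * (q - p) powr \<kappa> * norm (L h)"
    if h: "h \<in> D" and pq: "0 \<le> p" "p \<le> q" "q \<le> T" for h p q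
  proof -
    define x where "x = u q - S (q - p) (u p) - S (q - p) (\<Xi> q p) - (I q - S (q - p) (I p))"
    \<comment> \<open>\<open>S (q - p)\<close> maps the sums for end point \<open>p\<close> to the
      sums over \<open>[0, p]\<close> for end point \<open>q\<close>; both limits then belong to the
      same germ \<open>G q\<close>.\<close>
    have lp: "rs_limit p (G q) id (S (q - p) (v p))"
    proof -
      have "rs_limit p (\<lambda>x r. S (q - p) (G p x r)) id (S (q - p) (v p))"
        by (rule rs_limit_bounded_linear[OF v(1) bounded_linear_S]) (use pq in auto)
      moreover have "S (q - p) (G p x r) = G q x r" if "0 \<le> r" "r < x" "x \<le> p" for r x
        using that pq a_bounds by (simp add: G_def fracA_S[symmetric] S_S)
      ultimately show ?thesis
        using rs_limit_cong[of p "\<lambda>x r. S (q - p) (G p x r)" "G q"] by simp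
    qed
    have "norm (v q - S (q - p) (v p) - G q q p) \<le> sewing_const \<kappa> * Kg * (q - p) powr \<kappa>"
      using pq by (intro rs_limit_increment[OF lp v(1) _ _ _ \<kappa>(1) Kg(1)] germ_bound_subset[OF Kg(2)]) auto
    moreover have "fracA S a x = v q - S (q - p) (v p) - G q q p"
      using pq a_bounds v(2)[of p] v(2)[of q]
      by (simp add: x_def G_def linear_diff[OF lin] S_diff fracA_S S_S)
    ultimately have ax: "norm (fracA S a x) \<le> sewing_const \<kappa> * Kg * (q - p) powr \<kappa>" by simp
    \<comment> \<open>The drift accumulated up to \<open>p\<close> is tested with
      \<open>S_{q-p} h\<close>, which makes the two integrands agree on
      \<open>{0..p}\<close>.\<close>
    have "inner x h = mild_defect h p q"
    proof -
      let ?f = "\<lambda>r. inner (z r) (S (q - r) (- L h))"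
      have Iq: "(?f has_integral inner (I q) h) {0..q}" using conv h pq by auto
      have "((\<lambda>r. inner (z r) (S (p - r) (- L (S (q - p) h)))) has_integral inner (I p) (S (q - p) h)) {0..p}"
        using pq h by (intro conv S_D) auto
      then have Ip: "(?f has_integral inner (I p) (S (q - p) h)) {0..p}"
        by (rule has_integral_eq[rotated])
           (use pq h in \<open>auto simp: S_D S_minus S_S\<close>)
      have "integral {0..p} ?f + integral {p..q} ?f = integral {0..q} ?f"
        using pq Iq by (intro Henstock_Kurzweil_Integration.integral_combine) auto
      then have "integral {p..q} ?f = inner (I q) h - inner (I p) (S (q - p) h)"
        using Iq Ip by (simp add: integral_unique)
      then show ?thesis
        using pq by (simp add: mild_defect_def x_def inner_diff_left S_sym)
    qed
    then have "\<bar>mild_defect h p q\<bar> \<le> M * norm (fracA S a x) * norm (L h)"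
      using inner_D_le[OF h, of x] by simp
    also have "\<dots> \<le> M * (sewing_const \<kappa> * Kg * (q - p) powr \<kappa>) * norm (L h)"
      using M(1) ax by (intro mult_right_mono mult_left_mono) auto
    finally show ?thesis by (simp add: K1_def mult_ac)
  qed
  obtain K2 where K2: "K2 \<ge> 0" "\<And>h k p q. h \<in> D \<Longrightarrow> k \<in> D \<Longrightarrow> 0 \<le> p \<Longrightarrow> p \<le> q \<Longrightarrow> q \<le> T \<Longrightarrow>
      (\<lambda>r. inner (z r) (S (q - r) (- L h))) integrable_on {p..q} \<Longrightarrow> N_integrable (- L h) \<Longrightarrow>
      \<bar>mild_defect h p q - weak_defect h p q\<bar> \<le> K2 * (norm (L h - k) * (q - p) + (norm (L k) + norm (L h)) * (q - p) powr \<kappa>)"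
    using mild_weak_defect_close by blast
  show ?thesis
    unfolding weak_def
  proof (intro ballI conjI)
    fix h t assume h: "h \<in> D" and "t \<in> {0..T}"
    then have t: "0 \<le> t" "t \<le> T" by auto
    note iu = u_integrable and iN = N_integrable_subinterval[OF N[OF h]]
    show "(\<lambda>s. inner (u s) (L h)) integrable_on {0..t}" "(\<lambda>s. inner (z s) (- L h)) integrable_on {0..t}"
      using iu iN t by auto
    \<comment> \<open>\<open>A\<close> isolates the rough integral; its increments differ from the
      germ exactly by \<open>weak_defect\<close>.\<close>
    define A where "A s = inner (u s) h - integral {0..s} (\<lambda>r. inner (u r) (L h)) - integral {0..s} (\<lambda>r. inner (z r) (- L h))" for s
    have incr: "A q - A r - inner (\<Xi> q r) h = weak_defect h r q" if "0 \<le> r" "r \<le> q" "q \<le> T" for r q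
    proof -
      have "integral {0..r} (\<lambda>r. inner (u r) (L h)) + integral {r..q} (\<lambda>r. inner (u r) (L h)) = integral {0..q} (\<lambda>r. inner (u r) (L h))"
        "integral {0..r} (\<lambda>r. inner (z r) (- L h)) + integral {r..q} (\<lambda>r. inner (z r) (- L h)) = integral {0..q} (\<lambda>r. inner (z r) (- L h))"
        using that iu iN by (intro Henstock_Kurzweil_Integration.integral_combine; auto)+
      then show ?thesis by (simp add: A_def weak_defect_def inner_diff_left)
    qed
    have "additive_approx 0 t A (\<lambda>q r. inner (\<Xi> q r) h)"
    proof (rule additive_approx_of_eps_powr[OF \<kappa>(1)])
      fix e :: real assume e: "e > 0"
      \<comment> \<open>Density of \<open>D\<close> provides \<open>k\<close>; the scale
        \<open>e / (K2 + 1)\<close> makes its contribution at most \<open>e * (q - r)\<close>, and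
        \<open>K\<close> absorbs the size of \<open>L k\<close>.\<close>
      obtain k where k: "k \<in> D" "norm (L h - k) < e / (K2 + 1)"
        using closure_approachable[of "L h" D] closure_D e K2(1)
        by (metis UNIV_I add_nonneg_pos dist_norm divide_pos_pos norm_minus_commute zero_less_one)
      have ek: "K2 * norm (L h - k) \<le> e"
      proof -
        have "K2 * norm (L h - k) \<le> K2 * (e / (K2 + 1))" using k K2(1) by (intro mult_left_mono) auto
        also have "\<dots> \<le> e" using e K2(1) by (simp add: field_simps)
        finally show ?thesis .
      qed
      define K where "K = K1 * norm (L h) + K2 * (norm (L k) + norm (L h))"
      have "norm (A q - A r - inner (\<Xi> q r) h) \<le> e * (q - r) + K * (q - r) powr \<kappa>"
        if rq: "0 \<le> r" "r < q" "q \<le> t" for r q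
      proof -
        have rq': "0 \<le> r" "r \<le> q" "q \<le> T" using rq t by auto
        have "(\<lambda>s. inner (z s) (S (q - s) (- L h))) integrable_on {r..q}"
          by (rule integrable_on_subinterval[OF has_integral_integrable[OF conv[OF _ _ h]]]) (use rq' in auto)
        from K2(2)[OF h k(1) rq' this N[OF h]] mild_local[OF h rq']
        have "\<bar>weak_defect h r q\<bar> \<le> K1 * (q - r) powr \<kappa> * norm (L h)
            + K2 * (norm (L h - k) * (q - r) + (norm (L k) + norm (L h)) * (q - r) powr \<kappa>)" by linarith
        also have "\<dots> = K2 * norm (L h - k) * (q - r) + K * (q - r) powr \<kappa>"
          by (simp add: K_def algebra_simps)
        also have "\<dots> \<le> e * (q - r) + K * (q - r) powr \<kappa>"
          using ek rq by (intro add_right_mono mult_right_mono) auto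
        finally show ?thesis using incr[OF rq'] by simp
      qed
      moreover have "K \<ge> 0" using K1 K2(1) by (simp add: K_def)
      ultimately show "\<exists>K\<ge>0. \<forall>r q. 0 \<le> r \<longrightarrow> r < q \<longrightarrow> q \<le> t \<longrightarrow>
          norm (A q - A r - inner (\<Xi> q r) h) \<le> e * (q - r) + K * (q - r) powr \<kappa>" by blast
    qed
    from rs_limit_of_additive_approx[OF t(1) this]
    have lim: "rs_limit t (\<lambda>q r. inner (\<Xi> q r) h) id (A t - A 0)" .
    have "inner (u t) h = inner (u 0) h + integral {0..t} (\<lambda>s. inner (u s) (L h))
         + integral {0..t} (\<lambda>s. inner (z s) (- L h)) + (A t - A 0)"
      by (simp add: A_def)
    with lim show "\<exists>l. rs_limit t (\<lambda>q r. inner (\<Xi> q r) h) id l \<and>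
       inner (u t) h = inner (u 0) h + integral {0..t} (\<lambda>s. inner (u s) (L h))
         + integral {0..t} (\<lambda>s. inner (z s) (- L h)) + l" by blast
  qed
qed

text \<open>Existence of the drift integral in \<open>H\<close> is an assertion of the mild equation
  that the weak one does not contain. The expansions are therefore kept in tested form until they
  have yielded strong continuity of \<open>u\<close>.\<close>

lemma weak_imp_mild:
  assumes weak
  shows mild
proof -
  have N: "N_integrable (- L h)" if "h \<in> D" for h
    using assms that T by (auto simp: weak_def N_integrable_def)
  have conv: "(\<lambda>r. inner (z r) (S (t - r) (- L h))) integrable_on {0..t}" if "h \<in> D" "0 \<le> t" "t \<le> T" for h t
  proof (rule convolution_integrable_of_N[OF _ that(2,3)])
    show "N_integrable (S \<sigma> (- L h))" if "\<sigma> \<ge> 0" for \<sigma>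
      using N[OF S_D(1)[OF \<open>h \<in> D\<close> that]] that \<open>h \<in> D\<close> by (simp add: S_D S_minus)
  qed
  have conv': "(\<lambda>r. inner (z r) (S (t - r) (- L h))) integrable_on {p..q}" if "h \<in> D" "0 \<le> p" "q \<le> t" "t \<le> T" for h t p q
  proof (cases "p \<le> q")
    case True
    show ?thesis by (rule integrable_on_subinterval[OF conv]) (use that True in auto)
  qed auto
  have a0: "0 \<le> a" "0 \<le> 1 - a" using a_bounds by auto
  define K1 where "K1 = sewing_const \<kappa> * (M * C)"
  have K1: "K1 \<ge> 0" using M(1) sewing_const(1)[OF \<kappa>(1)] C by (simp add: K1_def)
  have weak_local: "\<bar>weak_defect h p q\<bar> \<le> K1 * norm (L h) * (q - p) powr \<kappa>"
    if h: "h \<in> D" and pq: "0 \<le> p" "p \<le> q" "q \<le> T" for h p q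
  proof -
    have ex: "\<exists>l. rs_limit t (\<lambda>q r. inner (\<Xi> q r) h) id l \<and>
       inner (u t) h = inner (u 0) h + integral {0..t} (\<lambda>s. inner (u s) (L h))
         + integral {0..t} (\<lambda>s. inner (z s) (- L h)) + l" if "0 \<le> t" "t \<le> T" for t
      using assms h that by (simp add: weak_def)
    obtain lp lq where l: "rs_limit p (\<lambda>q r. inner (\<Xi> q r) h) id lp" "rs_limit q (\<lambda>q r. inner (\<Xi> q r) h) id lq"
      "inner (u p) h = inner (u 0) h + integral {0..p} (\<lambda>s. inner (u s) (L h)) + integral {0..p} (\<lambda>s. inner (z s) (- L h)) + lp"
      "inner (u q) h = inner (u 0) h + integral {0..q} (\<lambda>s. inner (u s) (L h)) + integral {0..q} (\<lambda>s. inner (z s) (- L h)) + lq"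
      using ex[of p] ex[of q] pq by auto
    have "norm (lq - lp - inner (\<Xi> q p) h) \<le> sewing_const \<kappa> * (M * C * norm (L h)) * (q - p) powr \<kappa>"
      using pq M(1) C
      by (intro rs_limit_increment[OF l(1,2) _ _ _ \<kappa>(1)] germ_bound_subset[OF weak_germ_bound[OF h]]) auto
    moreover have "lq - lp - inner (\<Xi> q p) h = weak_defect h p q"
    proof -
      have "integral {0..p} (\<lambda>r. inner (u r) (L h)) + integral {p..q} (\<lambda>r. inner (u r) (L h)) = integral {0..q} (\<lambda>r. inner (u r) (L h))"
        "integral {0..p} (\<lambda>r. inner (z r) (- L h)) + integral {p..q} (\<lambda>r. inner (z r) (- L h)) = integral {0..q} (\<lambda>r. inner (z r) (- L h))"
        using pq u_integrable N_integrable_subinterval[OF N[OF h]]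
        by (intro Henstock_Kurzweil_Integration.integral_combine; auto)+
      then show ?thesis using l(3,4) by (simp add: weak_defect_def inner_diff_left)
    qed
    ultimately show ?thesis by (simp add: K1_def mult_ac)
  qed
  obtain K2 where K2: "K2 \<ge> 0" "\<And>h k p q. h \<in> D \<Longrightarrow> k \<in> D \<Longrightarrow> 0 \<le> p \<Longrightarrow> p \<le> q \<Longrightarrow> q \<le> T \<Longrightarrow>
      (\<lambda>r. inner (z r) (S (q - r) (- L h))) integrable_on {p..q} \<Longrightarrow> N_integrable (- L h) \<Longrightarrow>
      \<bar>mild_defect h p q - weak_defect h p q\<bar> \<le> K2 * (norm (L h - k) * (q - p) + (norm (L k) + norm (L h)) * (q - p) powr \<kappa>)"
    using mild_weak_defect_close by blast
  define K3 where "K3 = K1 + K2"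
  have K3: "K3 \<ge> 0" using K1 K2(1) by (simp add: K3_def)
  \<comment> \<open>For \<open>h\<close> in \<open>D2\<close> the choice \<open>k = L h\<close>
    removes the term without a rate.\<close>
  have mild_D2: "\<bar>mild_defect h p q\<bar> \<le> K3 * (norm (L (L h)) + norm (L h)) * (q - p) powr \<kappa>"
    if h: "h \<in> D2" and pq: "0 \<le> p" "p \<le> q" "q \<le> T" for h p q
  proof -
    have hD: "h \<in> D" "L h \<in> D" using h by (auto simp: D2_def)
    have "\<bar>mild_defect h p q - weak_defect h p q\<bar> \<le> K2 * (norm (L h - L h) * (q - p) + (norm (L (L h)) + norm (L h)) * (q - p) powr \<kappa>)"
      by (rule K2(2)[OF hD pq conv'[OF hD(1)] N[OF hD(1)]]) (use pq in auto)
    moreover have "K1 * norm (L h) * (q - p) powr \<kappa> \<le> K1 * (norm (L (L h)) + norm (L h)) * (q - p) powr \<kappa>"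
      using K1 by (intro mult_right_mono mult_left_mono) auto
    ultimately show ?thesis using weak_local[OF hD(1) pq] by (simp add: K3_def algebra_simps)
  qed
  \<comment> \<open>For fixed \<open>t\<close>, the increments of \<open>W h t\<close> approximate
    the tested germ \<open>S_{t-r} \<Xi> q r\<close>; at \<open>q = t\<close> the error is the mild
    defect of \<open>h\<close> itself.\<close>
  define W where "W h t s = inner (u s) (S (t - s) h) - integral {0..s} (\<lambda>r. inner (z r) (S (t - r) (- L h)))" for h t s
  have W_incr: "W h t q - W h t r - inner (S (t - r) (\<Xi> q r)) h = mild_defect (S (t - q) h) r q"
    if h: "h \<in> D" and rq: "0 \<le> r" "r \<le> q" "q \<le> t" "t \<le> T" for h t q r
  proof -
    let ?f = "\<lambda>r. inner (z r) (S (t - r) (- L h))"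
    have comb: "integral {0..r} ?f + integral {r..q} ?f = integral {0..q} ?f"
      using rq by (intro Henstock_Kurzweil_Integration.integral_combine conv' h) auto
    have "integral {r..q} (\<lambda>s. inner (z s) (S (q - s) (- L (S (t - q) h)))) = integral {r..q} ?f"
      using rq h by (intro Henstock_Kurzweil_Integration.integral_cong) (auto simp: S_D S_minus S_S)
    then show ?thesis
      using rq comb by (simp add: W_def mild_defect_def inner_diff_left S_sym S_S)
  qed
  obtain Kg where Kg: "Kg \<ge> 0" "\<And>t. t \<le> T \<Longrightarrow> germ_bound 0 t \<kappa> Kg (\<lambda>q r. fracA S a (S (t - r) (\<Xi> q r)))"
    using mild_germ_bound by blast
  define K4 where "K4 = sewing_const \<kappa> * Kg"
  have K4: "K4 \<ge> 0" using sewing_const(1)[OF \<kappa>(1)] Kg(1) by (simp add: K4_def)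
  text \<open>Uniqueness of sewing trades the bound in terms of $L^2h$ for one in terms of the
    $\mathcal{H}_{2\gamma}$ norm of $h$.\<close>
  have mild_local: "\<bar>mild_defect (fracA S a k) p q\<bar> \<le> K4 * norm k * (q - p) powr \<kappa>"
    if k: "k \<in> D2" and pq: "0 \<le> p" "p \<le> q" "q \<le> T" for k p q
  proof -
    define h where "h = fracA S a k"
    have h: "h \<in> D2" "h \<in> D" "L h \<in> D" using D2_fracA[OF a0(1) k] by (auto simp: h_def D2_def)
    let ?g = "\<lambda>x r. inner (S (q - r) (\<Xi> x r)) h"
    have "additive_approx p q (W h q) ?g"
    proof (rule additive_approx_of_powr[OF \<kappa>(1)])
      show "0 \<le> K3 * (norm (L (L h)) + norm (L h))" using K3 by simp
      fix r x assume rx: "p \<le> r" "r < x" "x \<le> q"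
      have "\<bar>mild_defect (S (q - x) h) r x\<bar> \<le> K3 * (norm (L (L (S (q - x) h))) + norm (L (S (q - x) h))) * (x - r) powr \<kappa>"
        using rx pq by (intro mild_D2 D2_S h) auto
      also have "\<dots> \<le> K3 * (norm (L (L h)) + norm (L h)) * (x - r) powr \<kappa>"
        using rx K3 h S_D norm_S_le by (intro mult_right_mono mult_left_mono add_mono) auto
      finally show "norm (W h q x - W h q r - inner (S (q - r) (\<Xi> x r)) h) \<le> K3 * (norm (L (L h)) + norm (L h)) * (x - r) powr \<kappa>"
        using W_incr[OF h(2), of r x q] rx pq by simp
    qed
    moreover have "germ_bound p q \<kappa> (Kg * norm k) ?g"
      unfolding germ_bound_def
    proof (intro allI impI)
      fix r m x assume *: "p \<le> r" "r \<le> m" "m \<le> x" "x \<le> q"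
      have "norm (?g x r - ?g x m - ?g m r)
          = \<bar>inner (fracA S a (S (q - r) (\<Xi> x r)) - fracA S a (S (q - m) (\<Xi> x m)) - fracA S a (S (q - r) (\<Xi> m r))) k\<bar>"
        using a0 by (simp add: h_def inner_diff_left fracA_inner_sym)
      also have "\<dots> \<le> (Kg * (x - r) powr \<kappa>) * norm k"
        using * pq by (intro order_trans[OF Cauchy_Schwarz_ineq2] mult_right_mono germ_boundD[OF Kg(2)]) auto
      finally show "norm (?g x r - ?g x m - ?g m r) \<le> Kg * norm k * (x - r) powr \<kappa>" by (simp add: mult_ac)
    qed
    ultimately have "norm (W h q q - W h q p - ?g q p) \<le> sewing_const \<kappa> * (Kg * norm k) * (q - p) powr \<kappa>"
      using \<kappa>(1) Kg(1) pq by (intro additive_approx_germ) auto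
    then show ?thesis
      using W_incr[OF h(2), of p q q] pq by (simp add: h_def K4_def mult_ac)
  qed
  obtain M' where M': "M' > 0" "\<And>x. norm (fracA S (1 - a) x) \<le> M' * norm x"
    using fracA_bound[OF a0(2)] by blast
  have mild_S: "\<bar>mild_defect (S \<sigma> x) p q\<bar> \<le> K4 * M' * norm (L (S \<sigma> x)) * (q - p) powr \<kappa>"
    if \<sigma>: "\<sigma> > 0" and pq: "0 \<le> p" "p \<le> q" "q \<le> T" for \<sigma> x p q
  proof -
    \<comment> \<open>This is \<open>(-L)^a S_\<sigma> x\<close>, bounded crudely through
      \<open>L S_\<sigma> x\<close>; the resulting factor \<open>1 / \<sigma>\<close> is affordable
      since \<open>\<kappa> > 1\<close>.\<close>
    define k where "k = fracA S (1 - a) (- L (S \<sigma> x))"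
    have "L (S \<sigma> x) = S (\<sigma> / 2) (L (S (\<sigma> / 2) x))"
      using L_S[of "\<sigma> / 2" "\<sigma> / 2" x] \<sigma> by simp
    then have "k = S (\<sigma> / 2) (fracA S (1 - a) (- L (S (\<sigma> / 2) x)))"
      using \<sigma> a0 by (simp add: k_def fracA_S[symmetric] S_minus)
    then have "k \<in> D2" using S_in_D2[of "\<sigma> / 2"] \<sigma> by simp
    moreover have "fracA S a k = S \<sigma> x"
      using a0 S_in_D(1)[OF \<sigma>] by (simp add: k_def fracA_fracA fracA_minus fracA_1_L)
    ultimately have "\<bar>mild_defect (S \<sigma> x) p q\<bar> \<le> K4 * norm k * (q - p) powr \<kappa>"
      using mild_local[OF _ pq, of k] by simp
    also have "\<dots> \<le> K4 * (M' * norm (L (S \<sigma> x))) * (q - p) powr \<kappa>"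
      using K4 M'(2)[of "- L (S \<sigma> x)"] by (intro mult_right_mono mult_left_mono) (auto simp: k_def)
    finally show ?thesis by (simp add: mult.assoc)
  qed
  \<comment> \<open>The factor \<open>1 / \<tau>\<close> from smoothing lowers the order
    \<open>\<kappa>\<close> of the defect to \<open>\<kappa> - 1\<close>, which is at most the order
    \<open>\<gamma>\<close> of the germ and the order \<open>1/3\<close> of the drift.\<close>
  define \<theta> where "\<theta> = \<kappa> - 1"
  have \<theta>: "\<theta> > 0" "\<theta> \<le> \<gamma>" "\<theta> \<le> 1 / 3" using \<gamma> by (auto simp: \<theta>_def field_simps)
  define C1 where "C1 = K4 * M' + C * T powr (\<gamma> - \<theta>) + Cz * T powr (1 / 3 - \<theta>)"
  have C1: "C1 \<ge> 0" using K4 M'(1) C Cz_nonneg by (simp add: C1_def)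
  \<comment> \<open>The geometric series of the halving:
    \<open>C5 = C1 + C5 * 2^(-\<theta>)\<close>.\<close>
  define C5 where "C5 = C1 / (1 - (1 / 2) powr \<theta>)"
  have half: "(1 / 2) powr \<theta> < (1 :: real)" using powr_less_mono2[of \<theta> "1 / 2" 1] \<theta> by simp
  have C5: "C5 \<ge> 0" "C1 + C5 * (1 / 2) powr \<theta> = C5"
  proof -
    show "C5 \<ge> 0" using C1 half by (simp add: C5_def)
    have "C5 * (1 - (1 / 2) powr \<theta>) = C1" using half \<theta>(1) by (simp add: C5_def)
    then show "C1 + C5 * (1 / 2) powr \<theta> = C5" by (simp add: right_diff_distrib)
  qed
  define J where "J t s = u t - S (t - s) (u s)" for t s
  \<comment> \<open>The step \<open>[s, s + \<tau>]\<close> followed by free evolution for time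
    \<open>\<tau>\<close>: the test vector becomes \<open>S \<tau> h\<close>, so an \<open>L\<close>
    on it costs \<open>1 / \<tau>\<close>, and the singularity of the drift stays at distance at
    least \<open>\<tau>\<close>.\<close>
  have J_half: "\<bar>inner (S \<tau> (J (s + \<tau>) s)) h\<bar> \<le> C1 * (2 * \<tau>) powr \<theta> * norm h"
    if h: "h \<in> D" and \<tau>: "\<tau> > 0" "0 \<le> s" "s + 2 * \<tau> \<le> T" for h s \<tau>
  proof -
    let ?f = "\<lambda>r. inner (z r) (S (s + 2 * \<tau> - r) (- L h))"
    have \<tau>T: "0 \<le> \<tau>" "\<tau> \<le> T" using \<tau> by auto
    have eq: "inner (S \<tau> (J (s + \<tau>) s)) h = mild_defect (S \<tau> h) s (s + \<tau>) + inner (S \<tau> (\<Xi> (s + \<tau>) s)) (S \<tau> h)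
        + integral {s..s + \<tau>} ?f"
    proof -
      have "integral {s..s + \<tau>} (\<lambda>r. inner (z r) (S (s + \<tau> - r) (- L (S \<tau> h)))) = integral {s..s + \<tau>} ?f"
        using \<tau> h by (intro Henstock_Kurzweil_Integration.integral_cong)
          (auto simp: S_D S_minus S_S algebra_simps)
      then show ?thesis using \<tau> by (simp add: mild_defect_def J_def inner_diff_left S_sym S_diff)
    qed
    have b1: "\<bar>mild_defect (S \<tau> h) s (s + \<tau>)\<bar> \<le> K4 * M' * (\<tau> powr \<theta> * norm h)"
    proof -
      have "\<bar>mild_defect (S \<tau> h) s (s + \<tau>)\<bar> \<le> K4 * M' * norm (L (S \<tau> h)) * (s + \<tau> - s) powr \<kappa>"
        using \<tau> by (intro mild_S) auto
      also have "\<dots> \<le> K4 * M' * (norm h / \<tau>) * (s + \<tau> - s) powr \<kappa>"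
        using K4 M'(1) S_in_D(2)[OF \<tau>(1)] by (intro mult_right_mono mult_left_mono) auto
      also have "\<dots> = K4 * M' * (\<tau> powr \<theta> * norm h)"
      proof -
        have e: "\<kappa> = \<theta> + 1" by (simp add: \<theta>_def field_simps)
        show ?thesis unfolding e powr_add using \<tau> by simp
      qed
      finally show ?thesis .
    qed
    have b2: "\<bar>inner (S \<tau> (\<Xi> (s + \<tau>) s)) (S \<tau> h)\<bar> \<le> C * T powr (\<gamma> - \<theta>) * (\<tau> powr \<theta> * norm h)"
    proof -
      have "\<bar>inner (S \<tau> (\<Xi> (s + \<tau>) s)) (S \<tau> h)\<bar> \<le> (C * \<tau> powr \<gamma>) * norm h"
        using \<tau> C \<Xi>_bound[of s "s + \<tau>"]
        by (intro order_trans[OF Cauchy_Schwarz_ineq2] mult_mono order_trans[OF norm_S_le]) auto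
      also have "\<dots> \<le> (C * (T powr (\<gamma> - \<theta>) * \<tau> powr \<theta>)) * norm h"
        using C \<tau>T \<theta> by (intro mult_right_mono mult_left_mono powr_le_powr_mult) auto
      finally show ?thesis by (simp add: mult.assoc)
    qed
    have b3: "\<bar>integral {s..s + \<tau>} ?f\<bar> \<le> Cz * T powr (1 / 3 - \<theta>) * (\<tau> powr \<theta> * norm h)"
    proof -
      have "\<bar>integral {s..s + \<tau>} ?f\<bar> \<le> (Cz * \<tau> powr (- 2 / 3) * norm h) * (s + \<tau> - s)"
      proof (rule abs_integral_le_const)
        show "?f integrable_on {s..s + \<tau>}" using \<tau> h by (intro conv') auto
        fix r assume r: "r \<in> {s..s + \<tau>}"
        have "\<bar>?f r\<bar> = \<bar>inner (- L (S (s + 2 * \<tau> - r) (z r))) h\<bar>"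
          using r \<tau> by (subst inner_LS_z[OF h]) auto
        also have "\<dots> \<le> (Cz * (s + 2 * \<tau> - r) powr (- 2 / 3)) * norm h"
          using r \<tau> LS_z_bound[of r "s + 2 * \<tau> - r"]
          by (intro order_trans[OF Cauchy_Schwarz_ineq2] mult_right_mono) auto
        also have "\<dots> \<le> (Cz * \<tau> powr (- 2 / 3)) * norm h"
          using r \<tau> Cz_nonneg by (intro mult_right_mono mult_left_mono powr_mono2') auto
        finally show "\<bar>?f r\<bar> \<le> Cz * \<tau> powr (- 2 / 3) * norm h" .
      qed (use \<tau> in auto)
      also have "\<dots> = Cz * \<tau> powr (1 / 3) * norm h"
        using \<tau> powr_add[of \<tau> "- 2 / 3" 1] by simp
      also have "\<dots> \<le> Cz * (T powr (1 / 3 - \<theta>) * \<tau> powr \<theta>) * norm h"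
        using Cz_nonneg \<tau>T \<theta> by (intro mult_right_mono mult_left_mono powr_le_powr_mult) auto
      finally show ?thesis by (simp add: mult.assoc)
    qed
    have "\<bar>inner (S \<tau> (J (s + \<tau>) s)) h\<bar> \<le> C1 * (\<tau> powr \<theta> * norm h)"
      using b1 b2 b3 unfolding eq C1_def by (simp add: distrib_right)
    also have "\<dots> \<le> C1 * ((2 * \<tau>) powr \<theta> * norm h)"
      using C1 \<tau> \<theta> by (intro mult_left_mono mult_right_mono powr_mono2) auto
    finally show ?thesis by (simp add: mult.assoc)
  qed
  text \<open>The weak bound of order $\gamma$ is only available in $\mathcal{H}_{-1}$; halving the interval
    towards its right end point moves it to shorter and shorter intervals.\<close>
  have J_iter: "\<bar>inner (J t s) h\<bar> \<le> C5 * (t - s) powr \<theta> * norm h + M * C * ((1 / 2) ^ n * (t - s)) powr \<gamma> * norm (L h)"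
    if h: "h \<in> D" and st: "0 \<le> s" "s < t" "t \<le> T" for h s t n
    using st
  proof (induction n arbitrary: s)
    case 0
    have "\<bar>inner (J t s) h\<bar> \<le> M * C * (t - s) powr \<gamma> * norm (L h)"
      using inner_increment_le[OF 0(1) _ 0(3) h, of h] 0 by (simp add: J_def)
    moreover have "0 \<le> C5 * (t - s) powr \<theta> * norm h" using C5 by simp
    ultimately show ?case by simp
  next
    case (Suc n)
    define \<tau> where "\<tau> = (t - s) / 2"
    have \<tau>: "\<tau> > 0" "t = s + 2 * \<tau>" using Suc.prems by (auto simp: \<tau>_def field_simps)
    have split: "J t s = J t (s + \<tau>) + S \<tau> (J (s + \<tau>) s)"
      using \<tau> Suc.prems by (simp add: J_def S_diff S_S)
    have "\<bar>inner (J t (s + \<tau>)) h\<bar> \<le> C5 * \<tau> powr \<theta> * norm h + M * C * ((1 / 2) ^ n * \<tau>) powr \<gamma> * norm (L h)"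
      using Suc.IH[of "s + \<tau>"] \<tau> Suc.prems by simp
    moreover have "\<bar>inner (S \<tau> (J (s + \<tau>) s)) h\<bar> \<le> C1 * (2 * \<tau>) powr \<theta> * norm h"
      using \<tau> Suc.prems by (intro J_half h) auto
    moreover have "C5 * \<tau> powr \<theta> * norm h + C1 * (2 * \<tau>) powr \<theta> * norm h = C5 * (2 * \<tau>) powr \<theta> * norm h"
    proof -
      have "\<tau> powr \<theta> = (1 / 2) powr \<theta> * (2 * \<tau>) powr \<theta>"
        using powr_mult[of "1 / 2" "2 * \<tau>" \<theta>] \<tau> by simp
      then have "C5 * \<tau> powr \<theta> + C1 * (2 * \<tau>) powr \<theta> = (C1 + C5 * (1 / 2) powr \<theta>) * (2 * \<tau>) powr \<theta>"
        by (simp add: distrib_right mult.assoc)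
      then show ?thesis unfolding C5(2) by (simp only: distrib_right[symmetric])
    qed
    ultimately have "\<bar>inner (J t s) h\<bar> \<le> C5 * (2 * \<tau>) powr \<theta> * norm h + M * C * ((1 / 2) ^ n * \<tau>) powr \<gamma> * norm (L h)"
      unfolding split inner_add_left by linarith
    moreover have "(1 / 2) ^ Suc n * (t - s) = (1 / 2) ^ n * \<tau>" "t - s = 2 * \<tau>"
      by (simp_all add: \<tau>_def)
    ultimately show ?case by simp
  qed
  have J_norm: "norm (J t s) \<le> C5 * (t - s) powr \<theta>" if st: "0 \<le> s" "s \<le> t" "t \<le> T" for s t
  proof (cases "s = t")
    case True
    then show ?thesis by (simp add: J_def)
  next
    case False
    with st have st': "0 \<le> s" "s < t" "t \<le> T" by auto
    show ?thesis
    proof (rule norm_le_of_inner_le_D)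
      fix h assume h: "h \<in> D"
      \<comment> \<open>As \<open>n\<close> grows, the term with \<open>L h\<close> disappears, and
        a bound by \<open>|h|\<close> on the dense set \<open>D\<close> remains.\<close>
      have "(\<lambda>n. C5 * (t - s) powr \<theta> * norm h + M * C * ((1 / 2) ^ n * (t - s)) powr \<gamma> * norm (L h))
          \<longlonglongrightarrow> C5 * (t - s) powr \<theta> * norm h + M * C * (0 * (t - s)) powr \<gamma> * norm (L h)"
        using \<gamma> st' by (intro tendsto_intros tendsto_powr' LIMSEQ_realpow_zero) auto
      moreover have "inner (J t s) h \<le> C5 * (t - s) powr \<theta> * norm h + M * C * ((1 / 2) ^ n * (t - s)) powr \<gamma> * norm (L h)" for n
        using J_iter[OF h st', of n] by linarith
      ultimately show "inner (J t s) h \<le> C5 * (t - s) powr \<theta> * norm h"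
        using LIMSEQ_le_const by force
    qed (use C5 in simp)
  qed
  have u_cont: "continuous_on {0..T} u"
    unfolding continuous_on_iff
  proof (intro ballI allI impI)
    fix t0 e :: real assume t0: "t0 \<in> {0..T}" and e: "e > 0"
    have "((\<lambda>d. C5 * (2 * d) powr \<theta>) \<longlongrightarrow> C5 * (2 * 0) powr \<theta>) (at_right 0)"
      using \<theta> by (intro tendsto_intros tendsto_powr') (auto simp: eventually_at_right_field intro!: exI[of _ 1])
    then have "\<forall>\<^sub>F d in at_right 0. C5 * (2 * d) powr \<theta> < e / 3"
      using \<theta> e by (intro order_tendstoD(2)) auto
    then obtain d0 where "d0 > 0" "\<And>d. 0 < d \<Longrightarrow> d < d0 \<Longrightarrow> C5 * (2 * d) powr \<theta> < e / 3"
      by (auto simp: eventually_at_right_field)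
    then obtain d where d: "d > 0" "C5 * (2 * d) powr \<theta> < e / 3" using dense by metis
    \<comment> \<open>A common starting time before \<open>t0\<close> and the nearby
      \<open>t\<close>, so that continuity from the left is covered as well.\<close>
    define r where "r = max 0 (t0 - d)"
    have r: "0 \<le> r" "r \<le> t0" "t0 - r \<le> d" using t0 d by (auto simp: r_def)
    have small: "norm (J t r) < e / 3" if "r \<le> t" "t \<le> T" "t - r \<le> 2 * d" for t
    proof -
      have "C5 * (t - r) powr \<theta> \<le> C5 * (2 * d) powr \<theta>"
        using that C5 \<theta> by (intro mult_left_mono powr_mono2) auto
      then show ?thesis using J_norm[OF r(1) that(1,2)] d(2) by linarith
    qed
    have "continuous_on {0..} (\<lambda>s. S s (u r))" by (rule continuous_on_S)
    then obtain d' where d': "d' > 0" "\<And>s. s \<ge> 0 \<Longrightarrow> dist s (t0 - r) < d' \<Longrightarrow> dist (S s (u r)) (S (t0 - r) (u r)) < e / 3"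
      unfolding continuous_on_iff using r e by (metis atLeast_iff diff_ge_0_iff_ge divide_pos_pos zero_less_numeral)
    show "\<exists>d>0. \<forall>t\<in>{0..T}. dist t t0 < d \<longrightarrow> dist (u t) (u t0) < e"
    proof (intro exI[of _ "min d d'"] conjI ballI impI)
      fix t assume t: "t \<in> {0..T}" "dist t t0 < min d d'"
      have rt: "r \<le> t" "t - r \<le> 2 * d" using t r d by (auto simp: r_def dist_real_def)
      have eq: "u t - u t0 = (J t r - J t0 r) + (S (t - r) (u r) - S (t0 - r) (u r))" by (simp add: J_def)
      have "norm (J t r) < e / 3" "norm (J t0 r) < e / 3"
        using small[of t] small[of t0] rt r t t0 d by auto
      moreover have "norm (S (t - r) (u r) - S (t0 - r) (u r)) < e / 3"
        using d'(2)[of "t - r"] rt t by (simp add: dist_norm)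
      ultimately have "norm (u t - u t0) < e"
        unfolding eq
        using norm_triangle_ineq[of "J t r - J t0 r" "S (t - r) (u r) - S (t0 - r) (u r)"] norm_triangle_ineq4[of "J t r" "J t0 r"]
        by linarith
      then show "dist (u t) (u t0) < e" by (simp add: dist_norm)
    qed (use d d' in auto)
  qed
  have y_cont: "continuous_on {0..T} y" by (rule y_continuous[OF u_cont])
  have int: "(\<lambda>r. dec S (S (t - r) (z r))) integrable_on {0..t}" if t: "0 \<le> t" "t \<le> T" for t
  proof (cases "t = 0")
    case True
    show ?thesis unfolding True using integrable_on_refl by (metis cbox_interval)
  next
    case False
    show ?thesis
    proof (rule integrable_on_Icc_of_continuous_dominated)
      show "0 < t" using t False by simp
      show "(\<lambda>r. (t - r) powr (- 2 / 3) * Cz) integrable_on {0..t}"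
        using t by (intro integrable_on_mult_left integrable_powr_at_end) auto
      show "norm (dec S (S (t - r) (z r))) \<le> (t - r) powr (- 2 / 3) * Cz" if "r \<in> {0<..<t}" for r
        using LS_z_bound[of r "t - r"] S_in_D(1)[of "t - r" "z r"] that t by (simp add: dec_D mult.commute)
      \<comment> \<open>Keeping a positive time \<open>c\<close> in reserve makes
        \<open>L S_c (-L)^(-b)\<close> a bounded operator acting on \<open>y r\<close>; the
        remaining propagator is strongly continuous. Every \<open>r < t\<close> is reached with
        \<open>c\<close> small enough.\<close>
      have cont: "continuous_on {0<..<t - c} (\<lambda>r. dec S (S (t - r) (z r)))" if c: "c > 0" for c
      proof -
        let ?B = "\<lambda>x. - L (S c (fracA S b x))"
        obtain K where K: "K \<ge> 0" "\<And>x \<sigma>. \<sigma> > 0 \<Longrightarrow> norm (L (S \<sigma> (fracA S b x))) \<le> K * \<sigma> powr (1 / 3 - 1) * norm x"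
          using norm_LS_fracA[of "1 / 3" b] b by auto
        have B: "bounded_linear ?B"
        proof (rule bounded_linear_intro[of _ "K * c powr (1 / 3 - 1)"])
          show "?B (x + y) = ?B x + ?B y" for x y
            using c b_pos by (simp add: fracA_add S_add L_add S_in_D(1))
          show "?B (r *\<^sub>R x) = r *\<^sub>R ?B x" for r x
            using c b_pos by (simp add: fracA_scaleR S_scaleR L_scaleR S_in_D(1))
          show "norm (?B x) \<le> norm x * (K * c powr (1 / 3 - 1))" for x
            using K(2)[OF c, of x] by (simp add: mult_ac)
        qed
        have "continuous_on {0<..<t - c} (\<lambda>r. S (t - c - r) (?B (y r)))"
          by (intro continuous_on_S_compose bounded_linear.continuous_on[OF B] continuous_on_subset[OF y_cont]
              continuous_intros) (use t c in auto)
        moreover have "S (t - c - r) (?B (y r)) = dec S (S (t - r) (z r))" if "r \<in> {0<..<t - c}" for r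
          using that c t L_S[of c "t - c - r" "z r"] S_in_D(1)[of "t - r" "z r"]
          by (simp add: z_eq[symmetric] dec_D S_minus)
        ultimately show ?thesis by (rule continuous_on_eq)
      qed
      show "continuous_on {0<..<t} (\<lambda>r. dec S (S (t - r) (z r)))"
      proof (rule continuous_at_imp_continuous_on, rule ballI)
        fix r assume r: "r \<in> {0<..<t}"
        have "continuous_on {0<..<t - (t - r) / 2} (\<lambda>r. dec S (S (t - r) (z r)))"
          using r by (intro cont) auto
        then show "isCont (\<lambda>r. dec S (S (t - r) (z r))) r"
          using r by (subst (asm) continuous_on_eq_continuous_at) (auto simp: field_simps)
      qed
    qed
  qed
  show ?thesis
    unfolding mild_def
  proof (intro ballI conjI)
    fix t assume "t \<in> {0..T}"
    then have t: "0 \<le> t" "t \<le> T" by auto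
    show "(\<lambda>r. dec S (S (t - r) (z r))) integrable_on {0..t}" by (rule int[OF t])
    let ?f = "\<lambda>r. dec S (S (t - r) (z r))"
    \<comment> \<open>The vector counterpart of \<open>W\<close>: its increments minus the germ,
      tested against \<open>(-L)^(-a) k\<close>, are mild defects.\<close>
    define V where "V s = S (t - s) (u s) - integral {0..s} ?f" for s
    have lin: "linear (fracA S a)" using a_bounds by (intro linear_fracA) auto
    have local: "norm (fracA S a (V q) - fracA S a (V r) - fracA S a (S (t - r) (\<Xi> q r))) \<le> K4 * (q - r) powr \<kappa>"
      if rq: "0 \<le> r" "r < q" "q \<le> t" for r q
    proof (rule norm_le_of_inner_le_D2)
      fix k assume k: "k \<in> D2"
      define h where "h = fracA S a k"
      have h: "h \<in> D" using D2_fracA[OF a0(1) k] by (simp add: h_def D2_def)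
      have intx: "?f integrable_on {0..x}" if "x \<le> t" for x
        by (rule integrable_on_subinterval_complete[OF int[OF t]]) (use that in auto)
      have "inner (integral {0..q} ?f) h - inner (integral {0..r} ?f) h = integral {r..q} (\<lambda>s. inner (?f s) h)"
        using Henstock_Kurzweil_Integration.integral_combine[OF _ _ inner_integral_left(1)[OF intx], of r q h] rq
        by (simp add: inner_integral_left(2)[OF intx, symmetric])
      also have "\<dots> = integral {r..q} (\<lambda>s. inner (z s) (S (q - s) (- L (S (t - q) h))))"
      proof (rule integral_spike[OF negligible_sing[of t]])
        show "inner (z s) (S (q - s) (- L (S (t - q) h))) = inner (?f s) h" if s: "s \<in> {r..q} - {t}" for s
        proof -
          have "S (q - s) (- L (S (t - q) h)) = S (t - s) (- L h)"
            using s rq h by (simp add: S_D S_minus S_S)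
          then show ?thesis using inner_dec_S_z[OF h, of "t - s" s] s rq by auto
        qed
      qed
      finally have I: "inner (integral {0..q} ?f) h - inner (integral {0..r} ?f) h = integral {r..q} (\<lambda>s. inner (z s) (S (q - s) (- L (S (t - q) h))))" .
      have "inner (fracA S a (V q) - fracA S a (V r) - fracA S a (S (t - r) (\<Xi> q r))) k
          = inner (V q - V r - S (t - r) (\<Xi> q r)) h"
        using a0 by (simp add: h_def fracA_inner_sym inner_diff_left)
      moreover have "inner (V q - V r - S (t - r) (\<Xi> q r)) h = mild_defect (S (t - q) h) r q"
        using rq I by (simp add: V_def mild_defect_def inner_diff_left S_sym S_S)
      moreover have "S (t - q) h = fracA S a (S (t - q) k)"
        using rq a0 by (simp add: h_def fracA_S)
      ultimately have eq: "inner (fracA S a (V q) - fracA S a (V r) - fracA S a (S (t - r) (\<Xi> q r))) k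
          = mild_defect (fracA S a (S (t - q) k)) r q" by simp
      have "\<bar>mild_defect (fracA S a (S (t - q) k)) r q\<bar> \<le> K4 * norm (S (t - q) k) * (q - r) powr \<kappa>"
        using rq t k by (intro mild_local D2_S) auto
      also have "\<dots> \<le> K4 * norm k * (q - r) powr \<kappa>"
        using rq K4 norm_S_le[of "t - q" k] by (intro mult_right_mono mult_left_mono) auto
      finally show "\<bar>inner (fracA S a (V q) - fracA S a (V r) - fracA S a (S (t - r) (\<Xi> q r))) k\<bar>
          \<le> K4 * (q - r) powr \<kappa> * norm k"
        unfolding eq by (simp add: mult_ac)
    qed (use K4 in simp)
    have "additive_approx 0 t (\<lambda>s. fracA S a (V s)) (\<lambda>q r. fracA S a (S (t - r) (\<Xi> q r)))"
      by (rule additive_approx_of_powr[OF \<kappa>(1) K4 local])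
    from rs_limit_of_additive_approx[OF t(1) this]
    have lim: "rs_limit t (\<lambda>q r. S (t - r) (\<Xi> q r)) (fracA S a) (fracA S a (V t) - fracA S a (V 0))"
      by (simp add: rs_limit_linear[OF lin])
    have "fracA S a (u t) = fracA S a (S t (u 0) + integral {0..t} ?f) + (fracA S a (V t) - fracA S a (V 0))"
      by (simp add: V_def linear_diff[OF lin] linear_add[OF lin])
    with lim show "\<exists>v. rs_limit t (\<lambda>q r. S (t - r) (\<Xi> q r)) (fracA S a) v \<and>
       fracA S a (u t) = fracA S a (S t (u 0) + integral {0..t} ?f) + v" by blast
  qed
qed

end

section \<open>The given nonlinearities as an instance\<close>

lemma (in selfadjoint_semigroup) Poly0_class_coord:
  assumes N: "Poly0_class S 0 n (- \<delta>) Nc" and \<delta>: "\<delta> \<le> 1"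
  defines "y \<equiv> \<lambda>v. coord (1 - \<delta>) (Nc (enc S v))"
  shows "Nc (enc S v) = fracA S (1 - \<delta>) (y v)"
    and "\<exists>C. \<forall>v. norm v \<le> R \<longrightarrow> norm (y v) \<le> C"
    and "continuous_on UNIV y"
proof -
  have e: "0 + 1 = (1 :: real)" "0 + (- \<delta>) + 1 = 1 - \<delta>" by auto
  have b: "1 - \<delta> \<ge> 0" using \<delta> by simp
  have H: "(\<forall>x\<in>Hsp S 1. Nc x \<in> Hsp S (1 - \<delta>))"
     "(\<forall>x\<in>Hsp S 1. \<forall>\<epsilon>>0. \<exists>\<eta>>0. \<forall>y\<in>Hsp S 1. nrm S 1 (y - x) < \<eta> \<longrightarrow> nrm S (1 - \<delta>) (Nc y - Nc x) < \<epsilon>)"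
     "(\<forall>R. \<exists>C. \<forall>x\<in>Hsp S 1. nrm S 1 x \<le> R \<longrightarrow> nrm S (1 - \<delta>) (Nc x) \<le> C)"
    using N[unfolded Poly0_class_def, THEN spec, of 0, THEN mp, OF order_refl, unfolded e] by blast+
  have enc_Hsp: "enc S v \<in> Hsp S 1" and nrm_enc: "nrm S 1 (enc S v) = norm v" for v
    by (simp_all add: enc_def)
  have Nc_Hsp: "Nc (enc S v) \<in> Hsp S (1 - \<delta>)" for v using H(1) enc_Hsp by blast
  show "Nc (enc S v) = fracA S (1 - \<delta>) (y v)"
    using Nc_Hsp b by (simp add: y_def)
  obtain C where C: "\<And>x. x \<in> Hsp S 1 \<Longrightarrow> nrm S 1 x \<le> R \<Longrightarrow> nrm S (1 - \<delta>) (Nc x) \<le> C"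
    using H(3) by blast
  then show "\<exists>C. \<forall>v. norm v \<le> R \<longrightarrow> norm (y v) \<le> C"
    using enc_Hsp nrm_enc unfolding y_def nrm_eq_coord[symmetric] by metis
  show "continuous_on UNIV y"
    unfolding continuous_on_iff
  proof (intro ballI allI impI)
    fix v and e :: real assume "e > 0"
    then obtain \<eta> where \<eta>: "\<eta> > 0" "\<And>x. x \<in> Hsp S 1 \<Longrightarrow> nrm S 1 (x - enc S v) < \<eta> \<Longrightarrow> nrm S (1 - \<delta>) (Nc x - Nc (enc S v)) < e"
      using H(2) enc_Hsp by blast
    have "dist (y w) (y v) < e" if "dist w v < \<eta>" for w
    proof -
      have "enc S w - enc S v = enc S (w - v)" by (simp add: enc_def fracA_diff)
      then have "nrm S (1 - \<delta>) (Nc (enc S w) - Nc (enc S v)) < e"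
        using that by (intro \<eta>(2) enc_Hsp) (simp add: nrm_enc dist_norm)
      then show ?thesis
        using b Nc_Hsp by (simp add: y_def dist_norm nrm_eq_coord coord_diff)
    qed
    with \<eta>(1) show "\<exists>d>0. \<forall>w\<in>UNIV. dist w v < d \<longrightarrow> dist (y w) (y v) < e" by blast
  qed
qed

theorem theorem6p3:
  fixes L :: "'h::{real_inner, complete_space} \<Rightarrow> 'h" and D :: "'h set"
    and S :: "real \<Rightarrow> 'h \<Rightarrow> 'h"
    and \<gamma> T \<delta> :: real and n :: nat
    and X :: "real \<Rightarrow> real \<Rightarrow> real ^ 'd" and XX :: "real \<Rightarrow> real \<Rightarrow> real ^ 'd ^ 'd"
    and \<xi> :: 'h
    and Fc :: "'h \<Rightarrow> 'h ^ 'd" and DF :: "'h \<Rightarrow> 'h \<Rightarrow> 'h ^ 'd"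
    and Nc :: "'h \<Rightarrow> 'h" and u :: "real \<Rightarrow> 'h"
  assumes separable: "\<exists>Q::'h set. countable Q \<and> closure Q = UNIV"
    and L: "neg_selfadjoint L D"
    and S: "generates L D S"
    and gamma: "1/3 < \<gamma>" "\<gamma> \<le> 1/2"
    and rough: "rough_path_Rplus \<gamma> X XX"
    and T: "T > 0"
    and F: "C2_class S (- 2 * \<gamma>) 0 Fc DF"
    and N: "Poly0_class S 0 n (- \<delta>) Nc"
    and n: "n \<ge> 1"
    and delta: "1 - \<delta> > \<gamma>"
    and ctrl: "controlled S T \<gamma> X u (\<lambda>t. Fu S Fc (u t))"
    and init: "u 0 = \<xi>"
  shows "mild_solution L S T \<gamma> X XX Fc DF Nc \<xi> u \<longleftrightarrow> weak_solution L S T X XX Fc DF Nc u"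
proof -
  interpret selfadjoint_semigroup L D S
    by unfold_locales (rule L S)+
  have "rough_path T \<gamma> X XX" using rough T by (simp add: rough_path_Rplus_def)
  from rough_germ_estimates[OF this T gamma F ctrl]
  obtain C1 where C1: "C1 \<ge> 0"
    "\<And>t. 0 \<le> t \<Longrightarrow> t \<le> T \<Longrightarrow> norm (u t) \<le> C1"
    "\<And>s t. 0 \<le> s \<Longrightarrow> s \<le> t \<Longrightarrow> t \<le> T \<Longrightarrow> norm (fracA S (2 * \<gamma>) (u t - S (t - s) (u s))) \<le> C1 * (t - s) powr \<gamma>"
    "\<And>r q. 0 \<le> r \<Longrightarrow> r \<le> q \<Longrightarrow> q \<le> T \<Longrightarrow> norm (rough_germ X XX Fc DF u q r) \<le> C1 * (q - r) powr \<gamma>"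
    "\<And>r m q. 0 \<le> r \<Longrightarrow> r \<le> m \<Longrightarrow> m \<le> q \<Longrightarrow> q \<le> T \<Longrightarrow>
      norm (fracA S (2 * \<gamma>) (rough_germ X XX Fc DF u q r - rough_germ X XX Fc DF u q m - rough_germ X XX Fc DF u m r))
        \<le> C1 * (q - r) powr ((1 + 3 * \<gamma>) / 2)"
    by blast
  have \<delta>: "\<delta> \<le> 1" using delta gamma by simp
  note Ncoord = Poly0_class_coord[OF N \<delta>]
  define y where "y v = coord (1 - \<delta>) (Nc (enc S v))" for v
  \<comment> \<open>\<open>u\<close> stays in the ball of radius \<open>C1\<close>, on which the
    drift is bounded.\<close>
  obtain C2 where C2: "\<And>v. norm v \<le> C1 \<Longrightarrow> norm (y v) \<le> C2"
    using Ncoord(2)[of C1] unfolding y_def by blast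
  define C where "C = max C1 C2"
  have C: "C1 \<le> C" "C2 \<le> C" by (auto simp: C_def)
  have le: "C1 * x powr p \<le> C * x powr p" for x p using C(1) by (intro mult_right_mono) auto
  interpret mild_weak_setting L D S \<gamma> T C "2 * \<gamma>" "1 - \<delta>" u "\<lambda>r. Nc (enc S (u r))" "\<lambda>r. y (u r)"
    "rough_germ X XX Fc DF u"
  proof unfold_locales
    show "C \<ge> 0" using C C1(1) by simp
    show "1 - \<delta> > 1 / 3" using delta gamma by simp
    show "norm (u t) \<le> C" if "0 \<le> t" "t \<le> T" for t using C1(2)[OF that] C(1) by simp
    show "norm (y (u t)) \<le> C" if "0 \<le> t" "t \<le> T" for t using C2[OF C1(2)[OF that]] C(2) by simp
    show "Nc (enc S (u r)) = fracA S (1 - \<delta>) (y (u r))" for r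
      unfolding y_def by (rule Ncoord(1))
    show "continuous_on {0..T} (\<lambda>r. y (u r))" if "continuous_on {0..T} u"
      using continuous_on_compose2[OF Ncoord(3) that] by (simp add: y_def)
    show "norm (fracA S (2 * \<gamma>) (u t - S (t - s) (u s))) \<le> C * (t - s) powr \<gamma>"
      if "0 \<le> s" "s \<le> t" "t \<le> T" for s t
      by (rule order_trans[OF C1(3)[OF that] le])
    show "norm (rough_germ X XX Fc DF u q r) \<le> C * (q - r) powr \<gamma>" if "0 \<le> r" "r \<le> q" "q \<le> T" for r q
      by (rule order_trans[OF C1(4)[OF that] le])
    show "norm (fracA S (2 * \<gamma>) (rough_germ X XX Fc DF u q r - rough_germ X XX Fc DF u q m - rough_germ X XX Fc DF u m r))
        \<le> C * (q - r) powr ((1 + 3 * \<gamma>) / 2)" if "0 \<le> r" "r \<le> m" "m \<le> q" "q \<le> T" for r m q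
      by (rule order_trans[OF C1(5)[OF that] le])
  qed (use gamma T in auto)
  have "mild_solution L S T \<gamma> X XX Fc DF Nc \<xi> u \<longleftrightarrow> mild"
    by (simp add: mild_solution_def mild_def rough_germ_def init)
  \<comment> \<open>\<open>Hsp_1\<close> identifies the test space \<open>H_1\<close> with
    \<open>D\<close>; the sums in the germ are pulled out of the inner product.\<close>
  moreover have "weak_solution L S T X XX Fc DF Nc u \<longleftrightarrow> weak"
    by (simp add: weak_solution_def weak_def rough_germ_def Hsp_1 inner_add_left inner_sum_left)
  moreover have "mild \<longleftrightarrow> weak"
    using mild_imp_weak weak_imp_mild by blast
  ultimately show ?thesis by blast
qed

end
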